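(* Let $f$ be a meromorphic function in $\mathbb{C}$ (transcendental, or rational of degree at least two) in Class $\mathcal{B}$, that is, $\mathrm{sing}(f^{-1})$ is bounded, and suppose that the Julia set of $f$ is connected and locally connected. If the Fatou set of $f$ has exactly two components, then $\infty$ is not an asymptotic value of $f$.
   Context: The Fatou set $\mathcal{F}_f$ is the set of $z\in\widehat{\mathbb{C}}=\mathbb{C}\cup\{\infty\}$ having a neighborhood on which all iterates $f^n$ are well defined and form a normal family; the Julia set is $\widehat{\mathcal{J}}_f=\widehat{\mathbb{C}}\setminus\mathcal{F}_f$. $\mathrm{sing}(f^{-1})$ is the closure in $\mathbb{C}$ of the set of finite critical and asymptotic values of $f$. A value $a\in\widehat{\mathbb{C}}$ is an asymptotic value of $f$ if there is a curve in $\mathbb{C}$ tending to $\infty$ along which $f$ tends to $a$ (a rational function has no asymptotic values by convention). *)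

theory Defs
  imports
    "HOL-Complex_Analysis.Complex_Analysis"
    "HOL-Computational_Algebra.Computational_Algebra"
begin

text \<open>
  Points of the Riemann sphere are values of type \<^typ>\<open>complex option\<close>, with \<^const>\<open>None\<close> as the
  point at infinity.
\<close>

abbreviation riemann_sphere :: "complex option topology" where
  "riemann_sphere \<equiv> Alexandroff_compactification euclidean"

text \<open>Stereographic projection onto the unit sphere, the point at infinity being the north pole.
  The Euclidean distance between projected points is the chordal metric, which is equivalent to the
  spherical metric.\<close>

fun stereographic :: "complex option \<Rightarrow> complex \<times> real" where
  "stereographic None = (0, 1)"
| "stereographic (Some z) =
     (2 * z / of_real (1 + (norm z)\<^sup>2), ((norm z)\<^sup>2 - 1) / ((norm z)\<^sup>2 + 1))"

text \<open>Locally uniform convergence on \<open>U\<close> is expressed as uniform convergence on compact subsets;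
  the constant \<open>\<infinity>\<close> is an admissible limit.\<close>

definition normal_family_on ::
    "complex option set \<Rightarrow> (complex option \<Rightarrow> complex option) set \<Rightarrow> bool" where
  "normal_family_on U \<F> \<longleftrightarrow>
     (\<forall>s :: nat \<Rightarrow> complex option \<Rightarrow> complex option. range s \<subseteq> \<F> \<longrightarrow>
       (\<exists>(r :: nat \<Rightarrow> nat) g. strict_mono r \<and>
         (\<forall>K. compactin riemann_sphere K \<and> K \<subseteq> U \<longrightarrow>
           uniform_limit K (\<lambda>n x. stereographic (s (r n) x)) (\<lambda>x. stereographic (g x)) sequentially)))"

definition rational_of_degree :: "(complex \<Rightarrow> complex) \<Rightarrow> nat \<Rightarrow> bool" where
  "rational_of_degree f d \<longleftrightarrow>
     (\<exists>p q :: complex poly. q \<noteq> 0 \<and> coprime p q \<and> d = max (degree p) (degree q) \<and>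
        (\<forall>z. poly q z \<noteq> 0 \<longrightarrow> f z = poly p z / poly q z))"

definition rational_function :: "(complex \<Rightarrow> complex) \<Rightarrow> bool" where
  "rational_function f \<longleftrightarrow> (\<exists>d. rational_of_degree f d)"

text \<open>
  A meromorphic function in the plane is given by \<open>f :: complex \<Rightarrow> complex\<close> with
  \<open>f nicely_meromorphic_on UNIV\<close>: all removable singularities are removed, and \<open>f\<close> has the dummy
  value \<open>0\<close> at its poles. The function \<open>sphere_map f\<close> is the associated map into the sphere. It is
  meaningful only on \<open>sphere_domain f\<close>: a rational function extends to infinity, a transcendental
  one does not.
\<close>

definition sphere_domain :: "(complex \<Rightarrow> complex) \<Rightarrow> complex option set" where
  "sphere_domain f = (if rational_function f then UNIV else range Some)"

fun sphere_map :: "(complex \<Rightarrow> complex) \<Rightarrow> complex option \<Rightarrow> complex option" where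
  "sphere_map f (Some z) = (if is_pole f z then None else Some (f z))"
| "sphere_map f None =
     (if filterlim f at_infinity at_infinity then None else Some (Lim at_infinity f))"

definition iterate_defined_at :: "(complex \<Rightarrow> complex) \<Rightarrow> nat \<Rightarrow> complex option \<Rightarrow> bool" where
  "iterate_defined_at f n x \<longleftrightarrow> (\<forall>k<n. (sphere_map f ^^ k) x \<in> sphere_domain f)"

definition fatou_set :: "(complex \<Rightarrow> complex) \<Rightarrow> complex option set" where
  "fatou_set f =
     {x. \<exists>U. openin riemann_sphere U \<and> x \<in> U \<and>
           (\<forall>n. \<forall>y\<in>U. iterate_defined_at f n y) \<and>
           normal_family_on U (range (\<lambda>n. sphere_map f ^^ n))}"

definition julia_set :: "(complex \<Rightarrow> complex) \<Rightarrow> complex option set" where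
  "julia_set f = UNIV - fatou_set f"

definition asymptotic_value :: "(complex \<Rightarrow> complex) \<Rightarrow> complex option \<Rightarrow> bool" where
  "asymptotic_value f a \<longleftrightarrow>
     \<not> rational_function f \<and>
     (\<exists>\<gamma> :: real \<Rightarrow> complex. continuous_on {0..} \<gamma> \<and> filterlim \<gamma> at_infinity at_top \<and>
        limitin riemann_sphere (\<lambda>t. sphere_map f (Some (\<gamma> t))) a at_top)"

text \<open>A rational function may have a critical point at infinity; the second set contains its value
  there if that value is finite, using the coordinate \<open>w = 1/z\<close> near infinity. Multiple poles are
  critical points too, but with the value infinity.\<close>

definition finite_critical_values :: "(complex \<Rightarrow> complex) \<Rightarrow> complex set" where
  "finite_critical_values f =
     {f c | c. \<not> is_pole f c \<and> deriv f c = 0} \<union>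
     {a. rational_function f \<and> sphere_map f None = Some a \<and>
         deriv (\<lambda>w. if w = 0 then a else f (inverse w)) 0 = 0}"

definition sing_inverse :: "(complex \<Rightarrow> complex) \<Rightarrow> complex set" where
  "sing_inverse f = closure (finite_critical_values f \<union> {a. asymptotic_value f (Some a)})"

definition class_B :: "(complex \<Rightarrow> complex) \<Rightarrow> bool" where
  "class_B f \<longleftrightarrow> bounded (sing_inverse f)"

end

theory Submission
  imports Defs
begin

text \<open>
  Suppose that infinity is an asymptotic value. Then \<open>f\<close> is transcendental, infinity lies in the Julia
  set, and since \<open>f\<close> is in class B it has a logarithmic tract: there is an injective holomorphic map \<open>G\<close>
  of a right half-plane into the plane with \<open>f (G z) = exp z\<close> and \<open>G z \<longlonglongrightarrow> \<infinity>\<close> as \<open>Re z \<longlonglongrightarrow> \<infinity>\<close>.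
  A transcendental \<open>f\<close> takes values in every open set arbitrarily near infinity, so the two Fatou
  components are permuted by \<open>f\<close> and both are unbounded; say \<open>A\<close> and \<open>A'\<close> are the components whose
  preimages are \<open>U\<close> and \<open>U'\<close>. Local connectedness of the Julia set lets one go to infinity inside \<open>A\<close>.
  Lifting such a path by \<open>exp\<close> and translating it by multiples of \<open>2 * pi * \<i>\<close> gives infinitely many
  ends of \<open>U\<close> in the tract, with points of \<open>U'\<close> between any two consecutive ones. The paths to two
  consecutive ends, joined inside \<open>U\<close>, separate the points of the connected set \<open>U'\<close> that is disjoint
  from \<open>U\<close>, a contradiction.
\<close>

section \<open>Access to infinity in a domain with locally connected boundary\<close>

text \<open>Two obstacles shape the proof. No curve in \<open>A\<close> tending to infinity is
  constructed. It is enough to have points \<open>p n\<close> such that \<open>p n\<close> and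
  \<open>p (Suc n)\<close> are connected in \<open>A\<close> outside larger and larger discs, and a
  pigeonhole argument yields them once only finitely many components of \<open>A\<close> outside a
  disc reach far out. Secondly, the separating curve would run through infinity. It is therefore cut
  off by a vertical segment at real part greater than \<open>n\<close>. The image of this segment
  under \<open>G\<close> escapes to infinity, so a given path in \<open>U'\<close> avoids it for
  large \<open>n\<close>; how large depends on the path, and the winding numbers are afterwards
  shown to be independent of \<open>n\<close>.

  The tract is a lift of \<open>exp\<close> through \<open>f\<close>, which has no singular values
  outside a disc. If such a lift does not tend to infinity, it winds periodically around a pole of
  \<open>f\<close>, and the asymptotic curve excludes that. If it tends to infinity but is periodic,
  it covers a neighborhood of infinity, and density of the values of \<open>f\<close> excludes that.

  That \<open>f\<close> permutes finitely many components means that the preimage of a component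
  lies in a single one. So every lift of \<open>A\<close> lies in the connected set
  \<open>U\<close>, and every lift of \<open>A'\<close> in \<open>U'\<close>.\<close>

lemma arc_hull_of_closed_set:
  fixes c :: "real \<Rightarrow> complex"
  assumes "a \<le> b" and contc: "continuous_on {a..b} c" and inj: "inj_on c {a..b}" and "closed J"
  obtains K Q1 Q2 where "compact K" "connected K" "connected Q1" "connected Q2"
    "c ` {a..b} = K \<union> Q1 \<union> Q2" "Q1 \<inter> J = {}" "Q2 \<inter> J = {}" "K \<inter> {c a, c b} \<subseteq> J"
    "K \<noteq> {} \<Longrightarrow> c ` {a..b} \<inter> J \<noteq> {}"
proof (cases "c ` {a..b} \<inter> J = {}")
  case True
  show ?thesis
  proof (rule that [of "{}" "c ` {a..b}" "{}"])
    show "connected (c ` {a..b})"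
      using contc connected_continuous_image connected_Icc by blast
  qed (use True in auto)
next
  case False
  \<comment> \<open>The hull \<open>K\<close> runs from the first to the last parameter with value
    in \<open>J\<close>; the pieces before and after it miss \<open>J\<close> and stay connected. An
    endpoint of the arc lies in \<open>K\<close> only if it is itself that first or last point, and
    then it is in \<open>J\<close>. Hence hulls of adjacent arcs will meet inside
    \<open>J\<close>.\<close>
  define Z where "Z = {a..b} \<inter> c -` J"
  have "closed Z"
    unfolding Z_def by (rule continuous_closed_preimage [OF contc]) (auto simp: \<open>closed J\<close>)
  then have "compact Z"
    unfolding compact_eq_bounded_closed by (auto simp: Z_def intro: bounded_subset [of "{a..b}"])
  have "Z \<noteq> {}"
    using False by (auto simp: Z_def)
  obtain s where s: "s \<in> Z" "\<And>t. t \<in> Z \<Longrightarrow> s \<le> t"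
    using compact_attains_inf [OF \<open>compact Z\<close> \<open>Z \<noteq> {}\<close>] by auto
  obtain s' where s': "s' \<in> Z" "\<And>t. t \<in> Z \<Longrightarrow> t \<le> s'"
    using compact_attains_sup [OF \<open>compact Z\<close> \<open>Z \<noteq> {}\<close>] by auto
  have ab: "a \<le> s" "s \<le> s'" "s' \<le> b" "c s \<in> J" "c s' \<in> J"
    using s s' by (auto simp: Z_def)
  have cont: "continuous_on X c" if "X \<subseteq> {a..b}" for X
    using contc that continuous_on_subset by blast
  show ?thesis
  proof (rule that [of "c ` {s..s'}" "c ` {a..<s}" "c ` {s'<..b}"])
    show "compact (c ` {s..s'})"
      by (rule compact_continuous_image [OF cont]) (use ab in auto)
    show "connected (c ` {s..s'})" "connected (c ` {a..<s})" "connected (c ` {s'<..b})"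
      by (rule connected_continuous_image [OF cont]; use ab in auto)+
    show "c ` {a..b} = c ` {s..s'} \<union> c ` {a..<s} \<union> c ` {s'<..b}"
      unfolding image_Un [symmetric] by (rule arg_cong [where f = "image c"]) (use ab in auto)
    show "c ` {a..<s} \<inter> J = {}"
    proof -
      have "c t \<notin> J" if "a \<le> t" "t < s" for t
        using that s(2) [of t] ab by (auto simp: Z_def)
      then show ?thesis by auto
    qed
    show "c ` {s'<..b} \<inter> J = {}"
    proof -
      have "c t \<notin> J" if "t \<le> b" "s' < t" for t
        using that s'(2) [of t] ab by (auto simp: Z_def)
      then show ?thesis by auto
    qed
    show "c ` {s..s'} \<inter> {c a, c b} \<subseteq> J"
    proof -
      have "c t \<in> J" if "t \<in> {s..s'}" "c t = c a \<or> c t = c b" for t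
      proof -
        have "t = a \<or> t = b"
          using that inj ab \<open>a \<le> b\<close> by (auto simp: inj_on_def)
        then have "t = s \<or> t = s'"
          using that ab by auto
        then show ?thesis using ab by auto
      qed
      then show ?thesis by (intro subsetI) (elim IntE imageE, simp)
    qed
  qed (use False in auto)
qed

text \<open>The number \<open>e\<close> will be a Lebesgue number, so that each nonempty hull fits
  into a ball where \<open>J\<close> is controlled by a small connected set. Hulls overlapping only
  inside \<open>J\<close> is what keeps the intersection in Janiszewski's theorem connected.\<close>

lemma circle_arcs:
  assumes "0 < R" "0 < e" and "closed J"
  obtains M :: nat and K Q :: "nat \<Rightarrow> complex set" and Q' :: "nat \<Rightarrow> complex set" where
    "\<And>i. i < M \<Longrightarrow> compact (K i)" "\<And>i. i < M \<Longrightarrow> connected (K i)"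
    "\<And>i. i < M \<Longrightarrow> connected (Q i)" "\<And>i. i < M \<Longrightarrow> connected (Q' i)"
    "sphere 0 R = (\<Union>i<M. K i \<union> Q i \<union> Q' i)"
    "\<And>i. i < M \<Longrightarrow> Q i \<inter> J = {}" "\<And>i. i < M \<Longrightarrow> Q' i \<inter> J = {}"
    "\<And>i j. i < M \<Longrightarrow> j < M \<Longrightarrow> i \<noteq> j \<Longrightarrow> K i \<inter> K j \<subseteq> J"
    "\<And>i. i < M \<Longrightarrow> K i \<noteq> {} \<Longrightarrow> \<exists>y\<in>J \<inter> sphere 0 R. K i \<subseteq> ball y e"
proof -
  define c where "c = circlepath (0::complex) R"
  have sc: "simple_path c" and pc: "path_image c = sphere 0 R"
    using \<open>0 < R\<close> by (auto simp: c_def simple_path_circlepath)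
  have contc: "continuous_on {0..1} c"
    using sc by (simp add: simple_path_def path_def)
  have injc: "x = y \<or> x = 0 \<and> y = 1 \<or> x = 1 \<and> y = 0" if "c x = c y" "x \<in> {0..1}" "y \<in> {0..1}" for x y
    using sc that by (auto simp: simple_path_def loop_free_def)
  have "uniformly_continuous_on {0..1} c"
    by (simp add: compact_uniformly_continuous contc)
  then obtain \<delta> where \<delta>: "\<delta> > 0" "\<And>x y. \<lbrakk>x \<in> {0..1}; y \<in> {0..1}; dist x y < \<delta>\<rbrakk> \<Longrightarrow> dist (c x) (c y) < e"
    using \<open>0 < e\<close> unfolding uniformly_continuous_on_def by metis
  obtain M0 where M0: "inverse (real (Suc M0)) < \<delta>"
    using reals_Archimedean \<delta>(1) by blast
  \<comment> \<open>At least two intervals are needed: each then has length below 1, so the closed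
    curve \<open>c\<close> is injective on it although \<open>c 0 = c 1\<close>.\<close>
  define M where "M = M0 + 2"
  have M: "1 / real M < \<delta>" "M \<ge> 2"
  proof -
    have "1 / real M \<le> inverse (real (Suc M0))"
      by (simp add: M_def field_simps)
    then show "1 / real M < \<delta>" "M \<ge> 2" using M0 by (auto simp: M_def)
  qed
  define I where "I i = {real i / real M..real (Suc i) / real M}" for i
  have I01: "I i \<subseteq> {0..1}" if "i < M" for i
    using that M by (auto simp: I_def field_simps)
  have Icov: "{0..1} = (\<Union>i<M. I i)"
  proof
    show "(\<Union>i<M. I i) \<subseteq> {0..1}" using I01 by blast
    show "{0..1} \<subseteq> (\<Union>i<M. I i)"
    proof
      fix t :: real assume t: "t \<in> {0..1}"
      show "t \<in> (\<Union>i<M. I i)"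
      proof (cases "t = 1")
        case True
        then have "t \<in> I (M - 1)" "M - 1 < M"
          using M by (auto simp: I_def field_simps of_nat_diff)
        then show ?thesis by blast
      next
        case False
        define i where "i = nat \<lfloor>t * real M\<rfloor>"
        have "t * real M < real M"
          using t False M by auto
        then have "i < M"
          using t M unfolding i_def by (simp add: nat_less_iff floor_less_iff)
        moreover have "real i \<le> t * real M" "t * real M \<le> real (Suc i)"
          using t unfolding i_def by (simp_all, linarith+)
        then have "t \<in> I i"
          using M by (auto simp: I_def field_simps)
        ultimately show ?thesis by blast
      qed
    qed
  qed
  have injI: "inj_on c (I i)" if "i < M" for i
  proof (rule inj_onI)
    fix x y assume xy: "x \<in> I i" "y \<in> I i" "c x = c y"
    have "dist x y < 1"
    proof -
      have "dist x y \<le> 1 / real M"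
        using xy M unfolding I_def dist_real_def by (auto simp: field_simps abs_le_iff)
      also have "\<dots> < 1" using M by (simp add: field_simps)
      finally show ?thesis .
    qed
    moreover have "x \<in> {0..1}" "y \<in> {0..1}"
      using xy I01 [OF that] by blast+
    ultimately show "x = y"
      using injc [OF xy(3)] by (auto simp: dist_real_def)
  qed
  define \<Phi> where "\<Phi> i K Q1 Q2 \<longleftrightarrow> compact K \<and> connected K \<and> connected Q1 \<and> connected Q2 \<and>
    c ` I i = K \<union> Q1 \<union> Q2 \<and> Q1 \<inter> J = {} \<and> Q2 \<inter> J = {} \<and> K \<inter> {c (real i / real M), c (real (Suc i) / real M)} \<subseteq> J \<and>
    (K \<noteq> {} \<longrightarrow> c ` I i \<inter> J \<noteq> {})" for i K Q1 Q2
  have ex: "\<exists>K Q1 Q2. \<Phi> i K Q1 Q2" if "i < M" for i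
  proof -
    have "real i / real M \<le> real (Suc i) / real M" 
      using M by (simp add: field_simps)
    moreover have "continuous_on (I i) c"
      using contc I01 [OF that] continuous_on_subset by blast
    ultimately show ?thesis
      using arc_hull_of_closed_set [of "real i / real M" "real (Suc i) / real M" c J] injI [OF that] \<open>closed J\<close>
      unfolding I_def \<Phi>_def by metis
  qed
  then obtain K Q Q' where \<Phi>: "\<And>i. i < M \<Longrightarrow> \<Phi> i (K i) (Q i) (Q' i)"
    by metis
  have KQ: "\<And>i. i < M \<Longrightarrow> compact (K i)" "\<And>i. i < M \<Longrightarrow> connected (K i)"
    "\<And>i. i < M \<Longrightarrow> connected (Q i)" "\<And>i. i < M \<Longrightarrow> connected (Q' i)"
    "\<And>i. i < M \<Longrightarrow> c ` I i = K i \<union> Q i \<union> Q' i"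
    "\<And>i. i < M \<Longrightarrow> Q i \<inter> J = {}" "\<And>i. i < M \<Longrightarrow> Q' i \<inter> J = {}"
    "\<And>i. i < M \<Longrightarrow> K i \<inter> {c (real i / real M), c (real (Suc i) / real M)} \<subseteq> J"
    "\<And>i. i < M \<Longrightarrow> K i \<noteq> {} \<Longrightarrow> c ` I i \<inter> J \<noteq> {}"
    by (insert \<Phi>; unfold \<Phi>_def; blast)+
  have meet: "c ` I i \<inter> c ` I j \<subseteq> {c (real i / real M), c (real (Suc i) / real M)}"
    if "i < M" "j < M" "i \<noteq> j" for i j
  proof -
    have "t = real i / real M \<or> t = real (Suc i) / real M" if t: "t \<in> I i" "s \<in> I j" "c t = c s" for s t
    proof (cases "t = s")
      case True
      consider "Suc i \<le> j" | "Suc j \<le> i" using \<open>i \<noteq> j\<close> by linarith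
      then show ?thesis
      proof cases
        case 1
        have "real (Suc i) / real M \<le> real j / real M" using 1 by (intro divide_right_mono) auto
        then show ?thesis using t True by (auto simp: I_def)
      next
        case 2
        have "real (Suc j) / real M \<le> real i / real M" using 2 by (intro divide_right_mono) auto
        then show ?thesis using t True by (auto simp: I_def)
      qed
    next
      \<comment> \<open>Distinct parameters with the same value are 0 and 1, and these can only be
        endpoints of their intervals.\<close>
      case False
      then have "t = 0 \<or> t = 1"
        using injc [OF t(3)] t I01 \<open>i < M\<close> \<open>j < M\<close> by blast
      then show ?thesis
      proof
        assume "t = 0"
        moreover have "0 \<le> real i / real M" by simp
        moreover have "real i / real M \<le> t" using t by (simp add: I_def)
        ultimately show ?thesis by linarith
      next
        assume "t = 1"
        moreover have "real (Suc i) / real M \<le> 1" using \<open>i < M\<close> by (simp add: field_simps)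
        moreover have "t \<le> real (Suc i) / real M" using t by (simp add: I_def)
        ultimately show ?thesis by linarith
      qed
    qed
    then show ?thesis by blast
  qed
  show ?thesis
  proof (rule that [of M K Q Q'])
    show "sphere 0 R = (\<Union>i<M. K i \<union> Q i \<union> Q' i)"
    proof -
      have "sphere 0 R = c ` (\<Union>i<M. I i)"
        using pc Icov by (simp add: path_image_def)
      also have "\<dots> = (\<Union>i<M. K i \<union> Q i \<union> Q' i)"
        using KQ(5) by (auto simp: image_UN)
      finally show ?thesis .
    qed
    show "K i \<inter> K j \<subseteq> J" if "i < M" "j < M" "i \<noteq> j" for i j
      using meet [OF that] KQ(5) [of i] KQ(5) [of j] KQ(8) [of i] that by blast
    show "\<exists>y\<in>J \<inter> sphere 0 R. K i \<subseteq> ball y e" if i: "i < M" and "K i \<noteq> {}" for i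
    proof -
      obtain t where t: "t \<in> I i" "c t \<in> J"
        using KQ(9) [OF i \<open>K i \<noteq> {}\<close>] by blast
      have "c s \<in> ball (c t) e" if "s \<in> I i" for s
      proof -
        have "dist t s \<le> 1 / real M"
          using that t M unfolding I_def dist_real_def by (auto simp: field_simps abs_le_iff)
        moreover have "t \<in> {0..1}" "s \<in> {0..1}"
          using that t I01 [OF i] by blast+
        ultimately show ?thesis
          using \<delta>(2) [of t s] M by auto
      qed
      then have "c ` I i \<subseteq> ball (c t) e" by blast
      moreover have "c t \<in> sphere 0 R"
        using pc t I01 [OF i] unfolding path_image_def by blast
      ultimately show ?thesis
        using t KQ(5) [OF i] by blast
    qed
  qed (use KQ in auto)
qed

text \<open>The circle of radius \<open>R\<close> is cut into finitely many short arcs. The hull in each arc of its points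
  in \<open>J\<close> can be added to \<open>J\<close> without separating far away points: together with a small connected piece
  of \<open>J\<close> it meets the set constructed so far in a connected set, so Janiszewski's theorem applies.
  A path in the complement then crosses the circle only in the finitely many remaining arcs.\<close>

lemma finite_components_outside_disc:
  fixes A J :: "complex set"
  assumes clJ: "closed J" and A: "A \<in> components (- J)"
    and lc: "\<And>x e. \<lbrakk>x \<in> J; 0 < e\<rbrakk> \<Longrightarrow> \<exists>d>0. \<exists>N. connected N \<and> N \<subseteq> J \<inter> ball x e \<and> J \<inter> ball x d \<subseteq> N"
    and u0: "u0 \<in> A" "cmod u0 + 1 < R"
  shows "finite ((\<lambda>a. connected_component_set (A \<inter> {w. R \<le> cmod w}) a) ` {a \<in> A. R + 1 < cmod a})"
proof -
  have R: "R > 0" using u0 norm_ge_zero [of u0] by linarith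
  have conA: "connected A" and AJ: "A \<inter> J = {}" and opA: "open A"
    using in_components_connected [OF A] in_components_subset [OF A] open_components [OF _ A] clJ
    by (auto simp: open_Compl)
  have maxA: "C \<subseteq> A" if "connected C" "C \<inter> J = {}" "C \<inter> A \<noteq> {}" for C
    using components_maximal [OF A] that by blast
  define XJ where "XJ = J \<inter> sphere 0 R"
  \<comment> \<open>Radius 1 is the margin built into the statement: \<open>u0\<close> lies more
    than 1 inside the circle and \<open>a\<close> more than 1 outside it, so a unit ball centred on
    the circle contains neither.\<close>
  have "\<exists>d N. 0 < d \<and> d \<le> 1 \<and> connected N \<and> N \<subseteq> J \<inter> ball x 1 \<and> J \<inter> ball x d \<subseteq> N" if "x \<in> XJ" for x
  proof -
    obtain d N where dN: "d > 0" "connected N" "N \<subseteq> J \<inter> ball x 1" "J \<inter> ball x d \<subseteq> N"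
      using lc [of x 1] \<open>x \<in> XJ\<close> by (auto simp: XJ_def)
    have "ball x (min d 1) \<subseteq> ball x d" by auto
    with dN show ?thesis
      by (intro exI [of _ "min d 1"] exI [of _ N]) (auto simp del: mem_ball)
  qed
  then obtain d N where dN: "\<And>x. x \<in> XJ \<Longrightarrow> 0 < d x" "\<And>x. x \<in> XJ \<Longrightarrow> d x \<le> 1"
      "\<And>x. x \<in> XJ \<Longrightarrow> connected (N x)" "\<And>x. x \<in> XJ \<Longrightarrow> N x \<subseteq> J \<inter> ball x 1"
      "\<And>x. x \<in> XJ \<Longrightarrow> J \<inter> ball x (d x) \<subseteq> N x"
    by metis
  have "compact XJ"
    unfolding XJ_def using clJ by (simp add: closed_Int_compact)
  moreover have "XJ \<subseteq> \<Union> ((\<lambda>x. ball x (d x)) ` XJ)"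
    using dN(1) by auto
  \<comment> \<open>A Lebesgue number of the cover: each hull of size \<open>e\<close> lies in one
    \<open>ball x (d x)\<close>, where \<open>J\<close> is contained in \<open>N x\<close>.\<close>
  ultimately obtain e where e: "0 < e" "\<And>y. y \<in> XJ \<Longrightarrow> \<exists>G \<in> (\<lambda>x. ball x (d x)) ` XJ. ball y e \<subseteq> G"
    by (rule Heine_Borel_lemma) auto
  obtain M K Q Q' where KQ: "\<And>i::nat. i < M \<Longrightarrow> compact (K i)" "\<And>i. i < M \<Longrightarrow> connected (K i)"
    "\<And>i. i < M \<Longrightarrow> connected (Q i)" "\<And>i. i < M \<Longrightarrow> connected (Q' i)"
    "sphere 0 R = (\<Union>i<M. K i \<union> Q i \<union> Q' i)"
    "\<And>i. i < M \<Longrightarrow> Q i \<inter> J = {}" "\<And>i. i < M \<Longrightarrow> Q' i \<inter> J = {}"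
    "\<And>i j. i < M \<Longrightarrow> j < M \<Longrightarrow> i \<noteq> j \<Longrightarrow> K i \<inter> K j \<subseteq> J"
    "\<And>i. i < M \<Longrightarrow> K i \<noteq> {} \<Longrightarrow> \<exists>y\<in>J \<inter> sphere 0 R. K i \<subseteq> ball y e"
    by (rule circle_arcs [OF R e(1) clJ]) (rule that, assumption+)
  have cc: "connected_component (- (J \<union> (\<Union>i<m. K i))) a u0" if a: "a \<in> A" "R + 1 < cmod a" and "m \<le> M" for a m
    using \<open>m \<le> M\<close>
  proof (induction m)
    case 0
    then show ?case
      using conA AJ a u0 unfolding connected_component_def by auto
  next
    case (Suc m)
    then have m: "m < M" and IH: "connected_component (- (J \<union> (\<Union>i<m. K i))) a u0"
      by auto
    show ?case
    proof (cases "K m = {}")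
      case True
      then show ?thesis using IH by (simp add: lessThan_Suc)
    next
      case False
      obtain y where "y \<in> XJ" "K m \<subseteq> ball y e"
        using KQ(9) [OF m False] by (auto simp: XJ_def)
      then obtain x where x: "x \<in> XJ" "K m \<subseteq> ball x (d x)"
        using e(2) by blast
      have clN: "closure (N x) \<subseteq> J" "closure (N x) \<subseteq> cball x 1"
        by (rule closure_minimal; use dN(4) [OF x(1)] clJ in auto)+
      have K1: "K m \<subseteq> cball x 1"
        using x dN(2) [OF x(1)] by fastforce
      \<comment> \<open>The hull alone could meet \<open>T\<close> in a scattered part of
        \<open>J\<close>. With \<open>closure (N x)\<close> added, the intersection becomes exactly
        that connected set. The closure makes \<open>S\<close> compact and stays inside
        \<open>J\<close>, so \<open>S \<union> T\<close> enlarges \<open>T\<close> by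
        \<open>K m\<close> only.\<close>
      define S where "S = K m \<union> closure (N x)"
      define T where "T = J \<union> (\<Union>i<m. K i)"
      have ST: "S \<inter> T = closure (N x)"
      proof
        have "K m \<inter> K i \<subseteq> J" if "i < m" for i
          using KQ(8) [of m i] m that by auto
        then have "K m \<inter> T \<subseteq> K m \<inter> J"
          by (auto simp: T_def)
        also have "\<dots> \<subseteq> N x"
          using x dN(5) [OF x(1)] by blast
        finally show "S \<inter> T \<subseteq> closure (N x)"
          using closure_subset [of "N x"] by (auto simp: S_def)
        show "closure (N x) \<subseteq> S \<inter> T"
          using clN by (auto simp: S_def T_def)
      qed
      have "connected_component (- (S \<union> T)) a u0"
      proof (rule Janiszewski)
        show "compact S"
          unfolding S_def using KQ(1) [OF m] clN(2)
          by (intro compact_Un) (auto intro: compact_closure [THEN iffD2] bounded_subset [OF bounded_cball] dest: subset_trans [OF closure_subset])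
        show "closed T"
          unfolding T_def using m KQ(1) by (intro closed_Un clJ closed_UN) (auto intro: compact_imp_closed)
        show "connected (S \<inter> T)"
          unfolding ST using dN(3) [OF x(1)] by (rule connected_imp_connected_closure)
        have "connected (- cball x 1)"
          by (rule connected_complement_bounded_convex) auto
        moreover have "cmod x = R"
          using x by (simp add: XJ_def)
        then have "a \<in> - cball x 1" "u0 \<in> - cball x 1"
          using a u0 norm_triangle_ineq2 [of a x] norm_triangle_ineq2 [of x u0] by (auto simp: dist_norm norm_minus_commute)
        moreover have "- cball x 1 \<subseteq> - S"
          using K1 clN by (auto simp: S_def)
        ultimately show "connected_component (- S) a u0"
          unfolding connected_component_def by blast
        show "connected_component (- T) a u0"
          using IH by (simp add: T_def)
      qed
      moreover have "- (S \<union> T) \<subseteq> - (J \<union> (\<Union>i<Suc m. K i))"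
        by (auto simp: S_def T_def lessThan_Suc)
      ultimately show ?thesis
        by (rule connected_component_of_subset)
    qed
  qed
  define W where "W = A \<inter> {w. R \<le> cmod w}"
  define \<Q> where "\<Q> = Q ` {..<M} \<union> Q' ` {..<M}"
  \<comment> \<open>The path from \<open>a\<close> to \<open>u0\<close> is cut where it reaches the
    circle. The landing point avoids \<open>J\<close> and all hulls, so it lies in one of the
    remaining arcs. That arc lies in \<open>A\<close> by maximality of \<open>A\<close>, and it
    determines the component of \<open>a\<close>.\<close>
  have main: "\<exists>q\<in>\<Q>. q \<noteq> {} \<and> (\<forall>z\<in>q. connected_component_set W a = connected_component_set W z)" if a: "a \<in> A" "R + 1 < cmod a" for a
  proof -
    have "closed (J \<union> (\<Union>i<M. K i))"
      using KQ(1) by (intro closed_Un clJ closed_UN) (auto intro: compact_imp_closed)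
    then have "path_component (- (J \<union> (\<Union>i<M. K i))) a u0"
      using cc [OF a order_refl] open_path_connected_component by (metis open_Compl)
    then obtain g where g: "path g" "path_image g \<subseteq> - (J \<union> (\<Union>i<M. K i))" "pathstart g = a" "pathfinish g = u0"
      unfolding path_component_def by auto
    define S where "S = - ball (0::complex) R"
    obtain h where h: "path h" "pathstart h = a" "path_image h \<subseteq> path_image g \<inter> S" "pathfinish h \<in> frontier S"
    proof (rule exists_path_subpath_to_frontier_closed [of S g])
      show "pathstart g \<in> S" "pathfinish g \<notin> S"
        using a u0 g by (auto simp: S_def)
    qed (use g in \<open>auto simp: S_def closed_Compl\<close>)
    have ph: "pathfinish h \<in> path_image h" "a \<in> path_image h"
      using h by (auto simp: pathfinish_in_path_image)
    have hA: "path_image h \<subseteq> A"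
      by (rule maxA) (use h g ph a in \<open>auto simp: connected_path_image\<close>)
    have hW: "path_image h \<subseteq> W"
      using hA h(3) by (auto simp: W_def S_def)
    have "pathfinish h \<in> sphere 0 R"
      using h(4) R by (simp add: S_def frontier_complement)
    moreover have "pathfinish h \<notin> (\<Union>i<M. K i)"
      using ph h(3) g(2) by blast
    ultimately obtain q where q: "q \<in> \<Q>" "pathfinish h \<in> q" "connected q" "q \<inter> J = {}" "q \<subseteq> sphere 0 R"
    proof -
      obtain i where i: "i < M" "pathfinish h \<in> Q i \<or> pathfinish h \<in> Q' i"
        using \<open>pathfinish h \<in> sphere 0 R\<close> \<open>pathfinish h \<notin> (\<Union>i<M. K i)\<close> unfolding KQ(5) by blast
      have "Q i \<union> Q' i \<subseteq> sphere 0 R"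
        unfolding KQ(5) using i(1) by blast
      with i show thesis
        using that [of "Q i"] that [of "Q' i"] KQ(3,4,6,7) [OF i(1)] by (auto simp: \<Q>_def)
    qed
    have "q \<subseteq> A"
      using maxA [OF q(3,4)] q(2) ph hA by blast
    then have qW: "q \<subseteq> W"
      using q(5) by (auto simp: W_def)
    have "connected_component W a z" if "z \<in> q" for z
    proof -
      have "connected_component W a (pathfinish h)"
        unfolding connected_component_def using hW ph h by (auto intro: connected_path_image)
      moreover have "connected_component W (pathfinish h) z"
        unfolding connected_component_def using qW q that by auto
      ultimately show ?thesis using connected_component_trans by blast
    qed
    then show ?thesis
      using q connected_component_eq by (metis empty_iff mem_Collect_eq)
  qed
  have "(\<lambda>a. connected_component_set W a) ` {a \<in> A. R + 1 < cmod a} \<subseteq> (\<lambda>q. connected_component_set W (SOME z. z \<in> q)) ` \<Q>"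
  proof (rule image_subsetI)
    fix a assume "a \<in> {a \<in> A. R + 1 < cmod a}"
    then obtain q where q: "q \<in> \<Q>" "q \<noteq> {}" "\<forall>z\<in>q. connected_component_set W a = connected_component_set W z"
      using main by blast
    then have "connected_component_set W a = connected_component_set W (SOME z. z \<in> q)"
      using some_in_eq by blast
    then show "connected_component_set W a \<in> (\<lambda>q. connected_component_set W (SOME z. z \<in> q)) ` \<Q>"
      using q(1) by (rule image_eqI)
  qed
  moreover have "finite \<Q>"
    by (simp add: \<Q>_def)
  ultimately show ?thesis
    unfolding W_def using finite_surj by blast
qed

text \<open>A choice in the style of Koenig's lemma: only finitely many components outside a disc
  reach far out, so any unbounded subset of \<open>A\<close> has unbounded intersection with one of
  them. Applied inside the current unbounded component, this selects the next one.\<close>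

lemma unbounded_component_accessible:
  fixes A J :: "complex set" and r :: "nat \<Rightarrow> real"
  assumes clJ: "closed J" and A: "A \<in> components (- J)" and unb: "\<not> bounded A"
    and lc: "\<And>x e. \<lbrakk>x \<in> J; 0 < e\<rbrakk> \<Longrightarrow> \<exists>d>0. \<exists>N. connected N \<and> N \<subseteq> J \<inter> ball x e \<and> J \<inter> ball x d \<subseteq> N"
    and r: "mono r"
  shows "\<exists>p. \<forall>n. connected_component (A \<inter> {w. r n < cmod w}) (p n) (p (Suc n))"
proof -
  obtain u0 where u0: "u0 \<in> A"
    using in_components_nonempty [OF A] by blast
  \<comment> \<open>The summand 2 provides the margin around \<open>u0\<close> required by
    \<open>finite_components_outside_disc\<close> and makes \<open>r n < s n\<close> strict.\<close>
  define s where "s n = max (r n) (cmod u0) + 2" for n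
  have s: "r n < s n" "cmod u0 + 1 < s n" "s n \<le> s (Suc n)" for n
    using monoD [OF r, of n "Suc n"] by (auto simp: s_def max_def)
  define W where "W n = A \<inter> {w. s n \<le> cmod w}" for n
  have pigeon: "\<exists>x\<in>X. \<not> bounded (X \<inter> connected_component_set (W n) x)"
    if X: "X \<subseteq> {a \<in> A. s n + 1 < cmod a}" "\<not> bounded X" for X n
  proof (rule ccontr)
    assume "\<not> ?thesis"
    then have bd: "bounded (X \<inter> connected_component_set (W n) x)" if "x \<in> X" for x
      using that by blast
    have "finite ((\<lambda>a. connected_component_set (W n) a) ` {a \<in> A. s n + 1 < cmod a})"
      unfolding W_def using finite_components_outside_disc [OF clJ A lc u0 s(2)] by blast
    then have "finite ((\<lambda>a. connected_component_set (W n) a) ` X)"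
      by (rule finite_subset [OF image_mono [OF X(1)]])
    then have "finite ((\<lambda>C. X \<inter> C) ` (\<lambda>a. connected_component_set (W n) a) ` X)"
      by (rule finite_imageI)
    then have "finite ((\<lambda>a. X \<inter> connected_component_set (W n) a) ` X)"
      unfolding image_image .
    then have "bounded (\<Union> ((\<lambda>a. X \<inter> connected_component_set (W n) a) ` X))"
      using bd by (intro bounded_Union) auto
    moreover have "X \<subseteq> \<Union> ((\<lambda>a. X \<inter> connected_component_set (W n) a) ` X)"
    proof
      fix x assume "x \<in> X"
      then have "x \<in> W n"
        using X by (auto simp: W_def)
      then show "x \<in> \<Union> ((\<lambda>a. X \<inter> connected_component_set (W n) a) ` X)"
        using \<open>x \<in> X\<close> connected_component_refl [OF \<open>x \<in> W n\<close>] by blast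
    qed
    ultimately have "bounded X"
      by (rule bounded_subset)
    with X(2) show False ..
  qed
  have cut: "\<not> bounded {a \<in> Y. m < cmod a}" if "\<not> bounded Y" for Y :: "complex set" and m
  proof
    assume "bounded {a \<in> Y. m < cmod a}"
    then have "bounded ({a \<in> Y. m < cmod a} \<union> cball 0 m)"
      by simp
    moreover have "Y \<subseteq> {a \<in> Y. m < cmod a} \<union> cball 0 m"
      by auto
    ultimately have "bounded Y"
      by (rule bounded_subset)
    with that show False ..
  qed
  define P where "P n p \<longleftrightarrow> \<not> bounded (connected_component_set (W n) p)" for n p
  have "\<exists>p. \<forall>n. P n (p n) \<and> connected_component (W n) (p n) (p (Suc n))"
  proof (rule dependent_nat_choice)
    obtain x where "\<not> bounded ({a \<in> A. s 0 + 1 < cmod a} \<inter> connected_component_set (W 0) x)"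
      using pigeon [of "{a \<in> A. s 0 + 1 < cmod a}" 0, OF order_refl cut [OF unb]] by (elim bexE)
    then have "P 0 x"
      unfolding P_def using bounded_subset [OF _ Int_lower2] by (rule contrapos_nn)
    then show "\<exists>x. P 0 x" ..
  next
    fix p n assume "P n p"
    \<comment> \<open>Applying the pigeonhole to the far part of the current component keeps the
      next point connected to \<open>p\<close> within \<open>W n\<close>.\<close>
    define X where "X = {a \<in> connected_component_set (W n) p. s (Suc n) + 1 < cmod a}"
    have "\<not> bounded X"
      using \<open>P n p\<close> unfolding X_def P_def by (rule cut)
    have "connected_component_set (W n) p \<subseteq> A"
      using connected_component_subset [of "W n" p] unfolding W_def by blast
    then have "X \<subseteq> {a \<in> A. s (Suc n) + 1 < cmod a}"
      unfolding X_def by blast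
    then have "\<exists>x\<in>X. \<not> bounded (X \<inter> connected_component_set (W (Suc n)) x)"
      using \<open>\<not> bounded X\<close> by (rule pigeon)
    then obtain x where x: "x \<in> X" "\<not> bounded (X \<inter> connected_component_set (W (Suc n)) x)"
      by (elim bexE)
    from x(2) have "P (Suc n) x"
      unfolding P_def using bounded_subset [OF _ Int_lower2] by (rule contrapos_nn)
    moreover have "connected_component (W n) p x"
      using x(1) unfolding X_def by (elim CollectE conjE)
    ultimately show "\<exists>y. P (Suc n) y \<and> connected_component (W n) p y"
      by blast
  qed
  then obtain p where "\<forall>n. P n (p n) \<and> connected_component (W n) (p n) (p (Suc n))" ..
  then have p: "connected_component (W n) (p n) (p (Suc n))" for n
    by simp
  have "W n \<subseteq> A \<inter> {w. r n < cmod w}" for n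
    using s(1) [of n] by (auto simp: W_def)
  then have "connected_component (A \<inter> {w. r n < cmod w}) (p n) (p (Suc n))" for n
    by (rule connected_component_of_subset [OF p])
  then show ?thesis
    by (intro exI [of _ p] allI)
qed

section \<open>Two disjoint domains in a logarithmic tract\<close>

text \<open>Injectivity gives \<open>G z - G b = (z - b) * q z\<close> with \<open>q\<close>
  holomorphic and free of zeros, including \<open>q b = deriv G b\<close>. The logarithmic
  derivative thus splits into \<open>1 / (z - b)\<close> and \<open>deriv q z / q z\<close>, and the
  second term integrates to 0 by Cauchy's theorem on the convex set \<open>H\<close>.\<close>

lemma winding_number_compose_injective_holomorphic:
  assumes holG: "G holomorphic_on H" and inj: "inj_on G H" and H: "open H" "convex H"
    and c: "valid_path c" "pathfinish c = pathstart c" "path_image c \<subseteq> H - {b}" and b: "b \<in> H"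
  shows "winding_number (G \<circ> c) (G b) = winding_number c b"
proof -
  define q where "q = (\<lambda>z. if z = b then deriv G b else (G z - G b) / (z - b))"
  have holq: "q holomorphic_on H"
    unfolding q_def by (rule pole_lemma [OF holG]) (use b H in \<open>simp add: interior_open\<close>)
  have Gq: "G z = G b + (z - b) * q z" for z
    by (simp add: q_def)
  have "deriv G b \<noteq> 0"
    using holomorphic_injective_imp_regular [OF holG \<open>open H\<close> inj b] .
  then have q0: "q z \<noteq> 0" if "z \<in> H" for z
    using that inj b by (auto simp: q_def inj_on_def)
  have Gb: "G b \<notin> path_image (G \<circ> c)"
    using inj b c unfolding path_image_compose inj_on_def by blast
  have vGc: "valid_path (G \<circ> c)"
    using valid_path_compose_holomorphic [OF c(1) holG H(1)] c by blast
  have an: "G analytic_on H"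
    using holG H by (simp add: analytic_on_open)
  have derG: "deriv G z / (G z - G b) = 1 / (z - b) + deriv q z / q z" if "z \<in> H - {b}" for z
  proof -
    have "(q has_field_derivative deriv q z) (at z)"
      using holq H that holomorphic_derivI by blast
    then have "((\<lambda>z. G b + (z - b) * q z) has_field_derivative (q z + (z - b) * deriv q z)) (at z)"
      by (auto intro!: derivative_eq_intros)
    then have "(G has_field_derivative (q z + (z - b) * deriv q z)) (at z)"
      by (subst ext [of G, OF Gq])
    then have "deriv G z = q z + (z - b) * deriv q z"
      by (rule DERIV_imp_deriv)
    with q0 that show ?thesis
      by (simp add: Gq [of z] field_simps)
  qed
  have i1: "((\<lambda>z. 1 / (z - b)) has_contour_integral (2 * pi * \<i> * winding_number c b)) c"
    using has_contour_integral_winding_number [OF c(1), of b] c(3) by auto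
  have i2: "((\<lambda>z. deriv q z / q z) has_contour_integral 0) c"
    by (rule Cauchy_theorem_convex_simple [where S = H])
       (use holq q0 H c in \<open>auto intro!: holomorphic_intros\<close>)
  have "((\<lambda>z. deriv G z / (G z - G b)) has_contour_integral (2 * pi * \<i> * winding_number c b)) c"
  proof (rule has_contour_integral_eq)
    show "((\<lambda>z. 1 / (z - b) + deriv q z / q z) has_contour_integral (2 * pi * \<i> * winding_number c b)) c"
      using has_contour_integral_add [OF i1 i2] by simp
  qed (use derG c(3) in \<open>metis subsetD\<close>)
  then have "contour_integral c (\<lambda>z. deriv G z * (1 / (G z - G b))) = 2 * pi * \<i> * winding_number c b"
    by (simp add: contour_integral_unique)
  moreover have "contour_integral (G \<circ> c) (\<lambda>w. 1 / (w - G b)) = contour_integral c (\<lambda>z. deriv G z * (1 / (G z - G b)))"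
    by (rule contour_integral_comp_analyticW [OF an c(1)]) (use c in auto)
  moreover have "contour_integral (G \<circ> c) (\<lambda>w. 1 / (w - G b)) = 2 * pi * \<i> * winding_number (G \<circ> c) (G b)"
    using has_contour_integral_winding_number [OF vGc Gb] contour_integral_unique by blast
  ultimately show ?thesis by simp
qed

text \<open>The curve \<open>c n\<close> bounds the region between the lifted path \<open>\<alpha> n\<close> and its translate by \<open>2 * pi * \<i>\<close>.
  Connectedness of \<open>U'\<close> forces its winding numbers about all translates \<open>bk k\<close> of a point \<open>b\<close> over \<open>A'\<close>
  to agree, hence to vanish. But they add up to the winding number of \<open>exp \<circ> c n\<close> about \<open>exp b\<close>, which
  is \<open>- 1\<close>.\<close>

lemma no_disjoint_unbounded_domains_in_tract:
  fixes G :: "complex \<Rightarrow> complex" and a :: "nat \<Rightarrow> complex"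
  assumes holG: "G holomorphic_on {z. Re z > \<rho>}" and inj: "inj_on G {z. Re z > \<rho>}"
    and Ginf: "\<And>B. \<exists>N. \<forall>z. Re z > N \<longrightarrow> B < cmod (G z)"
    and U: "open U" "connected U" and U': "open U'" "connected U'" and UU': "U \<inter> U' = {}"
    and A: "open A" and GA: "\<And>z. \<lbrakk>Re z > \<rho>; exp z \<in> A\<rbrakk> \<Longrightarrow> G z \<in> U"
    and A': "\<And>r. \<exists>w\<in>A'. r < cmod w" and GA': "\<And>z. \<lbrakk>Re z > \<rho>; exp z \<in> A'\<rbrakk> \<Longrightarrow> G z \<in> U'"
    and a: "\<And>n. connected_component {z. Re z > \<rho> \<and> Re z > real n \<and> exp z \<in> A} (a n) (a (Suc n))"
  shows False
proof -
  define H where "H = {z. Re z > \<rho>}"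
  have opH: "open H" and convH: "convex H"
    by (simp_all add: H_def open_halfspace_Re_gt convex_halfspace_Re_gt)
  note holG = holG [folded H_def] and inj = inj [folded H_def]
  have contG: "continuous_on H G"
    using holG holomorphic_on_imp_continuous_on by blast
  define E where "E n = {z. Re z > \<rho> \<and> Re z > real n \<and> exp z \<in> A}" for n
  have opE: "open (E n)" for n
  proof -
    have "E n = {z. Re z > \<rho>} \<inter> {z. Re z > real n} \<inter> exp -` A"
      by (auto simp: E_def)
    then show ?thesis
      by (simp add: open_halfspace_Re_gt open_Int A open_vimage continuous_on_exp)
  qed
  \<comment> \<open>Polynomial paths are chosen because the winding numbers of
    \<open>G \<circ> c n\<close> and \<open>exp \<circ> c n\<close> are computed by contour
    integrals, which need piecewise smooth curves.\<close>
  have "\<exists>g. valid_path g \<and> path_image g \<subseteq> E n \<and> pathstart g = a n \<and> pathfinish g = a (Suc n)" for n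
  proof -
    have "connected_component (E n) (a n) (a (Suc n))"
      using a by (simp add: E_def)
    then have "\<exists>g. polynomial_function g \<and> path_image g \<subseteq> connected_component_set (E n) (a n) \<and> pathstart g = a n \<and> pathfinish g = a (Suc n)"
      by (intro connected_open_polynomial_connected open_connected_component opE)
         (auto simp: connected_component_refl_eq dest: connected_component_in)
    then show ?thesis
      using connected_component_subset valid_path_polynomial_function by blast
  qed
  then obtain g where g: "\<And>n. valid_path (g n)" "\<And>n. path_image (g n) \<subseteq> E n"
      "\<And>n. pathstart (g n) = a n" "\<And>n. pathfinish (g n) = a (Suc n)"
    by metis
  have gp: "path (g n)" for n
    using g(1) valid_path_imp_path by blast
  have aE: "a n \<in> E n" for n
    using g(2,3) pathstart_in_path_image by fastforce
  define \<alpha> where "\<alpha> = rec_nat (linepath (a 0) (a 0)) (\<lambda>n p. p +++ g n)"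
  have \<alpha>Suc: "\<alpha> (Suc n) = \<alpha> n +++ g n" for n
    by (simp add: \<alpha>_def)
  have E0: "E n \<subseteq> E 0" for n
    by (auto simp: E_def)
  have \<alpha>: "valid_path (\<alpha> n) \<and> pathstart (\<alpha> n) = a 0 \<and> pathfinish (\<alpha> n) = a n \<and> path_image (\<alpha> n) \<subseteq> E 0" for n
  proof (induction n)
    case 0
    have "\<alpha> 0 = linepath (a 0) (a 0)"
      by (simp add: \<alpha>_def)
    then show ?case using aE [of 0]
      by (metis pathfinish_linepath pathstart_linepath path_image_linepath valid_path_linepath
          closed_segment_idem empty_subsetI insert_subset)
  next
    case (Suc n)
    then show ?case
      using g [of n] E0 [of n] by (auto simp: \<alpha>Suc path_image_join)
  qed
  have \<alpha>p: "path (\<alpha> n)" for n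
    using \<alpha> valid_path_imp_path by blast
  define T where "T = 2 * of_real pi * \<i>"
  have ReT [simp]: "Re T = 0" and ImT [simp]: "Im T = 2 * pi" and T0: "T \<noteq> 0"
    by (auto simp: T_def)
  have expT [simp]: "exp (T + z) = exp z" "exp (z + T) = exp z" for z
    by (simp_all add: T_def exp_add)
  define sh where "sh p = (+) T \<circ> p" for p :: "real \<Rightarrow> complex"
  have sh: "path (sh p) = path p" "valid_path (sh p) = valid_path p" "path_image (sh p) = (+) T ` path_image p"
       "pathstart (sh p) = T + pathstart p" "pathfinish (sh p) = T + pathfinish p" for p
    by (simp_all add: sh_def path_translation_eq valid_path_translation_eq path_image_translation pathstart_translation pathfinish_translation)
  have shj: "sh (p +++ q) = sh p +++ sh q" for p q
    by (simp add: sh_def path_compose_join)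
  define seg where "seg n = linepath (a n) (T + a n)" for n
  have seg: "valid_path (seg n)" "path (seg n)" "pathstart (seg n) = a n" "pathfinish (seg n) = T + a n" for n
    by (simp_all add: seg_def)
  have Reseg: "Re z = Re (a n)" if "z \<in> path_image (seg n)" for z n
    using that by (auto simp: seg_def closed_segment_def algebra_simps)
  have ReaR: "Re (a n) > \<rho>" "Re (a n) > real n" "exp (a n) \<in> A" for n
    using aE [of n] by (auto simp: E_def)
  have segH: "path_image (seg n) \<subseteq> H" for n
    using Reseg ReaR by (auto simp: H_def)
  have E0H: "E 0 \<subseteq> H"
    by (auto simp: E_def H_def)
  have shE: "T + z \<in> E n \<longleftrightarrow> z \<in> E n" for z n
    by (simp add: E_def)
  have shH: "T + z \<in> H \<longleftrightarrow> z \<in> H" for z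
    by (simp add: H_def)
  have \<alpha>E: "path_image (\<alpha> n) \<subseteq> E 0" "path_image (sh (\<alpha> n)) \<subseteq> E 0" for n
    using \<alpha>[of n] shE by (auto simp: sh)
  have \<alpha>H: "path_image (\<alpha> n) \<subseteq> H" "path_image (sh (\<alpha> n)) \<subseteq> H" for n
    using \<alpha>E E0H by blast+
  have GE: "G ` E 0 \<subseteq> U"
    using GA by (auto simp: E_def)
  \<comment> \<open>The loop goes up the left segment, out along the upper translate, down the right
    segment and back along the lower path, that is, clockwise; hence the sign of the value
    \<open>- 1\<close> reached at the end.\<close>
  define c where "c n = seg 0 +++ (sh (\<alpha> n) +++ (reversepath (seg n) +++ reversepath (\<alpha> n)))" for n
  have c: "valid_path (c n)" "pathstart (c n) = a 0" "pathfinish (c n) = a 0" for n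
    using \<alpha>[of n] by (auto simp: c_def sh seg intro!: valid_path_join)
  have cim: "path_image (c n) = path_image (seg 0) \<union> path_image (sh (\<alpha> n)) \<union> path_image (seg n) \<union> path_image (\<alpha> n)" for n
    using \<alpha>[of n] by (auto simp: c_def sh seg path_image_join)
  have cH: "path_image (c n) \<subseteq> H" for n
    using segH \<alpha>H by (auto simp: cim)
  have "G (a 0) \<in> U" "G (T + a 0) \<in> U"
    using GA ReaR by auto
  then obtain P where P: "path P" "path_image P \<subseteq> U" "pathstart P = G (a 0)" "pathfinish P = G (T + a 0)"
    using U connected_open_path_connected path_connected_def by metis
  have pG: "path (G \<circ> p)" if "path p" "path_image p \<subseteq> H" for p
    using path_continuous_image [OF that(1)] contG that(2) continuous_on_subset by blast
  \<comment> \<open>\<open>L\<close> accounts for replacing the left side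
    \<open>G \<circ> seg 0\<close> by the path \<open>P\<close> in \<open>U\<close>. After this
    replacement the loop \<open>D n\<close> lies in \<open>U\<close> except for the image of the
    right segment.\<close>
  define L where "L = P +++ (G \<circ> reversepath (seg 0))"
  have L: "path L" "pathstart L = G (a 0)" "pathfinish L = G (a 0)"
    using P pG [of "reversepath (seg 0)"] segH seg by (auto simp: L_def pathstart_compose pathfinish_compose)
  have Lim: "path_image L = path_image P \<union> G ` path_image (seg 0)"
    using P seg by (simp add: L_def path_image_join pathstart_compose pathfinish_compose path_image_compose)
  define D where "D n = P +++ ((G \<circ> sh (\<alpha> n)) +++ ((G \<circ> reversepath (seg n)) +++ (G \<circ> reversepath (\<alpha> n))))" for n
  have D: "path (D n)" "pathstart (D n) = G (a 0)" "pathfinish (D n) = G (a 0)" for n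
    using P \<alpha>[of n] \<alpha>p[of n] \<alpha>H[of n] segH[of n] seg pG
    by (auto simp: D_def sh pathstart_compose pathfinish_compose intro!: path_join_imp pG)
  have Dim: "path_image (D n) = path_image P \<union> G ` path_image (sh (\<alpha> n)) \<union> G ` path_image (seg n) \<union> G ` path_image (\<alpha> n)" for n
    using P seg \<alpha>[of n] by (auto simp: D_def sh path_image_join pathstart_compose pathfinish_compose path_image_compose)
  have wD: "winding_number (D n) z = winding_number L z + winding_number (G \<circ> c n) z"
    if "z \<notin> path_image (D n)" "z \<notin> path_image L" for n z
  proof -
    have *: "winding_number (G \<circ> reversepath p) z = - winding_number (G \<circ> p) z" 
      if "path p" "path_image p \<subseteq> H" "z \<notin> G ` path_image p" for p
      using that pG by (simp add: path_compose_reversepath winding_number_reversepath path_image_compose)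
    have nz: "z \<notin> path_image P" "z \<notin> G ` path_image (sh (\<alpha> n))" "z \<notin> G ` path_image (seg n)" "z \<notin> G ` path_image (\<alpha> n)" "z \<notin> G ` path_image (seg 0)"
      using that by (auto simp: Dim Lim)
    note fs = sh seg \<alpha>[of n] \<alpha>p[of n] \<alpha>H[of n] segH[of n] segH[of 0] pG P nz
    have "winding_number L z = winding_number P z - winding_number (G \<circ> seg 0) z"
      unfolding L_def using fs
      by (subst winding_number_join) (auto simp: pathstart_compose pathfinish_compose path_image_compose *)
    moreover have "winding_number (D n) z = winding_number P z + winding_number (G \<circ> sh (\<alpha> n)) z 
        - winding_number (G \<circ> seg n) z - winding_number (G \<circ> \<alpha> n) z"
      unfolding D_def using fs
      by (simp add: winding_number_join path_join_imp not_in_path_image_join pathstart_compose pathfinish_compose path_image_compose *)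
    moreover have "winding_number (G \<circ> c n) z = winding_number (G \<circ> seg 0) z + winding_number (G \<circ> sh (\<alpha> n)) z 
        - winding_number (G \<circ> seg n) z - winding_number (G \<circ> \<alpha> n) z"
      unfolding c_def path_compose_join using fs
      by (simp add: winding_number_join path_join_imp not_in_path_image_join pathstart_compose pathfinish_compose path_image_compose *)
    ultimately show ?thesis by simp
  qed
  have "bounded (path_image L)"
    using L by (simp add: bounded_path_image)
  then obtain B where B: "\<And>z. z \<in> path_image L \<Longrightarrow> cmod z \<le> B"
    by (auto simp: bounded_iff)
  obtain M where M: "\<And>z. Re z > M \<Longrightarrow> B < cmod (G z)"
    using Ginf by meson
  \<comment> \<open>Beyond real part \<open>M'\<close> the map \<open>G\<close> has left the loop
    \<open>L\<close>. The bound \<open>Re (a 0)\<close> makes the circle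
    \<open>exp \<circ> seg 0\<close> smaller than \<open>cmod w\<close>.\<close>
  define M' where "M' = max \<rho> (max M (Re (a 0)))"
  obtain w where w: "w \<in> A'" "exp M' < cmod w"
    using A' by blast
  define b where "b = Ln w"
  have "w \<noteq> 0" using w(2) by (metis exp_ge_zero norm_zero not_less)
  then have expb: "exp b = w" and Reb: "Re b > M'"
    using w \<open>w \<noteq> 0\<close> by (auto simp: b_def) (metis exp_gt_zero exp_ln exp_less_cancel_iff less_trans)
  define bk where "bk k = b + of_int k * T" for k
  have Rebk: "Re (bk k) = Re b" for k
    by (simp add: bk_def)
  have bkH: "bk k \<in> H" for k
    using Reb by (simp add: H_def Rebk M'_def)
  have expbk: "exp (bk k) = w" for k
    using expb exp_integer_2pi [of "of_int k"] by (simp add: bk_def T_def exp_add mult_ac)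
  have expT_iff: "exp z = w \<longleftrightarrow> (\<exists>k::int. z = b + of_int k * T)" for z
    unfolding expb [symmetric] exp_eq T_def by (simp add: mult_ac)
  have GbU: "G (bk k) \<in> U'" for k
    using GA' [of "bk k"] expbk w bkH by (simp add: H_def)
  have bkE: "bk k \<notin> E 0" for k
    using GE GbU UU' by blast
  have GbL: "G z \<notin> path_image L" if "Re z > M'" for z
    using B M [of z] that by (force simp: M'_def)
  \<comment> \<open>All \<open>G (bk k)\<close> lie in the image of one half-plane, a connected set
    that avoids \<open>L\<close>.\<close>
  have 2: "winding_number L (G (bk k)) = winding_number L (G b)" for k
  proof (rule winding_number_eq [OF L(1)])
    show "connected (G ` {z. Re z > M'})"
    proof (rule connected_continuous_image)
      show "continuous_on {z. Re z > M'} G"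
        by (rule continuous_on_subset [OF contG]) (auto simp: H_def M'_def)
    qed (simp add: convex_halfspace_Re_gt convex_connected)
  qed (use L Reb Rebk GbL in auto)
  have bk0: "bk 0 = b"
    by (simp add: bk_def)
  have bk_seg: "bk k \<notin> path_image (seg n)" if "real n \<ge> Re b \<or> n = 0" for k n
  proof
    assume "bk k \<in> path_image (seg n)"
    then have "Re b = Re (a n)"
      using Reseg Rebk by metis
    with that ReaR [of n] Reb show False by (auto simp: M'_def)
  qed
  have bk_c: "bk k \<notin> path_image (c n)" if "real n \<ge> Re b" for k n
    using bk_seg [of n k] bk_seg [of 0 k] bkE [of k] \<alpha>E [of n] that by (auto simp: cim)
  have GbD: "G (bk k) \<notin> path_image (D n)" if "real n \<ge> Re b" for k n
  proof -
    have "G (bk k) \<notin> G ` path_image (seg n)"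
      using inj bk_seg [of n k] that bkH [of k] segH [of n] by (metis imageE inj_onD subsetD)
    moreover have "G ` path_image (sh (\<alpha> n)) \<subseteq> U" "G ` path_image (\<alpha> n) \<subseteq> U"
      using GE \<alpha>E by blast+
    ultimately show ?thesis
      using GbU [of k] UU' P by (auto simp: Dim)
  qed
  \<comment> \<open>A path in \<open>U'\<close> from \<open>G (bk k)\<close> to \<open>G b\<close>
    can meet \<open>D n\<close> only in the image of \<open>seg n\<close>, which for large
    \<open>n\<close> lies outside a disc containing the path. The bound on \<open>n\<close> depends
    on \<open>k\<close>.\<close>
  have 1: "\<exists>N. \<forall>n\<ge>N. winding_number (D n) (G (bk k)) = winding_number (D n) (G b)" for k
  proof -
    obtain P' where P': "path P'" "path_image P' \<subseteq> U'" "pathstart P' = G (bk k)" "pathfinish P' = G b"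
      using U' GbU [of k] GbU [of 0] bk0 connected_open_path_connected path_connected_def by metis
    obtain B' where B': "\<And>z. z \<in> path_image P' \<Longrightarrow> cmod z \<le> B'"
      using bounded_path_image [OF P'(1)] by (auto simp: bounded_iff)
    obtain N where N: "\<And>z. Re z > N \<Longrightarrow> B' < cmod (G z)"
      using Ginf by meson
    have "winding_number (D n) (G (bk k)) = winding_number (D n) (G b)" if "real n \<ge> N" for n
    proof (rule winding_number_eq [OF D(1)])
      have "G z \<notin> path_image P'" if "z \<in> path_image (seg n)" for z
        using B' N [of z] Reseg [OF that] ReaR [of n] \<open>real n \<ge> N\<close> by (metis less_le_trans not_le order_le_less_trans less_imp_le)
      moreover have "G ` path_image (sh (\<alpha> n)) \<subseteq> U" "G ` path_image (\<alpha> n) \<subseteq> U"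
        using GE \<alpha>E by blast+
      ultimately show "path_image P' \<inter> path_image (D n) = {}"
        using P' P UU' unfolding Dim by blast
    qed (use D P' in \<open>auto simp: connected_path_image pathstart_in_path_image pathfinish_in_path_image simp flip: P'(3,4)\<close>)
    then show ?thesis
      by (metis real_arch_simple order_trans of_nat_le_iff)
  qed
  have 3: "winding_number (G \<circ> c n) (G (bk k)) = winding_number (c n) (bk k)" if "real n \<ge> Re b" for k n
    by (rule winding_number_compose_injective_holomorphic [OF holG inj opH convH])
       (use c cH [of n] bk_c [of n k] that bkH in auto)
  have w_c: "winding_number (c n) z = winding_number (seg 0) z + winding_number (sh (\<alpha> n)) z - winding_number (seg n) z - winding_number (\<alpha> n) z"
    if "z \<notin> path_image (c n)" for n z
    unfolding c_def using that \<alpha>[of n] \<alpha>p[of n]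
    by (simp add: cim seg sh winding_number_join path_join_imp not_in_path_image_join winding_number_reversepath)
  \<comment> \<open>Passing from \<open>n\<close> to \<open>Suc n\<close> adds the loop
    \<open>q\<close>, which stays in the half-plane of real part greater than \<open>n\<close>, to
    the right of \<open>bk k\<close>. So the winding number about \<open>bk k\<close> no longer
    depends on \<open>n\<close>, and the comparisons made at different \<open>n\<close> can all be
    read off at one \<open>n0\<close>.\<close>
  have 4: "winding_number (c (Suc n)) (bk k) = winding_number (c n) (bk k)" if n: "real n \<ge> Re b" for n k
  proof -
    have bg: "bk k \<notin> path_image (g n)" "bk k \<notin> path_image (sh (g n))"
      using g(2)[of n] bkE[of k] E0 shE by (auto simp: sh) blast+
    have bs: "bk k \<notin> path_image (seg n)" "bk k \<notin> path_image (seg (Suc n))"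
      using bk_seg n by auto
    have "bk k \<notin> path_image (\<alpha> n)" "bk k \<notin> path_image (sh (\<alpha> n))"
      using \<alpha>E bkE by blast+
    then have j: "winding_number (\<alpha> (Suc n)) (bk k) = winding_number (\<alpha> n) (bk k) + winding_number (g n) (bk k)"
       "winding_number (sh (\<alpha> (Suc n))) (bk k) = winding_number (sh (\<alpha> n)) (bk k) + winding_number (sh (g n)) (bk k)"
      using \<alpha>[of n] \<alpha>p[of n] gp[of n] g[of n] bg
      by (auto simp: \<alpha>Suc winding_number_join sh shj)
    define q where "q = seg n +++ (sh (g n) +++ (reversepath (seg (Suc n)) +++ reversepath (g n)))"
    have q: "winding_number q (bk k) = winding_number (seg n) (bk k) + winding_number (sh (g n)) (bk k) - winding_number (seg (Suc n)) (bk k) - winding_number (g n) (bk k)"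
      unfolding q_def using bg bs gp[of n] g[of n]
      by (simp add: seg sh winding_number_join path_join_imp not_in_path_image_join winding_number_reversepath)
    have "winding_number q (bk k) = 0"
    proof (rule winding_number_zero_outside)
      show "path_image q \<subseteq> {z. Re z > real n}"
      proof -
        have "path_image (g n) \<subseteq> {z. Re z > real n}" "path_image (sh (g n)) \<subseteq> {z. Re z > real n}"
          using g(2) [of n] by (auto simp: E_def sh)
        moreover have "path_image (seg n) \<subseteq> {z. Re z > real n}" "path_image (seg (Suc n)) \<subseteq> {z. Re z > real n}"
          using ReaR[of n] ReaR[of "Suc n"] by (auto dest!: Reseg)
        ultimately show ?thesis
          using g[of n] by (auto simp: q_def path_image_join seg sh)
      qed
    qed (use gp[of n] g[of n] n Rebk in \<open>auto simp: q_def seg sh convex_halfspace_Re_gt path_join_imp\<close>)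
    have "bk k \<notin> path_image (c n)" "bk k \<notin> path_image (c (Suc n))"
      using bk_c n by auto
    then have "winding_number (c (Suc n)) (bk k) - winding_number (c n) (bk k) = winding_number q (bk k)"
      by (simp add: w_c j q)
    with \<open>winding_number q (bk k) = 0\<close> show ?thesis
      by simp
  qed
  define n0 where "n0 = nat \<lceil>Re b\<rceil>"
  have n0: "real n \<ge> Re b" if "n \<ge> n0" for n
    using that unfolding n0_def by linarith
  have 4: "winding_number (c n) (bk k) = winding_number (c n0) (bk k)" if "n \<ge> n0" for n k
    using that by (induction n rule: dec_induct) (auto simp: 4 n0)
  have 5: "winding_number (c n0) (bk k) = winding_number (c n0) b" for k
  proof -
    obtain N where N: "\<And>n. n \<ge> N \<Longrightarrow> winding_number (D n) (G (bk k)) = winding_number (D n) (G b)"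
      using 1 by blast
    define n where "n = max N n0"
    have n: "real n \<ge> Re b" "n \<ge> N" "n \<ge> n0"
      using n0 [of n] by (auto simp: n_def)
    have "winding_number (G \<circ> c n) (G (bk k)) = winding_number (G \<circ> c n) (G b)"
      using wD [of "G (bk k)" n] wD [of "G b" n] N [OF n(2)] 2 [of k] GbD[OF n(1), of k] GbD [OF n(1), of 0] GbL Reb Rebk bk0
      by simp
    then show ?thesis
      using 3 [OF n(1), of k] 3 [OF n(1), of 0] 4 [OF n(3), of k] 4 [OF n(3), of 0] bk0 by simp
  qed
  \<comment> \<open>The translates \<open>bk k\<close> are unbounded, and far from the loop the
    winding number is 0; by the equality just shown it is 0 at \<open>b\<close> too.\<close>
  have "winding_number (c n0) b = 0"
  proof -
    obtain B where B: "\<And>z. B \<le> norm z \<Longrightarrow> winding_number (c n0) z = 0"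
      using winding_number_zero_at_infinity [of "c n0"] c valid_path_imp_path by metis
    obtain k :: nat where k: "real k \<ge> \<bar>B\<bar> + norm b"
      using real_arch_simple by blast
    have "real k \<le> norm (of_int (int k) * T)"
      using pi_gt3 by (simp add: norm_mult T_def)
        (rule mult_left_mono [of 1 "2 * pi" "real k", simplified]; simp)
    also have "\<dots> \<le> norm (bk k) + norm b"
      unfolding bk_def using norm_triangle_ineq4 [of "b + of_int (int k) * T" b] by simp
    finally have "B \<le> norm (bk k)"
      using k by linarith
    then show ?thesis
      using B 5 by metis
  qed
  with 5 have w0: "winding_number (c n0) (bk k) = 0" for k
    by simp
  have b_c: "exp z \<noteq> w" if "z \<in> path_image (c n0)" for z
  proof
    assume "exp z = w"
    then obtain k :: int where "z = b + of_int k * T"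
      unfolding expT_iff by (elim exE)
    then show False
      using bk_c [of n0 k] n0 that by (simp add: bk_def)
  qed
  \<comment> \<open>The integrand has its poles exactly at the points \<open>bk k\<close>, so the
    global Cauchy theorem applies. Up to the factor \<open>2 * pi * \<i>\<close> the integral is the
    winding number of \<open>exp \<circ> c n0\<close> about \<open>w\<close>.\<close>
  have "((\<lambda>z. exp z / (exp z - w)) has_contour_integral 0) (c n0)"
  proof (rule Cauchy_theorem_global)
    show "open {z. exp z \<noteq> w}"
      by (intro open_Collect_neq continuous_intros)
    show "winding_number (c n0) z = 0" if "z \<notin> {z. exp z \<noteq> w}" for z
    proof -
      have "exp z = w"
        using that by simp
      then obtain k :: int where "z = b + of_int k * T"
        unfolding expT_iff by (elim exE)
      then show ?thesis
        using w0 by (simp add: bk_def)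
    qed
  qed (use c b_c in \<open>auto intro!: holomorphic_intros\<close>)
  moreover have "deriv exp z = exp z" for z :: complex
    by (rule DERIV_imp_deriv) (rule DERIV_exp)
  ultimately have "contour_integral (c n0) (\<lambda>z. deriv exp z * (1 / (exp z - w))) = 0"
    by (simp add: contour_integral_unique)
  then have "contour_integral (exp \<circ> c n0) (\<lambda>z. 1 / (z - w)) = 0"
    by (subst contour_integral_comp_analyticW [where s = UNIV]) (auto simp: c analytic_on_open holomorphic_on_exp)
  then have wexp: "winding_number (exp \<circ> c n0) w = 0"
  proof -
    have "valid_path (exp \<circ> c n0)"
      by (rule valid_path_compose_holomorphic [where S = UNIV]) (auto simp: c holomorphic_on_exp)
    moreover have "w \<notin> path_image (exp \<circ> c n0)"
      using b_c by (auto simp: path_image_compose)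
    ultimately show ?thesis
      using contour_integral_unique [OF has_contour_integral_winding_number [of "exp \<circ> c n0" w]]
        \<open>contour_integral (exp \<circ> c n0) _ = 0\<close> by simp
  qed
  have pe: "path (exp \<circ> p)" if "path p" for p :: "real \<Rightarrow> complex"
    using that by (intro path_continuous_image) (auto intro!: continuous_intros)
  have esh: "exp \<circ> sh p = exp \<circ> p" for p
    by (auto simp: sh_def)
  have nim: "w \<notin> exp ` path_image (seg 0)" "w \<notin> exp ` path_image (sh (\<alpha> n0))" "w \<notin> exp ` path_image (seg n0)" "w \<notin> exp ` path_image (\<alpha> n0)"
    using b_c by (auto simp: cim)
  \<comment> \<open>Under \<open>exp\<close> the path \<open>\<alpha> n0\<close> and its translate
    become the same curve and cancel. The left segment becomes a circle that is too small to enclose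
    \<open>w\<close>, the right one a circle that encloses it once.\<close>
  have "winding_number (exp \<circ> c n0) w = winding_number (exp \<circ> seg 0) w + winding_number (exp \<circ> \<alpha> n0) w 
        - winding_number (exp \<circ> seg n0) w - winding_number (exp \<circ> \<alpha> n0) w"
    unfolding c_def path_compose_join path_compose_reversepath using \<alpha>[of n0] \<alpha>p[of n0] nim pe
    by (simp add: winding_number_join path_join_imp not_in_path_image_join winding_number_reversepath
         pathstart_compose pathfinish_compose path_image_compose sh seg esh)
  moreover have "winding_number (exp \<circ> seg 0) w = 0"
  proof (rule winding_number_zero_outside)
    show "path_image (exp \<circ> seg 0) \<subseteq> ball 0 (cmod w)"
      using Reb by (auto simp: path_image_compose M'_def simp flip: expb dest!: Reseg)
  qed (auto simp: pe seg pathstart_compose pathfinish_compose)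
  moreover have "winding_number (exp \<circ> seg n0) w = winding_number (exp \<circ> seg n0) 0"
  proof (rule winding_number_eq)
    show "ball 0 (exp (Re (a n0))) \<inter> path_image (exp \<circ> seg n0) = {}"
      by (auto simp: path_image_compose dest!: Reseg)
    show "w \<in> ball 0 (exp (Re (a n0)))"
      using n0 [of n0] ReaR [of n0] by (simp flip: expb)
  qed (auto simp: pe seg pathstart_compose pathfinish_compose)
  moreover have "winding_number (exp \<circ> seg n0) 0 = 1"
    using T0 winding_number_compose_exp [OF seg(2)] by (simp add: seg T_def)
  ultimately show False
    using wexp by simp
qed

section \<open>Transcendental meromorphic functions and their Fatou sets\<close>

text \<open>The fraction is reduced by taking a denominator of least degree among all pairs
  \<open>p'\<close>, \<open>q'\<close> with \<open>p * q' = q * p'\<close>: a common factor could be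
  cancelled and would therefore be constant. At points where only \<open>q\<close> vanishes, the
  value of \<open>f\<close> is recovered as its limit, which is where the absence of removable
  singularities enters.\<close>

lemma rational_functionI:
  assumes mero: "f nicely_meromorphic_on UNIV" and "q \<noteq> 0"
    and eq: "\<And>z. \<forall>\<^sub>F w in at z. f w * poly q w = poly p w"
  shows "rational_function f"
proof -
  define P where "P n \<longleftrightarrow> (\<exists>p' q'. q' \<noteq> 0 \<and> p * q' = q * p' \<and> degree q' = n)" for n
  have "P (degree q)"
    unfolding P_def using \<open>q \<noteq> 0\<close> by (intro exI [of _ p] exI [of _ q]) (simp add: mult.commute)
  then have "P (LEAST n. P n)"
    by (rule LeastI)
  then obtain p' q' where q': "q' \<noteq> 0" "degree q' = (LEAST n. P n)" and pq: "p * q' = q * p'"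
    unfolding P_def by blast
  have cop: "coprime p' q'"
  proof (rule coprimeI)
    fix d assume "d dvd p'" "d dvd q'"
    then obtain a b where ab: "p' = d * a" "q' = d * b"
      by (auto elim!: dvdE)
    have "d \<noteq> 0" "b \<noteq> 0" using ab q' by auto
    have "d * (p * b) = d * (q * a)"
      using pq unfolding ab by (simp only: mult.left_commute)
    then have "p * b = q * a"
      using \<open>d \<noteq> 0\<close> by simp
    then have "P (degree b)"
      unfolding P_def using \<open>b \<noteq> 0\<close> by blast
    then have "degree q' \<le> degree b"
      unfolding q'(2) by (rule Least_le)
    then have "degree d = 0"
      using degree_mult_eq [OF \<open>d \<noteq> 0\<close> \<open>b \<noteq> 0\<close>] ab(2) by simp
    then show "is_unit d"
      using \<open>d \<noteq> 0\<close> by (simp add: is_unit_iff_degree)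
  qed
  have pq_z: "poly p w * poly q' w = poly q w * poly p' w" for w
    using pq by (metis poly_mult)
  have "f z = poly p' z / poly q' z" if z: "poly q' z \<noteq> 0" for z
  proof -
    have "finite {w. poly q w = 0}"
      using \<open>q \<noteq> 0\<close> by (rule poly_roots_finite)
    then have "\<forall>\<^sub>F w in at z. w \<notin> {w. poly q w = 0}"
      using islimpt_finite [of _ z] unfolding islimpt_iff_eventually by blast
    moreover have "\<forall>\<^sub>F w in at z. poly q' w \<noteq> 0"
      using z by (intro tendsto_imp_eventually_ne [OF isContD]) (auto intro: poly_isCont)
    ultimately have ev: "\<forall>\<^sub>F w in at z. f w = poly p' w / poly q' w"
      using eq [of z]
    proof eventually_elim
      case (elim w)
      have "poly q w * (f w * poly q' w) = (f w * poly q w) * poly q' w"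
        by simp
      also have "\<dots> = poly q w * poly p' w"
        by (simp only: elim(3) pq_z)
      finally have "f w * poly q' w = poly p' w"
        using elim(1) by simp
      then show ?case
        using elim(2) by (simp add: field_simps)
    qed
    have lim: "((\<lambda>w. poly p' w / poly q' w) \<longlongrightarrow> poly p' z / poly q' z) (at z)"
      by (rule isContD) (use z in \<open>auto intro!: continuous_intros\<close>)
    then have lim': "f \<midarrow>z\<rightarrow> poly p' z / poly q' z"
      using tendsto_cong [OF ev] by simp
    then have "\<not> is_pole f z"
      using not_tendsto_and_filterlim_at_infinity [OF at_neq_bot lim'] unfolding is_pole_def by blast
    then have "f \<midarrow>z\<rightarrow> f z"
      using mero unfolding nicely_meromorphic_on_def by blast
    then show ?thesis
      using lim' LIM_unique by blast
  qed
  then show ?thesis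
    unfolding rational_function_def rational_of_degree_def using cop q'(1) by blast
qed

text \<open>Each pole becomes a zero of \<open>Q\<close> of the same order, so \<open>h * Q\<close>
  has only removable singularities and extends to an entire function.\<close>

lemma clear_finitely_many_poles:
  assumes mero: "h nicely_meromorphic_on UNIV" and fin: "finite {z. is_pole h z}"
  obtains Q E where "Q \<noteq> 0" "E holomorphic_on UNIV" "\<And>z. \<not> is_pole h z \<Longrightarrow> h z * poly Q z = E z"
proof -
  define P where "P = {z. is_pole h z}"
  have hol: "h holomorphic_on - P"
  proof -
    have "h analytic_on - P"
      unfolding P_def by (subst analytic_on_analytic_at) (use mero in \<open>auto intro: nicely_meromorphic_on_imp_analytic_at\<close>)
    then show ?thesis by (rule analytic_imp_holomorphic)
  qed
  define n where "n p = nat (- zorder h p)" for p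
  define Q where "Q = (\<Prod>p\<in>P. [:- p, 1:] ^ n p)"
  have "Q \<noteq> 0"
    using fin by (simp add: Q_def P_def)
  have polyQ: "poly Q z = (\<Prod>p\<in>P. (z - p) ^ n p)" for z
    by (simp add: Q_def poly_prod)
  have "\<exists>E. E holomorphic_on UNIV \<and> (\<forall>z\<in>UNIV - P. E z = h z * poly Q z)"
  proof (rule removable_singularities)
    show "finite P" using fin by (simp add: P_def)
    show "(\<lambda>z. h z * poly Q z) holomorphic_on UNIV - P"
      using hol by (auto intro!: holomorphic_intros simp: Compl_eq_Diff_UNIV)
    fix p assume p: "p \<in> P"
    define S where "S = - (P - {p})"
    have "open S"
      unfolding S_def using fin by (intro open_Compl finite_imp_closed) (auto simp: P_def)
    have "S - {p} = - P" "p \<in> S"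
      using p by (auto simp: S_def)
    then obtain r where r: "zor_poly h p p \<noteq> 0" "r > 0" "cball p r \<subseteq> S" "zor_poly h p holomorphic_on cball p r"
        "\<And>w. w \<in> cball p r - {p} \<Longrightarrow> h w = zor_poly h p w / (w - p) ^ n p"
      using zorder_exist_pole [of h S p] \<open>open S\<close> hol p unfolding n_def P_def by auto
    define k where "k w = zor_poly h p w * (\<Prod>p'\<in>P - {p}. (w - p') ^ n p')" for w
    have ev: "\<forall>\<^sub>F w in at p. h w * poly Q w = k w"
    proof (rule eventually_at_in_open [THEN eventually_mono])
      fix w assume "w \<in> ball p r - {p}"
      then have w: "w \<in> cball p r - {p}" by auto
      have "poly Q w = (w - p) ^ n p * (\<Prod>p'\<in>P - {p}. (w - p') ^ n p')"
        unfolding polyQ using p fin by (subst prod.remove [of _ p]) (auto simp: P_def)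
      then show "h w * poly Q w = k w"
        using r(5) [OF w] w by (simp add: k_def)
    qed (use r in auto)
    have "isCont k p"
    proof -
      have "isCont (zor_poly h p) p"
        using r(2,4) by (meson ball_subset_cball centre_in_ball continuous_on_eq_continuous_at holomorphic_on_imp_continuous_on holomorphic_on_subset open_ball)
      then show ?thesis
        unfolding k_def by (intro continuous_intros)
    qed
    then have "((\<lambda>w. h w * poly Q w) \<longlongrightarrow> k p) (at p)"
      unfolding tendsto_cong [OF ev] by (rule isContD)
    then show "(\<lambda>w. h w * poly Q w) \<in> O[at p](\<lambda>_. 1)"
      by (intro bigoI_tendsto [where c = "k p"]) auto
  qed auto
  then obtain E where E: "E holomorphic_on UNIV" "\<And>z. z \<notin> P \<Longrightarrow> E z = h z * poly Q z"
    by auto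
  show ?thesis
    by (rule that [OF \<open>Q \<noteq> 0\<close> E(1)]) (simp add: E(2) P_def)
qed

section \<open>Values of a transcendental meromorphic function near infinity\<close>

locale transcendental_meromorphic =
  fixes f :: "complex \<Rightarrow> complex"
  assumes mero: "f nicely_meromorphic_on UNIV" and transc: "\<not> rational_function f"
begin

definition \<Omega> where "\<Omega> = {z. \<not> is_pole f z}"

lemma poles_sparse: "(- \<Omega>) sparse_in UNIV"
proof -
  obtain pts where pts: "pts sparse_in UNIV" "f analytic_on UNIV - pts"
    using nicely_meromorphic_onE [OF mero] by metis
  have "- \<Omega> \<subseteq> pts"
  proof
    fix z assume "z \<in> - \<Omega>"
    then have "\<not> f analytic_on {z}"
      by (auto simp: \<Omega>_def dest: analytic_at_imp_no_pole)
    then show "z \<in> pts"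
      using analytic_on_subset [OF pts(2), of "{z}"] by auto
  qed
  then show ?thesis
    using pts(1) by (rule sparse_in_subset2 [rotated])
qed

lemma open_\<Omega>: "open \<Omega>"
  using sparse_in_UNIV_imp_closed [OF poles_sparse] by (simp add: open_closed)

lemma f_analytic: "f analytic_on \<Omega>"
  unfolding \<Omega>_def by (subst analytic_on_analytic_at) (use mero in \<open>auto intro: nicely_meromorphic_on_imp_analytic_at\<close>)

lemma f_holomorphic: "f holomorphic_on \<Omega>"
  using f_analytic analytic_imp_holomorphic by blast

lemma f_continuous: "continuous_on \<Omega> f"
  using f_holomorphic holomorphic_on_imp_continuous_on by blast

lemma eventually_\<Omega>: "\<forall>\<^sub>F w in at z. w \<in> \<Omega>"
  using poles_sparse by (auto simp: sparse_in_eventually_iff)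

lemma not_constant_on:
  assumes "open S" "S \<noteq> {}"
  shows "\<not> f constant_on S"
proof
  assume "f constant_on S"
  then obtain c where c: "\<And>x. x \<in> S \<Longrightarrow> f x = c"
    by (auto simp: constant_on_def)
  obtain x where x: "x \<in> S" using assms(2) by blast
  have "\<not> (\<forall>\<^sub>\<approx>x\<in>UNIV. f x \<noteq> c)"
  proof
    assume "\<forall>\<^sub>\<approx>x\<in>UNIV. f x \<noteq> c"
    then have "\<forall>\<^sub>F w in at x. f w \<noteq> c"
      by (auto simp: eventually_cosparse_open_eq)
    moreover have "\<forall>\<^sub>F w in at x. w \<in> S"
      using x \<open>open S\<close> by (simp add: eventually_at_in_open')
    ultimately have "\<forall>\<^sub>F w in at x. False"
      by eventually_elim (use c in auto)
    then show False by simp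
  qed
  then have "f z = c" for z
    using nicely_meromorphic_imp_constant_or_avoid [OF mero, of c] by auto
  then have "rational_function f"
    by (intro rational_functionI [OF mero, of 1 "[:c:]"]) auto
  with transc show False ..
qed

text \<open>If \<open>f\<close> omits \<open>ball a \<epsilon>\<close> near infinity, then \<open>1 / (f - a)\<close> is bounded there, so it has finitely
  many poles and, after clearing them, polynomial growth.\<close>

lemma dense_values_near_infinity:
  assumes "open V" "V \<noteq> {}"
  shows "\<exists>z. M < cmod z \<and> z \<in> \<Omega> \<and> f z \<in> V"
proof (rule ccontr)
  assume no: "\<not> ?thesis"
  obtain a \<epsilon> where a: "\<epsilon> > 0" "ball a \<epsilon> \<subseteq> V"
    using assms open_contains_ball by blast
  have far: "\<epsilon> \<le> cmod (f z - a)" if "M < cmod z" "z \<in> \<Omega>" for z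
    using no that a(2) by (force simp: dist_norm norm_minus_commute)
  \<comment> \<open>Removing singularities gives \<open>h\<close> the value 0 at the poles of
    \<open>f\<close>, where \<open>f\<close> itself only carries a dummy value. So the bound
    \<open>inverse \<epsilon>\<close> holds at every point beyond \<open>M\<close>.\<close>
  define h where "h = remove_sings (\<lambda>z. inverse (f z - a))"
  have merof: "f meromorphic_on UNIV"
    using mero by (simp add: nicely_meromorphic_on_def)
  have meroh: "h nicely_meromorphic_on UNIV"
    unfolding h_def by (rule remove_sings_nicely_meromorphic) (intro meromorphic_intros merof)
  have h_in: "h z = inverse (f z - a)" if "z \<in> \<Omega>" "f z \<noteq> a" for z
  proof -
    have "f analytic_on {z}"
      by (rule analytic_on_subset [OF f_analytic]) (use that in simp)
    then have "(\<lambda>z. inverse (f z - a)) analytic_on {z}"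
      using that by (intro analytic_intros) auto
    then show ?thesis
      by (simp add: h_def)
  qed
  have h_pole: "h z = 0 \<and> \<not> is_pole h z" if "z \<notin> \<Omega>" for z
  proof -
    have "filterlim f at_infinity (at z)"
      using that by (simp add: \<Omega>_def is_pole_def)
    then have "filterlim (\<lambda>w. f w - a) at_infinity (at z)"
      using tendsto_add_filterlim_at_infinity [of "\<lambda>_. - a" "- a" "at z" f] by (simp add: add.commute)
    then have "((\<lambda>w. inverse (f w - a)) \<longlongrightarrow> 0) (at z)"
      by (rule filterlim_compose [OF tendsto_inverse_0])
    then have *: "h z = 0"
      unfolding h_def by (rule remove_sings_eqI)
    have "(\<lambda>w. inverse (f w - a)) meromorphic_on UNIV"
      by (intro meromorphic_intros merof)
    then have "isolated_singularity_at (\<lambda>w. inverse (f w - a)) z"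
      by (rule meromorphic_on_isolated_singularity [OF meromorphic_on_subset]) auto
    moreover have "\<not> is_pole (\<lambda>w. inverse (f w - a)) z"
      using \<open>((\<lambda>w. inverse (f w - a)) \<longlongrightarrow> 0) (at z)\<close> not_tendsto_and_filterlim_at_infinity [of "at z"]
      unfolding is_pole_def by auto
    ultimately have "\<not> is_pole h z"
      unfolding h_def by (simp add: is_pole_remove_sings_iff)
    with * show ?thesis by simp
  qed
  have h_bound: "cmod (h z) \<le> inverse \<epsilon>" if "M < cmod z" for z
  proof (cases "z \<in> \<Omega>")
    case True
    have "f z \<noteq> a" using far [OF that True] a(1) by auto
    then show ?thesis
      using h_in [OF True] far [OF that True] a(1) by (simp add: norm_inverse le_imp_inverse_le)
  qed (use h_pole a in auto)
  have pole_h: "cmod z \<le> M" if "is_pole h z" for z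
  proof (rule ccontr)
    assume "\<not> cmod z \<le> M"
    then have "\<forall>\<^sub>F w in at z. w \<in> {w. M < cmod w}"
      by (intro eventually_at_in_open') (auto intro!: open_Collect_less continuous_intros)
    moreover have "\<forall>\<^sub>F w in at z. inverse \<epsilon> + 1 \<le> norm (h w)"
      using that unfolding is_pole_def filterlim_at_infinity_conv_norm_at_top filterlim_at_top by blast
    ultimately have "\<forall>\<^sub>F w in at z. False"
      by eventually_elim (use h_bound in force)
    then show False by simp
  qed
  have "{z. is_pole h z} sparse_in UNIV"
    using meroh meromorphic_on_imp_not_pole_cosparse [of h UNIV]
    by (auto simp: nicely_meromorphic_on_def eventually_cosparse)
  have "finite (cball 0 M \<inter> {z. is_pole h z})"
    by (intro sparse_in_compact_finite sparse_in_subset [OF \<open>{z. is_pole h z} sparse_in UNIV\<close>]) auto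
  moreover have "cball 0 M \<inter> {z. is_pole h z} = {z. is_pole h z}"
    using pole_h by auto
  ultimately have "finite {z. is_pole h z}" by simp
  then obtain Q E where QE: "Q \<noteq> 0" "E holomorphic_on UNIV" "\<And>z. \<not> is_pole h z \<Longrightarrow> h z * poly Q z = E z"
    using clear_finitely_many_poles [OF meroh] by metis
  have "\<exists>P. \<forall>z. E z = poly P z"
  proof -
    define C where "C = (\<Sum>i\<le>degree Q. cmod (coeff Q i))"
    \<comment> \<open>Beyond \<open>M\<close> the function \<open>h\<close> is bounded and has no
      poles; beyond 1 every power of \<open>cmod z\<close> is dominated by the highest one.\<close>
    have "cmod (E z) \<le> inverse \<epsilon> * C * cmod z ^ degree Q" if z: "max M 1 + 1 \<le> cmod z" for z
    proof -
      have "\<not> is_pole h z" using pole_h [of z] z by auto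
      then have "cmod (E z) = cmod (h z) * cmod (poly Q z)"
        using QE(3) [of z] by (simp flip: norm_mult)
      also have "\<dots> \<le> inverse \<epsilon> * (C * cmod z ^ degree Q)"
      proof (rule mult_mono)
        show "cmod (h z) \<le> inverse \<epsilon>" using h_bound z by auto
        have "cmod (poly Q z) \<le> (\<Sum>i\<le>degree Q. cmod (coeff Q i * z ^ i))"
          unfolding poly_altdef by (rule norm_sum)
        also have "\<dots> \<le> (\<Sum>i\<le>degree Q. cmod (coeff Q i) * cmod z ^ degree Q)"
        proof (rule sum_mono)
          fix i assume "i \<in> {..degree Q}"
          then have "cmod z ^ i \<le> cmod z ^ degree Q"
            using z by (intro power_increasing) auto
          then show "cmod (coeff Q i * z ^ i) \<le> cmod (coeff Q i) * cmod z ^ degree Q"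
            by (simp add: norm_mult norm_power mult_left_mono)
        qed
        finally show "cmod (poly Q z) \<le> C * cmod z ^ degree Q"
          by (simp add: C_def sum_distrib_right)
      qed (use a in auto)
      finally show ?thesis by (simp add: mult.assoc)
    qed
    then have "E z = (\<Sum>k\<le>degree Q. (deriv ^^ k) E 0 / fact k * z ^ k)" for z
      by (rule Liouville_polynomial [OF QE(2)])
    then have "E z = poly (\<Sum>k\<le>degree Q. monom ((deriv ^^ k) E 0 / fact k) k) z" for z
      by (simp add: poly_sum poly_monom)
    then show ?thesis by blast
  qed
  then obtain P where P: "\<And>z. E z = poly P z" by blast
  have ev: "\<forall>\<^sub>F w in at z. w \<in> \<Omega> \<and> f w \<noteq> a \<and> \<not> is_pole h w" for z
  proof -
    have "\<not> (\<forall>x\<in>UNIV. f x = a)"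
      using not_constant_on [of UNIV] by (auto simp: constant_on_def)
    then have "\<forall>\<^sub>\<approx>x\<in>UNIV. f x \<noteq> a"
      using nicely_meromorphic_imp_constant_or_avoid [OF mero, of a] by auto
    then have "\<forall>\<^sub>F w in at z. f w \<noteq> a"
      by (auto simp: eventually_cosparse_open_eq)
    moreover have "\<forall>\<^sub>F w in at z. w \<notin> {z. is_pole h z}"
      using \<open>{z. is_pole h z} sparse_in UNIV\<close> by (auto simp: sparse_in_eventually_iff)
    ultimately show ?thesis
      using eventually_\<Omega> [of z] by eventually_elim auto
  qed
  \<comment> \<open>Inverting \<open>h = P / Q\<close> gives \<open>Q = P * (f - a)\<close>, which
    exhibits \<open>f\<close> as the quotient of \<open>Q + a * P\<close> by
    \<open>P\<close>.\<close>
  have *: "poly Q w = poly P w * (f w - a)" if "w \<in> \<Omega> \<and> f w \<noteq> a \<and> \<not> is_pole h w" for w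
  proof -
    have "poly P w = inverse (f w - a) * poly Q w"
      using that h_in [of w] QE(3) [of w] P [of w] by simp
    then show ?thesis
      using that by simp
  qed
  have "P \<noteq> 0"
  proof
    assume "P = 0"
    have "\<forall>\<^sub>F w in at 0. poly Q w = 0"
      using ev [of 0] by eventually_elim (use * \<open>P = 0\<close> in auto)
    moreover have "\<forall>\<^sub>F w in at 0. w \<notin> {w. poly Q w = 0}"
      using islimpt_finite [OF poly_roots_finite [OF QE(1)], of 0] unfolding islimpt_iff_eventually by blast
    ultimately have "\<forall>\<^sub>F w in at (0::complex). False"
      by eventually_elim auto
    then show False by simp
  qed
  have "rational_function f"
  proof (rule rational_functionI [OF mero \<open>P \<noteq> 0\<close>])
    show "\<forall>\<^sub>F w in at z. f w * poly P w = poly (Q + smult a P) w" for z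
      using ev [of z] by eventually_elim (use * in \<open>auto simp: algebra_simps\<close>)
  qed
  with transc show False ..
qed

end

text \<open>Compact sets are closed in this compactification, and closedness of a set that misses
  infinity means exactly that it comes from a compact set of the plane.\<close>

lemma compactin_riemann_sphere_Some [simp]: "compactin riemann_sphere (Some ` K) \<longleftrightarrow> compact K"
proof
  assume "compactin riemann_sphere (Some ` K)"
  then have "closedin riemann_sphere (Some ` K)"
    by (intro compactin_imp_closedin_gen kc_space_Alexandroff_compactification [THEN iffD2])
       (auto intro!: Hausdorff_imp_kc_space metrizable_imp_k_space metrizable_space_euclidean)
  then show "compact K" by simp
next
  assume "compact K"
  then show "compactin riemann_sphere (Some ` K)"
    by (intro image_compactin [OF _ continuous_map_Some]) simp
qed

section \<open>Complete invariance of the Fatou set\<close>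

context transcendental_meromorphic
begin

lemma sphere_domain [simp]: "sphere_domain f = range Some"
  using transc by (simp add: sphere_domain_def)

lemma sphere_map_\<Omega>: "z \<in> \<Omega> \<Longrightarrow> sphere_map f (Some z) = Some (f z)"
  by (simp add: \<Omega>_def)

lemma iterate_defined_all_iff:
  "(\<forall>n. iterate_defined_at f n (Some z)) \<longleftrightarrow> z \<in> \<Omega> \<and> (\<forall>n. iterate_defined_at f n (Some (f z)))"
proof -
  have "(\<forall>n. iterate_defined_at f n x) \<longleftrightarrow> (\<forall>k. (sphere_map f ^^ k) x \<in> range Some)" for x
    by (auto simp: iterate_defined_at_def simp del: funpow.simps)
  moreover have "(\<forall>k. (sphere_map f ^^ k) (Some z) \<in> range Some) \<longleftrightarrow>
      (\<forall>k. (sphere_map f ^^ k) (sphere_map f (Some z)) \<in> range Some)"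
  proof
    assume "\<forall>k. (sphere_map f ^^ k) (Some z) \<in> range Some"
    then have "(sphere_map f ^^ Suc k) (Some z) \<in> range Some" for k ..
    then show "\<forall>k. (sphere_map f ^^ k) (sphere_map f (Some z)) \<in> range Some"
      by (simp only: funpow_Suc_right o_apply) blast
  next
    assume *: "\<forall>k. (sphere_map f ^^ k) (sphere_map f (Some z)) \<in> range Some"
    show "\<forall>k. (sphere_map f ^^ k) (Some z) \<in> range Some"
    proof
      fix k show "(sphere_map f ^^ k) (Some z) \<in> range Some"
      proof (cases k)
        case (Suc j)
        then show ?thesis
          using * unfolding Suc funpow_Suc_right o_apply by blast
      qed simp
    qed
  qed
  moreover have "(\<forall>k. (sphere_map f ^^ k) (sphere_map f (Some z)) \<in> range Some) \<longleftrightarrow> 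
     z \<in> \<Omega> \<and> (\<forall>k. (sphere_map f ^^ k) (Some (f z)) \<in> range Some)"
  proof -
    have *: "z \<in> \<Omega>" if "\<forall>k. (sphere_map f ^^ k) (sphere_map f (Some z)) \<in> range Some"
      using that [rule_format, of 0] by (auto simp: \<Omega>_def split: if_splits)
    show ?thesis
    proof (cases "z \<in> \<Omega>")
      case True
      then show ?thesis
        unfolding sphere_map_\<Omega> [OF True] by simp
    next
      case False
      then show ?thesis
        using * by metis
    qed
  qed
  ultimately show ?thesis by simp
qed

text \<open>Infinity is outside the domain of a transcendental function, so already the first
  iterate is undefined there.\<close>

lemma fatou_finite: "None \<notin> fatou_set f"
proof
  assume "None \<in> fatou_set f"
  then have "iterate_defined_at f 1 None"
    unfolding fatou_set_def by blast
  then show False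
    by (auto simp: iterate_defined_at_def)
qed

text \<open>Neighborhoods may be taken in the plane: a neighborhood on the sphere where the first
  iterate is defined cannot contain infinity.\<close>

definition fatou_on :: "complex set \<Rightarrow> bool" where
  "fatou_on V \<longleftrightarrow> open V \<and> (\<forall>y\<in>V. \<forall>n. iterate_defined_at f n (Some y)) \<and>
     normal_family_on (Some ` V) (range (\<lambda>n. sphere_map f ^^ n))"

lemma Some_fatou_iff: "Some z \<in> fatou_set f \<longleftrightarrow> (\<exists>V. z \<in> V \<and> fatou_on V)"
proof
  assume "Some z \<in> fatou_set f"
  then obtain U where U: "openin riemann_sphere U" "Some z \<in> U" "\<forall>n. \<forall>y\<in>U. iterate_defined_at f n y"
      "normal_family_on U (range (\<lambda>n. sphere_map f ^^ n))"
    unfolding fatou_set_def by blast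
  have "y \<in> range Some" if "y \<in> U" for y
    using U(3) [rule_format, of y 1] that by (simp add: iterate_defined_at_def)
  then have UV: "U = Some ` (Some -` U)" by auto
  then have "open (Some -` U)"
    using U(1) openin_Alexandroff_compactification_image_Some [of euclidean "Some -` U"] by simp
  then show "\<exists>V. z \<in> V \<and> fatou_on V"
    unfolding fatou_on_def using U UV by (intro exI [of _ "Some -` U"]) auto
next
  assume "\<exists>V. z \<in> V \<and> fatou_on V"
  then obtain V where V: "z \<in> V" "fatou_on V" by blast
  then show "Some z \<in> fatou_set f"
    unfolding fatou_set_def fatou_on_def by (intro CollectI exI [of _ "Some ` V"]) auto
qed

text \<open>An iterate other than the identity is an earlier iterate composed with \<open>f\<close>,
  so convergence near \<open>f z\<close> pulls back along \<open>f\<close>. A sequence with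
  infinitely many identity terms has a constant subsequence and is treated separately.\<close>

lemma fatou_backward:
  assumes z: "z \<in> \<Omega>" and fz: "Some (f z) \<in> fatou_set f"
  shows "Some z \<in> fatou_set f"
proof -
  obtain W where W: "f z \<in> W" "open W" "\<forall>y\<in>W. \<forall>n. iterate_defined_at f n (Some y)"
     and norm: "normal_family_on (Some ` W) (range (\<lambda>n. sphere_map f ^^ n))"
    using fz unfolding Some_fatou_iff fatou_on_def by blast
  define U where "U = \<Omega> \<inter> f -` W"
  have "open U"
    unfolding U_def by (rule continuous_open_preimage [OF f_continuous open_\<Omega> W(2)])
  have "normal_family_on (Some ` U) (range (\<lambda>n. sphere_map f ^^ n))"
    unfolding normal_family_on_def
  proof (intro allI impI)
    fix s :: "nat \<Rightarrow> complex option \<Rightarrow> complex option"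
    assume "range s \<subseteq> range (\<lambda>n. sphere_map f ^^ n)"
    then have "\<forall>n. \<exists>m. s n = sphere_map f ^^ m" by blast
    then obtain m where m: "\<And>n. s n = sphere_map f ^^ m n" by metis
    show "\<exists>r g. strict_mono r \<and> (\<forall>K. compactin riemann_sphere K \<and> K \<subseteq> Some ` U \<longrightarrow>
            uniform_limit K (\<lambda>n x. stereographic (s (r n) x)) (\<lambda>x. stereographic (g x)) sequentially)"
    proof (cases "infinite {n. m n = 0}")
      case True
      then obtain r :: "nat \<Rightarrow> nat" where r: "strict_mono r" "\<And>n. r n \<in> {n. m n = 0}"
        using infinite_enumerate by blast
      then have "s (r n) = id" for n
        using m [of "r n"] by auto
      then show ?thesis
        using r(1) by (intro exI [of _ r] exI [of _ id]) (auto simp: uniform_limit_iff)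
    next
      case False
      then have "infinite {n. m n \<noteq> 0}"
        using finite_Collect_not [of "\<lambda>n. m n = 0"] infinite_UNIV_nat by simp
      then obtain r0 :: "nat \<Rightarrow> nat" where r0: "strict_mono r0" "\<And>n. r0 n \<in> {n. m n \<noteq> 0}"
        using infinite_enumerate by blast
      define t where "t n = sphere_map f ^^ (m (r0 n) - 1)" for n
      have "range t \<subseteq> range (\<lambda>n. sphere_map f ^^ n)"
        by (auto simp: t_def)
      then obtain r1 g where r1: "strict_mono r1" and g: "\<And>K. compactin riemann_sphere K \<and> K \<subseteq> Some ` W \<Longrightarrow>
            uniform_limit K (\<lambda>n x. stereographic (t (r1 n) x)) (\<lambda>x. stereographic (g x)) sequentially"
        using norm unfolding normal_family_on_def by meson
      have st: "s (r0 n) x = t n (sphere_map f x)" for n x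
        using r0(2) [of n] m [of "r0 n"] unfolding t_def
        by (cases "m (r0 n)") (auto simp: funpow_Suc_right simp del: funpow.simps)
      show ?thesis
      proof (intro exI [of _ "r0 \<circ> r1"] exI [of _ "g \<circ> sphere_map f"] conjI allI impI)
        show "strict_mono (r0 \<circ> r1)"
          using r0 r1 by (simp add: strict_mono_o)
        fix K assume "compactin riemann_sphere K \<and> K \<subseteq> Some ` U"
        then obtain K0 where K0: "K = Some ` K0" "compact K0" "K0 \<subseteq> U"
          by (metis compactin_riemann_sphere_Some inj_Some inj_image_subset_iff subset_image_iff)
        have "compact (f ` K0)"
          by (rule compact_continuous_image [OF continuous_on_subset [OF f_continuous]]) (use K0 in \<open>auto simp: U_def\<close>)
        then have ul: "uniform_limit (Some ` f ` K0) (\<lambda>n x. stereographic (t (r1 n) x)) (\<lambda>x. stereographic (g x)) sequentially"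
          by (intro g) (use K0 in \<open>auto simp: U_def\<close>)
        show "uniform_limit K (\<lambda>n x. stereographic (s ((r0 \<circ> r1) n) x)) (\<lambda>x. stereographic ((g \<circ> sphere_map f) x)) sequentially"
          unfolding uniform_limit_iff
        proof (intro allI impI)
          fix e :: real assume "e > 0"
          have *: "sphere_map f x \<in> Some ` f ` K0" if "x \<in> K" for x
            using that K0 sphere_map_\<Omega> by (auto simp: U_def simp del: sphere_map.simps)
          show "\<forall>\<^sub>F n in sequentially. \<forall>x\<in>K. dist (stereographic (s ((r0 \<circ> r1) n) x)) (stereographic ((g \<circ> sphere_map f) x)) < e"
            using ul [unfolded uniform_limit_iff, rule_format, OF \<open>e > 0\<close>]
          proof eventually_elim
            case (elim n)
            show ?case
              using bspec [OF elim *] by (simp add: st del: sphere_map.simps)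
          qed
        qed
      qed
    qed
  qed
  moreover have "\<forall>y\<in>U. \<forall>n. iterate_defined_at f n (Some y)"
    using iterate_defined_all_iff [THEN iffD2] W(3) unfolding U_def by (metis IntD1 IntD2 vimageD)
  ultimately show ?thesis
    unfolding Some_fatou_iff fatou_on_def using \<open>open U\<close> z W(1) by (intro exI [of _ U]) (auto simp: U_def)
qed

text \<open>The image of a small disc is open, and each iterate at \<open>y\<close> is the next
  iterate at a preimage of \<open>y\<close>. All preimages are taken in one closed disc, on which
  convergence is uniform.\<close>

lemma fatou_forward:
  assumes z: "Some z \<in> fatou_set f"
  shows "z \<in> \<Omega>" "Some (f z) \<in> fatou_set f"
proof -
  obtain U where U: "z \<in> U" "open U" "\<forall>y\<in>U. \<forall>n. iterate_defined_at f n (Some y)"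
     and norm: "normal_family_on (Some ` U) (range (\<lambda>n. sphere_map f ^^ n))"
    using z unfolding Some_fatou_iff fatou_on_def by blast
  have U\<Omega>: "y \<in> \<Omega> \<and> (\<forall>n. iterate_defined_at f n (Some (f y)))" if "y \<in> U" for y
    using iterate_defined_all_iff [THEN iffD1, OF U(3) [rule_format, OF that, THEN allI]] .
  then show "z \<in> \<Omega>" using U(1) by blast
  obtain e where e: "e > 0" "cball z e \<subseteq> U"
    using U open_contains_cball by blast
  define W where "W = f ` ball z e"
  have be: "ball z e \<subseteq> cball z e" by auto
  have "open W"
    unfolding W_def
  proof (rule open_mapping_thm)
    show "f holomorphic_on ball z e"
      using holomorphic_on_subset [OF f_holomorphic] U\<Omega> e be by blast
    show "\<not> f constant_on ball z e"
      using e by (intro not_constant_on) auto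
  qed (use e in auto)
  have "normal_family_on (Some ` W) (range (\<lambda>n. sphere_map f ^^ n))"
    unfolding normal_family_on_def
  proof (intro allI impI)
    fix s :: "nat \<Rightarrow> complex option \<Rightarrow> complex option"
    assume "range s \<subseteq> range (\<lambda>n. sphere_map f ^^ n)"
    then have "\<forall>n. \<exists>m. s n = sphere_map f ^^ m" by blast
    then obtain m where m: "\<And>n. s n = sphere_map f ^^ m n" by metis
    define t where "t n = sphere_map f ^^ Suc (m n)" for n
    have "range t \<subseteq> range (\<lambda>n. sphere_map f ^^ n)"
      unfolding t_def by blast
    then obtain r g where r: "strict_mono r" and g: "\<And>K. compactin riemann_sphere K \<and> K \<subseteq> Some ` U \<Longrightarrow>
          uniform_limit K (\<lambda>n x. stereographic (t (r n) x)) (\<lambda>x. stereographic (g x)) sequentially"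
      using norm unfolding normal_family_on_def by meson
    have ul: "uniform_limit (Some ` cball z e) (\<lambda>n x. stereographic (t (r n) x)) (\<lambda>x. stereographic (g x)) sequentially"
      by (rule g) (use e in auto)
    have "\<exists>u. u \<in> cball z e \<and> y = f u" if "y \<in> W" for y
      using that be unfolding W_def by blast
    \<comment> \<open>The choice of preimages may be discontinuous: uniform convergence on the
      closed disc transfers along any map into it.\<close>
    then obtain u where u: "\<And>y. y \<in> W \<Longrightarrow> u y \<in> cball z e" "\<And>y. y \<in> W \<Longrightarrow> y = f (u y)"
      by metis
    show "\<exists>r g. strict_mono r \<and> (\<forall>K. compactin riemann_sphere K \<and> K \<subseteq> Some ` W \<longrightarrow>
            uniform_limit K (\<lambda>n x. stereographic (s (r n) x)) (\<lambda>x. stereographic (g x)) sequentially)"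
    proof (intro exI [of _ r] exI [of _ "\<lambda>x. g (Some (u (the x)))"] conjI allI impI r)
      fix K assume K: "compactin riemann_sphere K \<and> K \<subseteq> Some ` W"
      have st: "s n x = t n (Some (u (the x)))" "Some (u (the x)) \<in> Some ` cball z e" if x: "x \<in> K" for n x
      proof -
        obtain y where y: "x = Some y" "y \<in> W" using x K by blast
        have "u y \<in> \<Omega>" using u(1) [OF y(2)] e U\<Omega> by blast
        then have "sphere_map f (Some (u y)) = x"
          using u(2) [OF y(2)] y sphere_map_\<Omega> by simp
        then show "s n x = t n (Some (u (the x)))"
          unfolding m t_def funpow_Suc_right using y by simp
        show "Some (u (the x)) \<in> Some ` cball z e"
          using u(1) [OF y(2)] y by simp
      qed
      show "uniform_limit K (\<lambda>n x. stereographic (s (r n) x)) (\<lambda>x. stereographic (g (Some (u (the x))))) sequentially"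
        unfolding uniform_limit_iff
      proof (intro allI impI)
        fix \<epsilon> :: real assume "\<epsilon> > 0"
        show "\<forall>\<^sub>F n in sequentially. \<forall>x\<in>K. dist (stereographic (s (r n) x)) (stereographic (g (Some (u (the x))))) < \<epsilon>"
          using ul [unfolded uniform_limit_iff, rule_format, OF \<open>\<epsilon> > 0\<close>]
        proof eventually_elim
          case (elim n)
          show ?case
            using bspec [OF elim st(2)] by (simp add: st(1))
        qed
      qed
    qed
  qed
  moreover have "\<forall>y\<in>W. \<forall>n. iterate_defined_at f n (Some y)"
    using U\<Omega> e be unfolding W_def by blast
  moreover have "f z \<in> W"
    using e by (auto simp: W_def)
  ultimately show "Some (f z) \<in> fatou_set f"
    unfolding Some_fatou_iff fatou_on_def using \<open>open W\<close> by blast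
qed

end

section \<open>Lifting through a function without singular values in the range\<close>

text \<open>These assumptions stand in for a covering property of \<open>f\<close> over
  \<open>{w. R < cmod w}\<close>: no critical points there gives local inverses, and no asymptotic
  values lets lifts be continued. Taking \<open>1 \<le> R\<close> keeps 0 out of the range and makes
  \<open>ln R\<close> nonnegative.\<close>

locale meromorphic_outside_singular_disc = transcendental_meromorphic +
  fixes R :: real
  assumes R: "1 \<le> R"
    and regular: "\<lbrakk>z \<in> \<Omega>; R < cmod (f z)\<rbrakk> \<Longrightarrow> deriv f z \<noteq> 0"
    and not_asymptotic: "R < cmod w \<Longrightarrow> \<not> asymptotic_value f (Some w)"
begin

section \<open>Uniqueness and continuation of lifts\<close>

definition is_lift :: "complex set \<Rightarrow> (complex \<Rightarrow> complex) \<Rightarrow> (complex \<Rightarrow> complex) \<Rightarrow> bool" where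
  "is_lift S \<phi> G \<longleftrightarrow> continuous_on S G \<and> (\<forall>x\<in>S. G x \<in> \<Omega> \<and> f (G x) = \<phi> x)"

lemma is_lift_subset: "is_lift S \<phi> G \<Longrightarrow> T \<subseteq> S \<Longrightarrow> is_lift T \<phi> G"
  by (auto simp: is_lift_def intro: continuous_on_subset)

lemma local_inverse:
  assumes "z \<in> \<Omega>" "R < cmod (f z)"
  obtains r L where "0 < r" "ball z r \<subseteq> \<Omega>" "inj_on f (ball z r)" "open (f ` ball z r)"
    "L holomorphic_on f ` ball z r" "\<And>x. x \<in> ball z r \<Longrightarrow> L (f x) = x"
proof -
  obtain r where r: "r > 0" "ball z r \<subseteq> \<Omega>" "inj_on f (ball z r)"
    using has_complex_derivative_locally_injective [OF f_holomorphic assms(1) open_\<Omega> regular [OF assms]] by metis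
  have hol: "f holomorphic_on ball z r"
    using f_holomorphic r(2) by (rule holomorphic_on_subset)
  obtain L where L: "L holomorphic_on f ` ball z r" "\<And>x. x \<in> ball z r \<Longrightarrow> L (f x) = x"
    using holomorphic_has_inverse [OF hol open_ball r(3)] by metis
  show ?thesis
    by (rule that [OF r open_mapping_thm3 [OF hol open_ball r(3)] L])
qed

text \<open>The set where the lifts agree is closed by continuity and open because \<open>f\<close>
  is locally injective at the common value.\<close>

lemma lift_unique:
  assumes S: "connected S" and G1: "is_lift S \<phi> G1" and G2: "is_lift S \<phi> G2"
    and \<phi>: "\<And>x. x \<in> S \<Longrightarrow> R < cmod (\<phi> x)" and a: "a \<in> S" "G1 a = G2 a" and x: "x \<in> S"
  shows "G1 x = G2 x"
proof -
  define E where "E = {x \<in> S. G1 x - G2 x = 0}"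
  have c: "continuous_on S G1" "continuous_on S G2"
    using G1 G2 by (auto simp: is_lift_def)
  have "closedin (top_of_set S) E"
    unfolding E_def by (rule continuous_closedin_preimage_constant) (intro continuous_intros c)
  moreover have "openin (top_of_set S) E"
  proof (subst openin_subopen, intro ballI)
    fix y assume y: "y \<in> E"
    then have yS: "y \<in> S" "G1 y = G2 y" by (auto simp: E_def)
    have "G1 y \<in> \<Omega>" "R < cmod (f (G1 y))"
      using G1 \<phi> yS by (auto simp: is_lift_def)
    then obtain r where r: "r > 0" "inj_on f (ball (G1 y) r)"
      by (rule local_inverse) (rule that; assumption)
    define T where "T = (S \<inter> G1 -` ball (G1 y) r) \<inter> (S \<inter> G2 -` ball (G1 y) r)"
    have "openin (top_of_set S) T"
      unfolding T_def by (intro openin_Int continuous_openin_preimage_gen c open_ball)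
    moreover have "y \<in> T"
      using r(1) yS by (simp add: T_def)
    moreover have "T \<subseteq> E"
    proof
      fix u assume "u \<in> T"
      then have u: "u \<in> S" "G1 u \<in> ball (G1 y) r" "G2 u \<in> ball (G1 y) r"
        by (auto simp: T_def)
      have "f (G1 u) = f (G2 u)"
        using G1 G2 u(1) by (simp add: is_lift_def)
      then show "u \<in> E"
        using inj_onD [OF r(2) _ u(2,3)] u(1) by (simp add: E_def)
    qed
    ultimately show "\<exists>T. openin (top_of_set S) T \<and> y \<in> T \<and> T \<subseteq> E" by blast
  qed
  ultimately have "E = {} \<or> E = S"
    using S unfolding connected_clopen by blast
  then show ?thesis
    using a x by (auto simp: E_def)
qed

lemma lift_holomorphic:
  assumes "open S" and \<phi>: "\<phi> holomorphic_on S" "\<And>x. x \<in> S \<Longrightarrow> R < cmod (\<phi> x)" and G: "is_lift S \<phi> G"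
  shows "G holomorphic_on S"
proof -
  have "G analytic_on {x}" if x: "x \<in> S" for x
  proof -
    have "G x \<in> \<Omega>" "R < cmod (f (G x))"
      using G \<phi> x by (auto simp: is_lift_def)
    then obtain r L where rL: "0 < r" "L holomorphic_on f ` ball (G x) r" "\<And>y. y \<in> ball (G x) r \<Longrightarrow> L (f y) = y"
      by (rule local_inverse) (rule that; assumption)
    define U where "U = S \<inter> G -` ball (G x) r"
    have "open U"
      unfolding U_def by (rule continuous_open_preimage) (use G \<open>open S\<close> in \<open>auto simp: is_lift_def\<close>)
    have fG: "f (G y) = \<phi> y" if "y \<in> S" for y
      using G that by (simp add: is_lift_def)
    have "L \<circ> \<phi> holomorphic_on U"
    proof (rule holomorphic_on_compose_gen)
      show "\<phi> holomorphic_on U"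
        using \<phi>(1) by (rule holomorphic_on_subset) (auto simp: U_def)
      show "\<phi> ` U \<subseteq> f ` ball (G x) r"
        using fG by (force simp: U_def)
    qed (rule rL)
    moreover have "(L \<circ> \<phi>) y = G y" if "y \<in> U" for y
      using that rL(3) [of "G y"] fG by (simp add: U_def)
    ultimately have "G holomorphic_on U"
      by (rule holomorphic_transform)
    moreover have "x \<in> U"
      using x rL by (simp add: U_def)
    ultimately show ?thesis
      unfolding analytic_at using \<open>open U\<close> by blast
  qed
  then have "G analytic_on S"
    by (subst analytic_on_analytic_at) blast
  then show ?thesis
    by (rule analytic_imp_holomorphic)
qed

text \<open>A lift that cannot be continued along a radius would run to infinity, so that the endpoint of the
  base path would be an asymptotic value.\<close>

lemma lift_boundary:
  assumes "0 < s" "s < 1" and \<phi>: "continuous_on (ball 0 1) \<phi>" "\<And>x. x \<in> ball 0 1 \<Longrightarrow> R < cmod (\<phi> x)"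
    and G: "is_lift (ball 0 s) \<phi> G" and \<zeta>: "\<zeta> \<in> sphere 0 s"
  shows "\<exists>\<delta>>0. \<exists>M. ball \<zeta> \<delta> \<subseteq> ball 0 1 \<and> is_lift (ball \<zeta> \<delta>) \<phi> M \<and> (\<forall>x \<in> ball \<zeta> \<delta> \<inter> ball 0 s. M x = G x)"
proof -
  have \<zeta>1: "\<zeta> \<in> ball 0 1" and n\<zeta>: "cmod \<zeta> = s" using assms by auto
  \<comment> \<open>The radius to \<open>\<zeta>\<close> is parametrized over \<open>{0..}\<close>,
    as the definition of an asymptotic value demands.\<close>
  define p where "p t = of_real (t / (1 + t)) * \<zeta>" for t :: real
  have pin: "p t \<in> ball 0 s" if "t \<ge> 0" for t
  proof -
    have "cmod (p t) = \<bar>t / (1 + t)\<bar> * s"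
      unfolding p_def norm_mult norm_of_real n\<zeta> ..
    moreover have "\<bar>t / (1 + t)\<bar> < 1"
      using that by simp
    ultimately show ?thesis
      using \<open>0 < s\<close> by (simp del: abs_divide)
  qed
  have contp: "continuous_on {0..} p"
    unfolding p_def by (intro continuous_intros) auto
  have limp: "(p \<longlongrightarrow> \<zeta>) at_top"
  proof -
    have "((\<lambda>t::real. t / (1 + t)) \<longlongrightarrow> 1) at_top" by real_asymp
    then have "((\<lambda>t. of_real (t / (1 + t)) * \<zeta>) \<longlongrightarrow> of_real 1 * \<zeta>) at_top"
      by (intro tendsto_intros)
    then show ?thesis by (simp add: p_def [abs_def])
  qed
  define \<gamma> where "\<gamma> t = G (p t)" for t
  have \<gamma>\<Omega>: "\<gamma> t \<in> \<Omega>" "f (\<gamma> t) = \<phi> (p t)" if "t \<ge> 0" for t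
    using G pin [OF that] by (auto simp: \<gamma>_def is_lift_def)
  have cont\<gamma>: "continuous_on {0..} \<gamma>"
    unfolding \<gamma>_def by (rule continuous_on_compose2 [OF _ contp]) (use G pin in \<open>auto simp: is_lift_def\<close>)
  have lim\<phi>: "((\<lambda>t. \<phi> (p t)) \<longlongrightarrow> \<phi> \<zeta>) at_top"
  proof (rule isCont_tendsto_compose [OF _ limp])
    show "isCont \<phi> \<zeta>"
      using \<phi>(1) \<zeta>1 by (simp add: continuous_on_eq_continuous_at)
  qed
  have "\<not> filterlim \<gamma> at_infinity at_top"
  proof
    assume inf: "filterlim \<gamma> at_infinity at_top"
    have "limitin euclidean (\<lambda>t. \<phi> (p t)) (\<phi> \<zeta>) at_top"
      using lim\<phi> by simp
    then have "limitin riemann_sphere (Some \<circ> (\<lambda>t. \<phi> (p t))) (Some (\<phi> \<zeta>)) at_top"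
      by (rule continuous_map_limit [OF continuous_map_Some])
    moreover have "\<forall>\<^sub>F t in at_top. (Some \<circ> (\<lambda>t. \<phi> (p t))) t = sphere_map f (Some (\<gamma> t))"
      using eventually_ge_at_top [of 0] by eventually_elim (use \<gamma>\<Omega> sphere_map_\<Omega> in simp)
    ultimately have "limitin riemann_sphere (\<lambda>t. sphere_map f (Some (\<gamma> t))) (Some (\<phi> \<zeta>)) at_top"
      by (rule limitin_transform_eventually [rotated])
    then have "asymptotic_value f (Some (\<phi> \<zeta>))"
      unfolding asymptotic_value_def using transc cont\<gamma> inf by blast
    with not_asymptotic \<phi>(2) [OF \<zeta>1] show False by blast
  qed
  then obtain B where B: "\<not> (\<forall>\<^sub>F t in at_top. B \<le> norm (\<gamma> t))"
    unfolding filterlim_at_infinity_conv_norm_at_top filterlim_at_top by blast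
  have "\<exists>t. real n \<le> t \<and> norm (\<gamma> t) \<le> B" for n :: nat
    using B unfolding eventually_at_top_linorder by (meson linear)
  then obtain t where t: "\<And>n. real n \<le> t n" "\<And>n. norm (\<gamma> (t n)) \<le> B"
    by metis
  have t0: "0 \<le> t n" for n using t(1) [of n] of_nat_0_le_iff [of n] by linarith
  have t_lim: "filterlim t at_top sequentially"
    by (rule filterlim_at_top_mono [OF filterlim_real_sequentially]) (use t(1) in auto)
  have "compact (cball (0::complex) B)" by simp
  moreover have "\<forall>n. \<gamma> (t n) \<in> cball 0 B" using t(2) by simp
  ultimately obtain z r where r: "strict_mono (r :: nat \<Rightarrow> nat)" "((\<gamma> \<circ> t) \<circ> r) \<longlonglongrightarrow> z"
    unfolding compact_def by (metis comp_def)
  have tr: "filterlim (t \<circ> r) at_top sequentially"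
    using filterlim_compose [OF t_lim filterlim_subseq [OF r(1)]] by (simp add: o_def)
  have lim1: "(\<lambda>n. f (\<gamma> (t (r n)))) \<longlonglongrightarrow> \<phi> \<zeta>"
  proof -
    have "(\<lambda>n. \<phi> (p (t (r n)))) \<longlonglongrightarrow> \<phi> \<zeta>"
      using filterlim_compose [OF lim\<phi> tr] by simp
    then show ?thesis using \<gamma>\<Omega>(2) t0 by simp
  qed
  have lim2: "(\<lambda>n. \<gamma> (t (r n))) \<longlonglongrightarrow> z"
    using r(2) by (simp add: o_def)
  \<comment> \<open>A pole is impossible as accumulation point of the lifted radius, because
    \<open>f\<close> tends to the finite value \<open>\<phi> \<zeta>\<close> along the
    sequence.\<close>
  have z\<Omega>: "z \<in> \<Omega>"
  proof (rule ccontr)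
    assume "z \<notin> \<Omega>"
    then have pole: "filterlim f at_infinity (at z)"
      by (simp add: \<Omega>_def is_pole_def)
    have ne: "\<gamma> (t (r n)) \<noteq> z" for n
      using \<gamma>\<Omega>(1) [OF t0 [of "r n"]] \<open>z \<notin> \<Omega>\<close> by metis
    have "filterlim (\<lambda>n. \<gamma> (t (r n))) (at z) sequentially"
      unfolding filterlim_at using lim2 ne by simp
    then have "filterlim (\<lambda>n. f (\<gamma> (t (r n)))) at_infinity sequentially"
      by (rule filterlim_compose [OF pole])
    then show False
      by (rule not_tendsto_and_filterlim_at_infinity [OF sequentially_bot lim1])
  qed
  have "isCont f z"
    using f_continuous z\<Omega> by (simp add: continuous_on_eq_continuous_at open_\<Omega>)
  then have "(\<lambda>n. f (\<gamma> (t (r n)))) \<longlonglongrightarrow> f z"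
    using lim2 by (rule isCont_tendsto_compose)
  then have fz: "f z = \<phi> \<zeta>"
    using lim1 by (rule LIMSEQ_unique)
  have "R < cmod (f z)"
    using fz \<phi>(2) [OF \<zeta>1] by simp
  then obtain \<rho> L where L: "0 < \<rho>" "ball z \<rho> \<subseteq> \<Omega>" "open (f ` ball z \<rho>)" "L holomorphic_on f ` ball z \<rho>"
       "\<And>x. x \<in> ball z \<rho> \<Longrightarrow> L (f x) = x"
    by (rule local_inverse [OF z\<Omega>]) (rule that; assumption)
  have "open (ball 0 1 \<inter> \<phi> -` (f ` ball z \<rho>))"
    by (rule continuous_open_preimage [OF \<phi>(1) open_ball L(3)])
  moreover have "\<zeta> \<in> ball 0 1 \<inter> \<phi> -` (f ` ball z \<rho>)"
    using \<zeta>1 fz L(1) by (auto intro!: image_eqI [of _ _ z])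
  ultimately obtain \<delta> where \<delta>: "\<delta> > 0" "ball \<zeta> \<delta> \<subseteq> ball 0 1 \<inter> \<phi> -` (f ` ball z \<rho>)"
    using open_contains_ball by blast
  define M where "M = L \<circ> \<phi>"
  have M: "is_lift (ball \<zeta> \<delta>) \<phi> M"
    unfolding is_lift_def
  proof (intro conjI ballI)
    show "continuous_on (ball \<zeta> \<delta>) M"
      unfolding M_def
    proof (rule continuous_on_compose)
      show "continuous_on (ball \<zeta> \<delta>) \<phi>" using \<phi>(1) \<delta>(2) continuous_on_subset by blast
      show "continuous_on (\<phi> ` ball \<zeta> \<delta>) L"
        using holomorphic_on_imp_continuous_on [OF L(4)] by (rule continuous_on_subset) (use \<delta> in blast)
    qed
    fix x assume "x \<in> ball \<zeta> \<delta>"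
    then obtain y where "y \<in> ball z \<rho>" "\<phi> x = f y" using \<delta>(2) by blast
    then show "M x \<in> \<Omega>" "f (M x) = \<phi> x"
      using L by (auto simp: M_def)
  qed
  have "\<forall>\<^sub>F n in sequentially. p (t (r n)) \<in> ball \<zeta> \<delta> \<and> \<gamma> (t (r n)) \<in> ball z \<rho>"
  proof (rule eventually_conj)
    have "(\<lambda>n. p (t (r n))) \<longlonglongrightarrow> \<zeta>"
      using filterlim_compose [OF limp tr] by simp
    then show "\<forall>\<^sub>F n in sequentially. p (t (r n)) \<in> ball \<zeta> \<delta>"
      using topological_tendstoD [OF _ open_ball] \<delta>(1) by (metis centre_in_ball)
    show "\<forall>\<^sub>F n in sequentially. \<gamma> (t (r n)) \<in> ball z \<rho>"
      using topological_tendstoD [OF lim2 open_ball] L(1) by (metis centre_in_ball)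
  qed
  then obtain n where n: "p (t (r n)) \<in> ball \<zeta> \<delta>" "\<gamma> (t (r n)) \<in> ball z \<rho>"
    by (auto simp: eventually_sequentially)
  \<comment> \<open>At \<open>q\<close> the lifted point already lies in the ball on which
    \<open>L\<close> inverts \<open>f\<close>, so \<open>M\<close> and \<open>G\<close> agree there;
    uniqueness spreads this over the convex intersection.\<close>
  define q where "q = p (t (r n))"
  have q: "q \<in> ball \<zeta> \<delta>" "q \<in> ball 0 s" "M q = G q"
    using n pin [OF t0] L(5) [OF n(2)] \<gamma>\<Omega>(2) [OF t0] by (auto simp: q_def M_def \<gamma>_def)
  have "M x = G x" if "x \<in> ball \<zeta> \<delta> \<inter> ball 0 s" for x
  proof (rule lift_unique [where S = "ball \<zeta> \<delta> \<inter> ball 0 s" and \<phi> = \<phi> and a = q and ?G1.0 = M and ?G2.0 = G])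
    show "connected (ball \<zeta> \<delta> \<inter> ball 0 s)"
      by (intro convex_connected convex_Int convex_ball)
    show "is_lift (ball \<zeta> \<delta> \<inter> ball 0 s) \<phi> M" "is_lift (ball \<zeta> \<delta> \<inter> ball 0 s) \<phi> G"
      using is_lift_subset [OF M] is_lift_subset [OF G] by auto
    show "R < cmod (\<phi> x)" if "x \<in> ball \<zeta> \<delta> \<inter> ball 0 s" for x
      using that \<delta>(2) \<phi>(2) by blast
  qed (use q that in auto)
  then show ?thesis
    using \<delta> M by blast
qed

text \<open>Let \<open>s\<close> be the supremum of the radii that admit a lift. By uniqueness the
  lifts glue to one of radius \<open>s\<close>. If \<open>s < 1\<close>, the continuations across
  boundary points glue as well, and compactness of the closed disc yields a lift of larger
  radius.\<close>

lemma disc_lift: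
  assumes \<phi>: "\<phi> holomorphic_on ball 0 1" "\<And>x. x \<in> ball 0 1 \<Longrightarrow> R < cmod (\<phi> x)"
    and z0: "z0 \<in> \<Omega>" "f z0 = \<phi> 0"
  shows "\<exists>g. is_lift (ball 0 1) \<phi> g \<and> g 0 = z0"
proof -
  have cont\<phi>: "continuous_on (ball 0 1) \<phi>"
    using \<phi>(1) holomorphic_on_imp_continuous_on by blast
  define T where "T = {s. 0 < s \<and> s \<le> 1 \<and> (\<exists>g. is_lift (ball 0 s) \<phi> g \<and> g 0 = z0)}"
  have Tne: "T \<noteq> {}"
  proof -
    have "R < cmod (f z0)" using z0 \<phi>(2) [of 0] by simp
    then obtain \<rho> L where L: "0 < \<rho>" "ball z0 \<rho> \<subseteq> \<Omega>" "open (f ` ball z0 \<rho>)" "L holomorphic_on f ` ball z0 \<rho>"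
         "\<And>x. x \<in> ball z0 \<rho> \<Longrightarrow> L (f x) = x"
      by (rule local_inverse [OF z0(1)]) (rule that; assumption)
    have "open (ball 0 1 \<inter> \<phi> -` (f ` ball z0 \<rho>))"
      by (rule continuous_open_preimage [OF cont\<phi> open_ball L(3)])
    moreover have "0 \<in> ball 0 1 \<inter> \<phi> -` (f ` ball z0 \<rho>)"
      using z0(2) L(1) by (auto intro!: image_eqI [of _ _ z0])
    ultimately obtain \<delta> where \<delta>: "\<delta> > 0" "ball 0 \<delta> \<subseteq> ball 0 1 \<inter> \<phi> -` (f ` ball z0 \<rho>)"
      using open_contains_ball by blast
    define s where "s = min 1 \<delta>"
    have s: "0 < s" "s \<le> 1" "ball 0 s \<subseteq> ball (0::complex) \<delta>"
      using \<delta>(1) by (auto simp: s_def)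
    have "is_lift (ball 0 s) \<phi> (L \<circ> \<phi>)"
      unfolding is_lift_def
    proof (intro conjI ballI)
      show "continuous_on (ball 0 s) (L \<circ> \<phi>)"
      proof (rule continuous_on_compose)
        show "continuous_on (ball 0 s) \<phi>" using cont\<phi> \<delta>(2) s(3) continuous_on_subset by blast
        show "continuous_on (\<phi> ` ball 0 s) L"
          using holomorphic_on_imp_continuous_on [OF L(4)] by (rule continuous_on_subset) (use \<delta> s in blast)
      qed
      fix x :: complex assume "x \<in> ball 0 s"
      then obtain y where "y \<in> ball z0 \<rho>" "\<phi> x = f y" using \<delta>(2) s(3) by blast
      then show "(L \<circ> \<phi>) x \<in> \<Omega>" "f ((L \<circ> \<phi>) x) = \<phi> x"
        using L by auto
    qed
    moreover have "(L \<circ> \<phi>) 0 = z0"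
      using L(1) L(5) [of z0] z0 by simp
    ultimately have "s \<in> T"
      unfolding T_def using s by blast
    then show ?thesis by blast
  qed
  have bdd: "bdd_above T"
    by (rule bdd_aboveI [of _ 1]) (auto simp: T_def)
  define s where "s = Sup T"
  have s01: "0 < s" "s \<le> 1"
  proof -
    obtain u where u: "u \<in> T" using Tne by blast
    then have "u \<le> s" unfolding s_def using bdd by (rule cSup_upper)
    then show "0 < s" using u by (auto simp: T_def)
    show "s \<le> 1" unfolding s_def by (rule cSup_least [OF Tne]) (auto simp: T_def)
  qed
  have "\<exists>g. \<forall>u\<in>T. is_lift (ball 0 u) \<phi> (g u) \<and> g u 0 = z0"
    by (rule bchoice) (auto simp: T_def)
  then obtain g where g: "\<And>u. u \<in> T \<Longrightarrow> is_lift (ball 0 u) \<phi> (g u)" "\<And>u. u \<in> T \<Longrightarrow> g u 0 = z0"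
    by blast
  have g_eq: "g u x = g v x" if "u \<in> T" "v \<in> T" "x \<in> ball 0 u" "x \<in> ball 0 v" for u v x
  proof (rule lift_unique [where S = "ball 0 u \<inter> ball 0 v" and \<phi> = \<phi> and a = 0 and ?G1.0 = "g u" and ?G2.0 = "g v"])
    show "connected (ball 0 u \<inter> ball (0::complex) v)"
      by (intro convex_connected convex_Int convex_ball)
    show "is_lift (ball 0 u \<inter> ball 0 v) \<phi> (g u)" "is_lift (ball 0 u \<inter> ball 0 v) \<phi> (g v)"
      using is_lift_subset [OF g(1)] that by auto
    show "R < cmod (\<phi> x)" if "x \<in> ball 0 u \<inter> ball 0 v" for x
      using that \<open>u \<in> T\<close> \<phi>(2) [of x] by (auto simp: T_def)
  qed (use that g in \<open>auto simp: T_def\<close>)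
  have "\<exists>u\<in>T. cmod x < u" if "x \<in> ball 0 s" for x :: complex
    using that less_cSup_iff [OF Tne bdd] by (auto simp: s_def)
  then obtain u where u: "\<And>x. x \<in> ball 0 s \<Longrightarrow> u x \<in> T \<and> cmod x < u x"
    by metis
  define G where "G x = g (u x) x" for x
  have G_eq: "G x = g v x" if "v \<in> T" "x \<in> ball 0 v" "x \<in> ball 0 s" for v x
    unfolding G_def by (rule g_eq) (use u [OF that(3)] that in auto)
  have G: "is_lift (ball 0 s) \<phi> G"
    unfolding is_lift_def
  proof (intro conjI ballI)
    have "isCont G x" if x: "x \<in> ball 0 s" for x
    proof -
      have "continuous_on (ball 0 (u x) \<inter> ball 0 s) G"
      proof (rule continuous_on_eq)
        show "continuous_on (ball 0 (u x) \<inter> ball 0 s) (g (u x))"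
          by (rule continuous_on_subset [of "ball 0 (u x)"]) (use g(1) [of "u x"] u [OF x] in \<open>auto simp: is_lift_def\<close>)
      qed (use u [OF x] G_eq [of "u x"] in auto)
      moreover have "x \<in> ball 0 (u x) \<inter> ball 0 s" using u [OF x] x by auto
      ultimately show ?thesis
        by (metis continuous_on_eq_continuous_at open_Int open_ball)
    qed
    then show "continuous_on (ball 0 s) G"
      by (intro continuous_at_imp_continuous_on) auto
    fix x :: complex assume x: "x \<in> ball 0 s"
    then show "G x \<in> \<Omega>" "f (G x) = \<phi> x"
      using u [OF x] g(1) [of "u x"] by (auto simp: G_def is_lift_def)
  qed
  have G0: "G 0 = z0"
    using u [of 0] s01 g(2) by (simp add: G_def)
  show ?thesis
  proof (cases "s = 1")
    case True
    then show ?thesis using G G0 by blast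
  next
    case False
    then have "s < 1" using s01 by simp
    have "\<exists>\<delta>>0. \<exists>M. ball \<zeta> \<delta> \<subseteq> ball 0 1 \<and> is_lift (ball \<zeta> \<delta>) \<phi> M \<and> (\<forall>x \<in> ball \<zeta> \<delta> \<inter> ball 0 s. M x = G x)"
      if \<zeta>: "\<zeta> \<in> cball 0 s" for \<zeta>
    proof (cases "\<zeta> \<in> sphere 0 s")
      case True
      show ?thesis
        by (rule lift_boundary [OF s01(1) \<open>s < 1\<close> cont\<phi> \<phi>(2) G True])
    next
      case False
      then have "\<zeta> \<in> ball 0 s" using \<zeta> by auto
      then obtain \<delta> where \<delta>: "\<delta> > 0" "ball \<zeta> \<delta> \<subseteq> ball 0 s"
        using open_contains_ball open_ball by blast
      moreover have "ball 0 s \<subseteq> ball (0::complex) 1" using s01 by auto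
      ultimately show ?thesis
        using is_lift_subset [OF G \<delta>(2)] by blast
    qed
    then obtain \<delta> M where M: "\<And>\<zeta>. \<zeta> \<in> cball 0 s \<Longrightarrow> 0 < \<delta> \<zeta>"
        "\<And>\<zeta>. \<zeta> \<in> cball 0 s \<Longrightarrow> ball \<zeta> (\<delta> \<zeta>) \<subseteq> ball 0 1"
        "\<And>\<zeta>. \<zeta> \<in> cball 0 s \<Longrightarrow> is_lift (ball \<zeta> (\<delta> \<zeta>)) \<phi> (M \<zeta>)"
        "\<And>\<zeta> x. \<zeta> \<in> cball 0 s \<Longrightarrow> x \<in> ball \<zeta> (\<delta> \<zeta>) \<inter> ball 0 s \<Longrightarrow> M \<zeta> x = G x"
      by metis
    have M_eq: "M \<zeta> y = M \<xi> y" if \<zeta>: "\<zeta> \<in> cball 0 s" "y \<in> ball \<zeta> (\<delta> \<zeta>)" and \<xi>: "\<xi> \<in> cball 0 s" "y \<in> ball \<xi> (\<delta> \<xi>)" for \<zeta> \<xi> y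
    proof -
      \<comment> \<open>Two overlapping balls must be shown to overlap inside
        \<open>ball 0 s\<close>, where both continuations equal \<open>G\<close>. Projecting a
        common point to the closed disc does not increase its distance to the two centres, since
        these lie in the disc.\<close>
      define D where "D = ball \<zeta> (\<delta> \<zeta>) \<inter> ball \<xi> (\<delta> \<xi>)"
      define q where "q = closest_point (cball 0 s) y"
      have ne: "cball (0::complex) s \<noteq> {}" using s01 by auto
      have near: "dist q a \<le> dist y a" if "a \<in> cball 0 s" for a
        using closest_point_lipschitz [OF convex_cball closed_cball ne, of y a] closest_point_self [OF that]
        by (simp add: q_def)
      have "q \<in> D"
        using near [OF \<zeta>(1)] near [OF \<xi>(1)] \<zeta> \<xi> by (simp add: D_def dist_commute)
      moreover have "q \<in> closure (ball 0 s)"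
        using closest_point_in_set [OF closed_cball ne, of y] s01 by (simp add: q_def closure_ball)
      ultimately have "D \<inter> ball 0 s \<noteq> {}"
        using open_Int_closure_eq_empty [of D "ball 0 s"] by (auto simp: D_def open_Int)
      then obtain a where a: "a \<in> D" "a \<in> ball 0 s" by blast
      show ?thesis
      proof (rule lift_unique [where S = D and \<phi> = \<phi> and a = a and ?G1.0 = "M \<zeta>" and ?G2.0 = "M \<xi>"])
        show "connected D"
          unfolding D_def by (intro convex_connected convex_Int convex_ball)
        show "is_lift D \<phi> (M \<zeta>)" "is_lift D \<phi> (M \<xi>)"
          by (rule is_lift_subset [OF M(3) [OF \<zeta>(1)]], simp add: D_def)
             (rule is_lift_subset [OF M(3) [OF \<xi>(1)]], simp add: D_def)
        show "R < cmod (\<phi> x)" if "x \<in> D" for x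
          using that M(2) [OF \<zeta>(1)] \<phi>(2) by (auto simp: D_def)
        show "M \<zeta> a = M \<xi> a"
          using a M(4) [OF \<zeta>(1), of a] M(4) [OF \<xi>(1), of a] by (simp add: D_def)
      qed (use a \<zeta> \<xi> in \<open>auto simp: D_def\<close>)
    qed
    define W where "W = (\<Union>\<zeta>\<in>cball 0 s. ball \<zeta> (\<delta> \<zeta>))"
    have "open W" by (auto simp: W_def)
    have "cball 0 s \<subseteq> W"
      using M(1) by (force simp: W_def)
    then obtain e where e: "e > 0" "(\<Union>x\<in>cball 0 s. ball x e) \<subseteq> W"
      using compact_subset_open_imp_ball_epsilon_subset [OF compact_cball \<open>open W\<close>] by metis
    have near: "ball 0 (s + e) \<subseteq> W"
    proof
      fix y :: complex assume y: "y \<in> ball 0 (s + e)"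
      show "y \<in> W"
      proof (cases "cmod y \<le> s")
        case True
        then show ?thesis using \<open>cball 0 s \<subseteq> W\<close> by auto
      next
        case False
        define x where "x = of_real (s / cmod y) * y"
        have y0: "cmod y > 0" using False s01 by linarith
        have "cmod x = s" using y0 s01 by (simp add: x_def norm_mult norm_divide)
        have "y - x = of_real (1 - s / cmod y) * y"
          by (simp add: x_def algebra_simps)
        then have "cmod (y - x) = \<bar>1 - s / cmod y\<bar> * cmod y"
          by (metis norm_mult norm_of_real)
        also have "\<dots> = cmod y - s"
          using False y0 s01 by (simp add: field_simps abs_if)
        also have "\<dots> < e" using y by simp
        finally have "y \<in> ball x e" by (simp add: dist_norm norm_minus_commute)
        moreover have "x \<in> cball 0 s"
          using \<open>cmod x = s\<close> by simp
        ultimately show ?thesis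
          using e(2) by blast
      qed
    qed
    have "\<exists>\<zeta>. \<zeta> \<in> cball 0 s \<and> y \<in> ball \<zeta> (\<delta> \<zeta>)" if "y \<in> W" for y
      using that by (auto simp: W_def)
    then obtain c where c: "\<And>y. y \<in> W \<Longrightarrow> c y \<in> cball 0 s" "\<And>y. y \<in> W \<Longrightarrow> y \<in> ball (c y) (\<delta> (c y))"
      by metis
    define G' where "G' y = M (c y) y" for y
    have G'_eq: "G' y = M \<zeta> y" if "\<zeta> \<in> cball 0 s" "y \<in> ball \<zeta> (\<delta> \<zeta>)" for y \<zeta>
    proof -
      have "y \<in> W" using that by (auto simp: W_def)
      then show ?thesis
        unfolding G'_def using M_eq c that by blast
    qed
    have "is_lift W \<phi> G'"
      unfolding is_lift_def
    proof (intro conjI ballI)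
      have "isCont G' x" if x: "x \<in> W" for x
      proof -
        have "continuous_on (ball (c x) (\<delta> (c x))) G'"
        proof (rule continuous_on_eq)
          show "continuous_on (ball (c x) (\<delta> (c x))) (M (c x))"
            using M(3) c(1) [OF x] by (simp add: is_lift_def)
          show "M (c x) y = G' y" if "y \<in> ball (c x) (\<delta> (c x))" for y
            using G'_eq [OF c(1) [OF x] that] by simp
        qed
        then show ?thesis
          using c(2) [OF x] by (metis continuous_on_eq_continuous_at open_ball)
      qed
      then show "continuous_on W G'"
        by (intro continuous_at_imp_continuous_on) auto
      fix x assume x: "x \<in> W"
      show "G' x \<in> \<Omega>" "f (G' x) = \<phi> x"
        using M(3) [OF c(1) [OF x]] c(2) [OF x] by (simp_all add: is_lift_def G'_def)
    qed
    moreover define v where "v = min 1 (s + e)"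
    ultimately have "is_lift (ball 0 v) \<phi> G'"
      by (rule_tac is_lift_subset) (use near in auto)
    moreover have "G' 0 = z0"
      using G'_eq [of 0 0] M(1) [of 0] M(4) [of 0 0] s01 G0 by simp
    ultimately have "v \<in> T"
      unfolding T_def using s01 e(1) by (auto simp: v_def)
    then have "v \<le> s"
      unfolding s_def using bdd by (rule cSup_upper)
    with \<open>s < 1\<close> e(1) show ?thesis
      by (auto simp: v_def)
  qed
qed

abbreviation half_plane :: "complex set" where
  "half_plane \<equiv> {z. Re z > ln R}"

lemma norm_exp_half_plane: "z \<in> half_plane \<Longrightarrow> R < cmod (exp z)"
  using R by simp (metis exp_less_mono exp_ln less_le_trans zero_less_one)

text \<open>The disc result is carried over by a Cayley transform: \<open>k\<close> maps the unit
  disc into the half-plane and 0 to the logarithm \<open>\<zeta>\<close> of \<open>f z0\<close>, and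
  \<open>m\<close> is its inverse. The point \<open>c\<close> is the projection of
  \<open>\<zeta>\<close> to the boundary line, at distance \<open>a\<close>.\<close>

lemma half_plane_lift:
  assumes "z0 \<in> \<Omega>" "R < cmod (f z0)"
  shows "\<exists>G \<zeta>. is_lift half_plane exp G \<and> \<zeta> \<in> half_plane \<and> G \<zeta> = z0"
proof -
  have "f z0 \<noteq> 0" using assms R by auto
  define \<zeta> where "\<zeta> = Ln (f z0)"
  have exp\<zeta>: "exp \<zeta> = f z0" using \<open>f z0 \<noteq> 0\<close> by (simp add: \<zeta>_def)
  have Re\<zeta>: "Re \<zeta> > ln R"
    using assms R \<open>f z0 \<noteq> 0\<close> by (simp add: \<zeta>_def)
  define a where "a = Re \<zeta> - ln R"
  have "a > 0" using Re\<zeta> by (simp add: a_def)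
  define c where "c = \<zeta> - of_real a"
  have Rec: "Re c = ln R" by (simp add: c_def a_def)
  define k where "k x = c + of_real a * (1 + x) / (1 - x)" for x
  define m where "m z = (z - c - of_real a) / (z - c + of_real a)" for z
  have k_in: "k x \<in> half_plane" if "x \<in> ball 0 1" for x
  proof -
    have "x \<noteq> 1" using that by auto
    have "(1 + x) / (1 - x) = (1 + x) * cnj (1 - x) / of_real ((cmod (1 - x))\<^sup>2)"
      by (rule complex_div_cnj)
    then have "Re ((1 + x) / (1 - x)) = Re ((1 + x) * cnj (1 - x)) / (cmod (1 - x))\<^sup>2"
      by (simp only: Re_divide_of_real)
    also have "Re ((1 + x) * cnj (1 - x)) = 1 - (cmod x)\<^sup>2"
      unfolding cmod_power2 by (simp add: algebra_simps power2_eq_square)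
    finally have "Re ((1 + x) / (1 - x)) = (1 - (cmod x)\<^sup>2) / (cmod (1 - x))\<^sup>2" .
    moreover have "(cmod x)\<^sup>2 < 1"
      using that by (simp add: abs_square_less_1)
    ultimately have "Re ((1 + x) / (1 - x)) > 0"
      using \<open>x \<noteq> 1\<close> by simp
    moreover have "Re (k x) = ln R + a * Re ((1 + x) / (1 - x))"
    proof -
      define w where "w = (1 + x) / (1 - x)"
      have "k x = c + of_real a * w"
        by (simp add: k_def w_def)
      then show ?thesis
        unfolding w_def [symmetric] by (simp add: Rec)
    qed
    ultimately show ?thesis
      using \<open>a > 0\<close> by simp
  qed
  have m_in: "m z \<in> ball 0 1" "z - c + of_real a \<noteq> 0" if "z \<in> half_plane" for z
  proof -
    define u where "u = z - c"
    have "Re u > 0" using that Rec by (simp add: u_def)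
    have "(cmod (u - of_real a))\<^sup>2 < (cmod (u + of_real a))\<^sup>2"
      unfolding cmod_power2 using \<open>Re u > 0\<close> \<open>a > 0\<close> by (simp add: power2_eq_square algebra_simps)
    then have "cmod (u - of_real a) < cmod (u + of_real a)"
      by (rule power_less_imp_less_base) simp
    moreover have "Re (u + of_real a) > 0" using \<open>Re u > 0\<close> \<open>a > 0\<close> by simp
    then have "u + of_real a \<noteq> 0"
      by (metis less_irrefl zero_complex.sel(1))
    ultimately show "m z \<in> ball 0 1" "z - c + of_real a \<noteq> 0"
      by (simp_all add: m_def u_def norm_divide)
  qed
  have km: "k (m z) = z" if "z \<in> half_plane" for z
  proof -
    define u where "u = z - c"
    have ne: "u + of_real a \<noteq> 0" using m_in(2) [OF that] by (simp add: u_def)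
    have 1: "1 + m z = 2 * u / (u + of_real a)" "1 - m z = 2 * of_real a / (u + of_real a)"
      using ne by (simp_all add: m_def u_def field_simps)
    define d where "d = u + of_real a"
    have "d \<noteq> 0" using ne by (simp add: d_def)
    then have "of_real a * (1 + m z) / (1 - m z) = u"
      unfolding 1 d_def [symmetric] using \<open>a > 0\<close> by (simp add: field_simps)
    then show ?thesis by (simp add: k_def u_def)
  qed
  have "\<exists>g. is_lift (ball 0 1) (exp \<circ> k) g \<and> g 0 = z0"
  proof (rule disc_lift)
    have "k holomorphic_on ball 0 1"
      unfolding k_def by (intro holomorphic_intros) auto
    then show "exp \<circ> k holomorphic_on ball 0 1"
      by (rule holomorphic_on_compose) (auto intro: holomorphic_on_exp)
    show "R < cmod ((exp \<circ> k) x)" if "x \<in> ball 0 1" for x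
      using norm_exp_half_plane [OF k_in [OF that]] by simp
    show "f z0 = (exp \<circ> k) 0"
      using exp\<zeta> by (simp add: k_def c_def)
  qed (use assms in auto)
  then obtain g where g: "is_lift (ball 0 1) (exp \<circ> k) g" "g 0 = z0" by blast
  have "is_lift half_plane exp (g \<circ> m)"
    unfolding is_lift_def
  proof (intro conjI ballI)
    show "continuous_on half_plane (g \<circ> m)"
    proof (rule continuous_on_compose)
      show "continuous_on half_plane m"
        unfolding m_def using m_in(2) by (intro continuous_intros) blast
      show "continuous_on (m ` half_plane) g"
        by (rule continuous_on_subset [of "ball 0 1"]) (use g(1) m_in(1) in \<open>auto simp: is_lift_def\<close>)
    qed
    fix z assume z: "z \<in> half_plane"
    show "(g \<circ> m) z \<in> \<Omega>" "f ((g \<circ> m) z) = exp z"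
      using g(1) m_in(1) [OF z] km [OF z] by (simp_all add: is_lift_def)
  qed
  moreover have "(g \<circ> m) \<zeta> = z0"
    using g(2) by (simp add: m_def c_def)
  ultimately show ?thesis
    using Re\<zeta> by blast
qed

end

section \<open>Logarithmic tracts\<close>

locale exponential_lift = meromorphic_outside_singular_disc +
  fixes G :: "complex \<Rightarrow> complex"
  assumes lift: "is_lift half_plane exp G"
begin

lemma G_\<Omega>: "z \<in> half_plane \<Longrightarrow> G z \<in> \<Omega>"
  and f_G: "z \<in> half_plane \<Longrightarrow> f (G z) = exp z"
  using lift by (auto simp: is_lift_def)

lemma continuous_G: "continuous_on half_plane G"
  using lift by (simp add: is_lift_def)

lemma holomorphic_G: "G holomorphic_on half_plane"
  by (rule lift_holomorphic [OF open_halfspace_Re_gt _ norm_exp_half_plane lift]) (auto intro: holomorphic_on_exp)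

lemma connected_half_plane: "connected {z. Re z > x}"
  by (simp add: convex_halfspace_Re_gt convex_connected)

lemma open_image_G:
  assumes "open U" "U \<subseteq> half_plane"
  shows "open (G ` U)"
proof (rule open_mapping_thm [OF holomorphic_G open_halfspace_Re_gt connected_half_plane assms])
  show "\<not> G constant_on half_plane"
  proof
    assume "G constant_on half_plane"
    then obtain c where "\<And>z. z \<in> half_plane \<Longrightarrow> G z = c"
      by (auto simp: constant_on_def)
    then have "exp z = f c" if "z \<in> half_plane" for z
      using f_G [OF that] that by simp
    then have "exp (of_real (ln R + 1)) = f c" "exp (of_real (ln R + 2)) = f c"
      by simp_all
    then have "cmod (exp (of_real (ln R + 1))) = cmod (exp (of_real (ln R + 2)))"
      by simp
    then show False
      unfolding norm_exp_eq_Re by simp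
  qed
qed

section \<open>Periods of a lift of the exponential function\<close>

definition T :: complex where "T = 2 * of_real pi * \<i>"

lemma T_simps [simp]: "Re T = 0" "Im T = 2 * pi" "T \<noteq> 0"
  by (auto simp: T_def)

lemma exp_shift: "exp (z + of_int n * T) = exp z"
  using exp_integer_2pi [of "of_int n"] by (simp add: T_def exp_add mult_ac)

definition has_period :: "nat \<Rightarrow> bool" where
  "has_period n \<longleftrightarrow> 0 < n \<and> (\<forall>z\<in>half_plane. G (z + of_nat n * T) = G z)"

text \<open>The translate of \<open>G\<close> by a multiple of \<open>T\<close> is again a lift of
  \<open>exp\<close>, so agreement with \<open>G\<close> at one point is agreement
  everywhere.\<close>

lemma has_periodI:
  assumes "0 < n" "a \<in> half_plane" "G (a + of_nat n * T) = G a"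
  shows "has_period n"
proof -
  have "is_lift half_plane exp (\<lambda>z. G (z + of_nat n * T))"
    unfolding is_lift_def
  proof (intro conjI ballI)
    show "continuous_on half_plane (\<lambda>z. G (z + of_nat n * T))"
      by (rule continuous_on_compose2 [OF continuous_G]) (auto intro!: continuous_intros)
    fix z assume "z \<in> half_plane"
    then have "z + of_nat n * T \<in> half_plane" by simp
    then show "G (z + of_nat n * T) \<in> \<Omega>" "f (G (z + of_nat n * T)) = exp z"
      using G_\<Omega> f_G exp_shift [of z "int n"] by auto
  qed
  then have "G (z + of_nat n * T) = G z" if "z \<in> half_plane" for z
    using lift_unique [OF connected_half_plane _ lift norm_exp_half_plane assms(2), where ?G1.0 = "\<lambda>z. G (z + of_nat n * T)"]
      assms(3) that by simp
  with assms(1) show ?thesis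
    by (simp add: has_period_def)
qed

lemma has_period_if_not_injective:
  assumes "a \<in> half_plane" "b \<in> half_plane" "a \<noteq> b" "G a = G b"
  shows "\<exists>n. has_period n"
proof -
  have "exp a = exp b"
    using f_G assms by metis
  then obtain n :: int where n: "a = b + of_int n * T"
    unfolding exp_eq by (auto simp: T_def mult_ac)
  show ?thesis
  proof (cases "n > 0")
    case True
    then have "a = b + of_nat (nat n) * T" using n by simp
    then have "has_period (nat n)"
      using True assms by (intro has_periodI [of _ b]) auto
    then show ?thesis ..
  next
    case False
    have "n \<noteq> 0" using n assms(3) by auto
    with False have "n < 0" by simp
    then have "b = a + of_nat (nat (- n)) * T" using n by (simp add: algebra_simps)
    then have "has_period (nat (- n))"
      using \<open>n < 0\<close> assms by (intro has_periodI [of _ a]) auto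
    then show ?thesis ..
  qed
qed

lemma has_period_int:
  assumes "has_period n" "z \<in> half_plane"
  shows "G (z + of_int m * (of_nat n * T)) = G z"
proof (induction m rule: int_induct [where k = 0])
  case base
  show ?case by simp
next
  case (step1 i)
  have "G ((z + of_int i * (of_nat n * T)) + of_nat n * T) = G (z + of_int i * (of_nat n * T))"
    using assms by (simp add: has_period_def)
  then show ?case using step1 by (simp add: algebra_simps)
next
  case (step2 i)
  have "G ((z + of_int (i - 1) * (of_nat n * T)) + of_nat n * T) = G (z + of_int (i - 1) * (of_nat n * T))"
    using assms by (simp add: has_period_def)
  then show ?case using step2 by (simp add: algebra_simps)
qed

text \<open>Periodicity reduces the vertical strip to one compact rectangle whose height is the
  period.\<close>

lemma compact_strip_image:
  assumes n: "has_period n" and "ln R < x"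
  shows "compact (G ` {z. x \<le> Re z \<and> Re z \<le> y})"
proof -
  define p where "p = 2 * pi * real n"
  have "p > 0" using n by (simp add: p_def has_period_def)
  have "G ` {z. x \<le> Re z \<and> Re z \<le> y} = G ` cbox (Complex x 0) (Complex y p)"
  proof
    show "G ` cbox (Complex x 0) (Complex y p) \<subseteq> G ` {z. x \<le> Re z \<and> Re z \<le> y}"
      by (intro image_mono) (auto simp: in_cbox_complex_iff)
    show "G ` {z. x \<le> Re z \<and> Re z \<le> y} \<subseteq> G ` cbox (Complex x 0) (Complex y p)"
    proof (rule image_subsetI)
      fix z assume z: "z \<in> {z. x \<le> Re z \<and> Re z \<le> y}"
      define m where "m = \<lfloor>Im z / p\<rfloor>"
      have "real_of_int m \<le> Im z / p" "Im z / p < real_of_int m + 1"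
        unfolding m_def by linarith+
      then have m: "real_of_int m * p \<le> Im z" "Im z \<le> real_of_int m * p + p"
        using \<open>p > 0\<close> by (simp_all add: field_simps)
      define w where "w = z + of_int (- m) * (of_nat n * T)"
      have "G z = G w"
        using has_period_int [OF n, of z "- m"] z assms(2) by (simp add: w_def)
      moreover have "Re w = Re z" "Im w = Im z - real_of_int m * p"
        by (simp_all add: w_def p_def)
      then have "w \<in> cbox (Complex x 0) (Complex y p)"
        using z m by (simp add: in_cbox_complex_iff)
      ultimately show "G z \<in> G ` cbox (Complex x 0) (Complex y p)"
        by (rule image_eqI)
    qed
  qed
  moreover have "compact (G ` cbox (Complex x 0) (Complex y p))"
    by (rule compact_continuous_image [OF continuous_on_subset [OF continuous_G] compact_cbox])
       (use assms(2) in \<open>auto simp: in_cbox_complex_iff\<close>)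
  ultimately show ?thesis by simp
qed

text \<open>The part beyond \<open>y\<close> stays at distance \<open>e\<close> from
  \<open>z\<close> and the remaining part lies in a compact image, so passing to the closure can add
  only the boundary line; hence \<open>\<le>\<close> in place of \<open><\<close>.\<close>

lemma closure_strip_image:
  assumes n: "has_period n" and x: "ln R < x" and e: "0 < e" "\<And>w. y < Re w \<Longrightarrow> e \<le> dist (G w) z"
    and z: "z \<in> closure (G ` {w. x < Re w})"
  shows "z \<in> G ` {w. x \<le> Re w}"
proof -
  have "{w. x < Re w} \<subseteq> {w. x \<le> Re w \<and> Re w \<le> y} \<union> {w. y < Re w}"
    by auto
  then have "G ` {w. x < Re w} \<subseteq> G ` {w. x \<le> Re w \<and> Re w \<le> y} \<union> G ` {w. y < Re w}"
    unfolding image_Un [symmetric] by (rule image_mono)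
  then have "z \<in> closure (G ` {w. x \<le> Re w \<and> Re w \<le> y} \<union> G ` {w. y < Re w})"
    using z by (rule subsetD [OF closure_mono])
  moreover have "z \<notin> closure (G ` {w. y < Re w})"
    unfolding closure_approachable using e by force
  ultimately have "z \<in> closure (G ` {w. x \<le> Re w \<and> Re w \<le> y})"
    by (simp add: closure_Un)
  then have "z \<in> G ` {w. x \<le> Re w \<and> Re w \<le> y}"
    using compact_imp_closed [OF compact_strip_image [OF n x]] by (simp add: closure_closed)
  then show ?thesis by blast
qed

text \<open>A periodic \<open>G\<close> that tends to infinity covers a neighborhood of infinity, where \<open>f\<close> would then omit
  the disc of radius \<open>R\<close>.\<close>

lemma not_periodic_tending_to_infinity:
  assumes n: "has_period n" and inf: "\<And>B. \<exists>N. \<forall>z. N < Re z \<longrightarrow> B < cmod (G z)"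
  shows False
proof -
  define x where "x = ln R + 1"
  have x: "ln R < x" by (simp add: x_def)
  define W where "W = G ` {w. x < Re w}"
  \<comment> \<open>A strip of width 0: \<open>Z\<close> is the compact image of the boundary line
    of \<open>W\<close>. Away from \<open>Z\<close> the set \<open>W\<close> is relatively clopen in
    the exterior of a disc.\<close>
  define Z where "Z = G ` {w. x \<le> Re w \<and> Re w \<le> x}"
  have "open W"
    unfolding W_def using x by (intro open_image_G) (auto simp: open_halfspace_Re_gt)
  have "bounded Z"
    unfolding Z_def using compact_strip_image [OF n x] compact_imp_bounded by blast
  then obtain M where M: "\<And>z. z \<in> Z \<Longrightarrow> cmod z \<le> M"
    by (auto simp: bounded_iff)
  define S where "S = - cball (0::complex) M"
  have "connected S"
    unfolding S_def by (rule connected_complement_bounded_convex) auto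
  have cl: "z \<in> W" if z: "z \<in> S" "z \<in> closure W" for z
  proof -
    obtain y where y: "\<And>w. y < Re w \<Longrightarrow> cmod z + 1 < cmod (G w)"
      using inf by meson
    have "1 \<le> dist (G w) z" if "y < Re w" for w
      using y [OF that] norm_triangle_ineq2 [of "G w" z] by (simp add: dist_norm)
    then obtain w where w: "x \<le> Re w" "z = G w"
      using closure_strip_image [OF n x zero_less_one _ z(2) [unfolded W_def]] by blast
    have "z \<notin> Z" using M [of z] z(1) by (auto simp: S_def)
    then have "Re w \<noteq> x" using w by (auto simp: Z_def)
    then show ?thesis using w by (auto simp: W_def)
  qed
  obtain y where y: "\<And>w. y < Re w \<Longrightarrow> M < cmod (G w)"
    using inf by meson
  define w where "w = complex_of_real (max x y + 1)"
  have "x < Re w" "y < Re w" by (auto simp: w_def)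
  then have "G w \<in> W" "G w \<in> S"
    using y [of w] by (auto simp: W_def S_def)
  moreover have "W \<inter> S = {} \<or> (- closure W) \<inter> S = {}"
  proof (rule connectedD [OF \<open>connected S\<close> \<open>open W\<close>])
    show "S \<subseteq> W \<union> - closure W" using cl by blast
    show "W \<inter> - closure W \<inter> S = {}" using closure_subset by blast
  qed (simp add: open_Compl)
  ultimately have "S \<subseteq> closure W" by blast
  then have SW: "S \<subseteq> W" using cl by blast
  obtain z where z: "M < cmod z" "f z \<in> ball 0 R"
    using dense_values_near_infinity [of "ball 0 R" M] R by auto
  then have "z \<in> W" using SW by (auto simp: S_def)
  then obtain w where "x < Re w" "z = G w" by (auto simp: W_def)
  then have "w \<in> half_plane" using x by simp
  then show False
    using z(2) f_G norm_exp_half_plane [of w] \<open>z = G w\<close> by simp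
qed

text \<open>A bounded sequence of values \<open>G (\<zeta> n)\<close> with real parts tending to
  infinity accumulates at some \<open>p\<close>, and \<open>p\<close> is a pole because
  \<open>exp\<close> is unbounded along the sequence. On a small circle about \<open>p\<close> the
  function \<open>f\<close> is bounded, so the image of a far half-plane cannot cross it. The
  discrete set of points with a given value then forces two translates to coincide, which gives a
  period.\<close>

lemma trapped_at_pole:
  assumes "\<not> (\<forall>B. \<exists>N. \<forall>z. N < Re z \<longrightarrow> B < cmod (G z))"
  shows "\<exists>p n. p \<notin> \<Omega> \<and> has_period n \<and> (\<forall>e>0. \<exists>N. \<forall>z. N < Re z \<longrightarrow> dist (G z) p < e)"
proof -
  obtain B where B: "\<And>N. \<exists>z. N < Re z \<and> cmod (G z) \<le> B"
    using assms by (meson not_less)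
  have "\<exists>z. max (ln R) (real n) < Re z \<and> cmod (G z) \<le> B" for n :: nat
    by (rule B)
  then obtain \<zeta> where \<zeta>: "\<And>n. max (ln R) (real n) < Re (\<zeta> n)" "\<And>n. cmod (G (\<zeta> n)) \<le> B"
    by metis
  have \<zeta>H: "\<zeta> n \<in> half_plane" for n using \<zeta>(1) [of n] by simp
  have "seq_compact (cball (0::complex) B)"
    using compact_cball compact_imp_seq_compact by blast
  moreover have "\<forall>n. (G \<circ> \<zeta>) n \<in> cball 0 B" using \<zeta>(2) by simp
  ultimately obtain p r where r: "strict_mono (r :: nat \<Rightarrow> nat)" "((G \<circ> \<zeta>) \<circ> r) \<longlonglongrightarrow> p"
    using seq_compactE by metis
  have lim: "(\<lambda>n. G (\<zeta> (r n))) \<longlonglongrightarrow> p"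
    using r(2) by (simp add: o_def)
  have Re_r: "real n < Re (\<zeta> (r n))" for n
    using \<zeta>(1) [of "r n"] seq_suble [OF r(1), of n] by linarith
  have p: "p \<notin> \<Omega>"
  proof
    assume "p \<in> \<Omega>"
    then have "isCont f p"
      using f_continuous by (simp add: continuous_on_eq_continuous_at open_\<Omega>)
    then have "(\<lambda>n. f (G (\<zeta> (r n)))) \<longlonglongrightarrow> f p"
      using lim by (rule isCont_tendsto_compose)
    then have "(\<lambda>n. exp (\<zeta> (r n))) \<longlonglongrightarrow> f p"
      using f_G [OF \<zeta>H] by simp
    then have "Bseq (\<lambda>n. exp (\<zeta> (r n)))"
      by (rule convergent_imp_Bseq [OF convergentI])
    then obtain K where "K > 0" and K: "\<And>n. cmod (exp (\<zeta> (r n))) \<le> K"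
      by (auto simp: Bseq_def)
    obtain n :: nat where "K < real n"
      using reals_Archimedean2 by blast
    also have "real n < exp (Re (\<zeta> (r n)))"
      using Re_r [of n] exp_ge_add_one_self [of "Re (\<zeta> (r n))"] by linarith
    finally show False
      using K [of n] by simp
  qed
  have trap: "\<exists>N. \<forall>z. N < Re z \<longrightarrow> dist (G z) p < e" if "e > 0" for e
  proof -
    obtain d where d: "d > 0" "\<And>x. x \<noteq> p \<Longrightarrow> dist x p < d \<Longrightarrow> x \<in> \<Omega>"
      using eventually_\<Omega> [of p] by (auto simp: eventually_at)
    define \<epsilon> where "\<epsilon> = min e (d / 2)"
    have \<epsilon>: "\<epsilon> > 0" "\<epsilon> \<le> e" "\<epsilon> < d" using d(1) that by (auto simp: \<epsilon>_def)
    have sphere_\<Omega>: "sphere p \<epsilon> \<subseteq> \<Omega>"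
      using d(2) \<epsilon> by (auto simp: dist_commute)
    have "compact (f ` sphere p \<epsilon>)"
      by (rule compact_continuous_image [OF continuous_on_subset [OF f_continuous sphere_\<Omega>]]) simp
    then obtain K where K: "\<And>x. x \<in> sphere p \<epsilon> \<Longrightarrow> cmod (f x) \<le> K"
      using compact_imp_bounded by (fastforce simp: bounded_iff)
    \<comment> \<open>Real part greater than \<open>K\<close> is enough for
      \<open>exp (Re z) > K\<close>, which keeps \<open>G z\<close> off the circle.\<close>
    define N where "N = max (ln R) K"
    have conn: "connected (G ` {z. N < Re z})"
      by (rule connected_continuous_image [OF continuous_on_subset [OF continuous_G] connected_half_plane]) (auto simp: N_def)
    have "\<forall>\<^sub>F n in sequentially. dist (G (\<zeta> (r n))) p < \<epsilon>"
      using lim \<epsilon>(1) by (rule tendstoD)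
    moreover have "\<forall>\<^sub>F n in sequentially. N \<le> real n"
      using real_arch_simple [of N] by (auto simp: eventually_sequentially) (meson of_nat_le_iff order_trans)
    ultimately have "\<forall>\<^sub>F n in sequentially. dist (G (\<zeta> (r n))) p < \<epsilon> \<and> N \<le> real n"
      by (rule eventually_conj)
    then obtain n where n: "dist (G (\<zeta> (r n))) p < \<epsilon>" "N \<le> real n"
      by (auto simp: eventually_sequentially)
    have "G (\<zeta> (r n)) \<in> G ` {z. N < Re z} \<inter> ball p \<epsilon>"
      using n Re_r [of n] by (auto simp: dist_commute)
    moreover have "G ` {z. N < Re z} \<inter> frontier (ball p \<epsilon>) = {}"
    proof -
      have "G z \<notin> sphere p \<epsilon>" if "N < Re z" for z
      proof
        assume "G z \<in> sphere p \<epsilon>"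
        then have "cmod (f (G z)) \<le> K" by (rule K)
        moreover have "z \<in> half_plane" using that by (simp add: N_def)
        ultimately have "exp (Re z) \<le> K" using f_G by simp
        then show False
          using that exp_ge_add_one_self [of "Re z"] by (simp add: N_def)
      qed
      then show ?thesis using \<epsilon>(1) by auto
    qed
    ultimately have "G ` {z. N < Re z} - ball p \<epsilon> = {}"
      using connected_Int_frontier [OF conn, of "ball p \<epsilon>"] by blast
    then have "G z \<in> ball p \<epsilon>" if "N < Re z" for z
      using that by blast
    then show ?thesis
      using \<epsilon>(2) by (intro exI [of _ N]) (force simp: dist_commute)
  qed
  obtain N where N: "\<And>z. N < Re z \<Longrightarrow> dist (G z) p < 1"
    using trap [of 1] by auto
  define a where "a = complex_of_real (max N (ln R) + 1)"
  define w where "w = exp a"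
  have aH: "a + of_nat j * T \<in> half_plane" for j
    by (simp add: a_def)
  have fa: "f (G (a + of_nat j * T)) = w" for j
    using f_G [OF aH [of j]] exp_shift [of a "int j"] by (simp add: w_def)
  have "\<not> (\<forall>x\<in>UNIV. f x = w)"
    using not_constant_on [of UNIV] by (auto simp: constant_on_def)
  then have "\<forall>\<^sub>\<approx>x\<in>UNIV. f x \<noteq> w"
    using nicely_meromorphic_imp_constant_or_avoid [OF mero, of w] by auto
  then have "{x. f x = w} sparse_in UNIV"
    by (simp add: eventually_cosparse)
  then have "finite (cball p 1 \<inter> {x. f x = w})"
    by (intro sparse_in_compact_finite sparse_in_subset [of _ UNIV "cball p 1"]) auto
  moreover have "range (\<lambda>j::nat. G (a + of_nat j * T)) \<subseteq> cball p 1 \<inter> {x. f x = w}"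
  proof -
    have "dist (G (a + of_nat j * T)) p < 1" for j
      by (rule N) (simp add: a_def)
    then show ?thesis
      using fa by (auto simp: dist_commute less_imp_le)
  qed
  ultimately have "finite (range (\<lambda>j::nat. G (a + of_nat j * T)))"
    by (rule finite_subset [rotated])
  then have "\<not> inj (\<lambda>j::nat. G (a + of_nat j * T))"
    using finite_imageD infinite_UNIV_nat by blast
  then obtain i j :: nat where ij: "i \<noteq> j" "G (a + of_nat i * T) = G (a + of_nat j * T)"
    by (auto simp: inj_def)
  have "\<exists>n. has_period n"
    by (rule has_period_if_not_injective [OF aH aH _ ij(2)]) (use ij(1) in simp)
  with p trap show ?thesis by blast
qed

text \<open>In the trapped case the image of \<open>G\<close> together with the pole is a whole component of the set
  where \<open>f\<close> is larger than \<open>R\<close>, so the curve cannot leave it.\<close>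

lemma curve_not_trapped:
  fixes \<gamma> :: "real \<Rightarrow> complex"
  assumes n: "has_period n" and p: "p \<notin> \<Omega>" and Gp: "\<And>e. 0 < e \<Longrightarrow> \<exists>N. \<forall>z. N < Re z \<longrightarrow> dist (G z) p < e"
    and \<gamma>: "continuous_on {t0..} \<gamma>" "filterlim \<gamma> at_infinity at_top"
    and large: "\<And>t. t0 \<le> t \<Longrightarrow> \<gamma> t \<in> \<Omega> \<Longrightarrow> R < cmod (f (\<gamma> t))"
    and inf: "\<And>K. \<forall>\<^sub>F t in at_top. \<gamma> t \<in> \<Omega> \<longrightarrow> K < cmod (f (\<gamma> t))"
    and start: "\<gamma> t0 \<in> G ` half_plane"
  shows False
proof -
  have away: "\<exists>e y. 0 < e \<and> (\<forall>w. y < Re w \<longrightarrow> e \<le> dist (G w) z)" if "z \<noteq> p" for z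
  proof -
    have "dist z p / 2 > 0" using that by simp
    then obtain y where y: "\<And>w. y < Re w \<Longrightarrow> dist (G w) p < dist z p / 2"
      using Gp by blast
    have "dist z p / 2 \<le> dist (G w) z" if "y < Re w" for w
      using y [OF that] dist_triangle [of z p "G w"] by (simp add: dist_commute)
    then show ?thesis using \<open>dist z p / 2 > 0\<close> by blast
  qed
  have cl: "z \<in> G ` half_plane"
    if z: "z \<in> closure (G ` half_plane)" "z \<noteq> p" "z \<in> \<Omega> \<Longrightarrow> R < cmod (f z)" for z
  proof -
    obtain e y where e: "0 < e" "\<And>w. y < Re w \<Longrightarrow> e \<le> dist (G w) z"
      using away [OF z(2)] by blast
    have app: "\<exists>w. w \<in> half_plane \<and> Re w \<le> y \<and> dist (G w) z < d" if "d > 0" for d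
    proof -
      have "min d e > 0" using that e(1) by simp
      then obtain w where "w \<in> half_plane" "dist (G w) z < min d e"
        using z(1) unfolding closure_approachable by blast
      then show ?thesis using e(2) [of w] by force
    qed
    \<comment> \<open>Near a pole \<open>cmod (f x)\<close> would exceed \<open>exp y\<close>,
      whereas the approximating points come from real parts at most \<open>y\<close>.\<close>
    have z\<Omega>: "z \<in> \<Omega>"
    proof (rule ccontr)
      assume "z \<notin> \<Omega>"
      then have "filterlim (\<lambda>x. cmod (f x)) at_top (at z)"
        by (simp add: \<Omega>_def is_pole_def filterlim_at_infinity_conv_norm_at_top)
      then have "\<forall>\<^sub>F x in at z. exp y < cmod (f x)"
        by (auto simp: filterlim_at_top_dense)
      then obtain d where d: "d > 0" "\<And>x. x \<noteq> z \<Longrightarrow> dist x z < d \<Longrightarrow> exp y < cmod (f x)"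
        by (auto simp: eventually_at)
      obtain w where w: "w \<in> half_plane" "Re w \<le> y" "dist (G w) z < d"
        using app [OF d(1)] by blast
      have "G w \<noteq> z" using G_\<Omega> [OF w(1)] \<open>z \<notin> \<Omega>\<close> by blast
      then show False
        using d(2) [of "G w"] w f_G [OF w(1)] by simp
    qed
    \<comment> \<open>A level strictly between \<open>R\<close> and \<open>cmod (f z)\<close> keeps
      the approximating points away from the boundary line of the half-plane, hence within the image
      of one closed strip, which is compact.\<close>
    define r where "r = (R + cmod (f z)) / 2"
    have r: "R < r" "r < cmod (f z)" using z(3) [OF z\<Omega>] by (auto simp: r_def)
    have "isCont (\<lambda>x. cmod (f x)) z"
      using f_continuous z\<Omega> by (intro continuous_intros) (simp add: continuous_on_eq_continuous_at open_\<Omega>)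
    then have "\<forall>\<^sub>F x in nhds z. r < cmod (f x)"
      using r(2) by (intro order_tendstoD [of _ "cmod (f z)"]) (auto simp: isCont_def tendsto_nhds_iff)
    then obtain d where d: "d > 0" "\<And>x. dist x z < d \<Longrightarrow> r < cmod (f x)"
      by (auto simp: eventually_nhds_metric)
    have "ln R < ln r" using r R by simp
    have "z \<in> closure (G ` {w. ln r \<le> Re w \<and> Re w \<le> y})"
      unfolding closure_approachable
    proof (intro allI impI)
      fix e :: real assume "e > 0"
      then obtain w where w: "w \<in> half_plane" "Re w \<le> y" "dist (G w) z < min d e"
        using app [of "min d e"] d(1) by auto
      have "r < exp (Re w)"
        using d(2) [of "G w"] w f_G [OF w(1)] by simp
      then have "ln r < Re w"
        using r(1) R by (metis ln_exp ln_less_cancel_iff exp_gt_zero less_le_trans less_trans zero_less_one)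
      then show "\<exists>x\<in>G ` {w. ln r \<le> Re w \<and> Re w \<le> y}. dist x z < e"
        using w by (intro bexI [of _ "G w"] imageI) auto
    qed
    then have "z \<in> G ` {w. ln r \<le> Re w \<and> Re w \<le> y}"
      using compact_imp_closed [OF compact_strip_image [OF n \<open>ln R < ln r\<close>]] by (simp add: closure_closed)
    then show ?thesis
      using \<open>ln R < ln r\<close> by auto
  qed
  define W' where "W' = insert p (G ` half_plane)"
  have "open W'"
  proof -
    define x where "x = ln R + 1"
    have x: "ln R < x" by (simp add: x_def)
    define W where "W = G ` {w. x < Re w}"
    define Z where "Z = G ` {w. x \<le> Re w \<and> Re w \<le> x}"
    have "open W"
      unfolding W_def using x by (intro open_image_G) (auto simp: open_halfspace_Re_gt)
    have "closed Z"
      unfolding Z_def using compact_strip_image [OF n x] compact_imp_closed by blast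
    moreover have "p \<in> - Z"
      using p x G_\<Omega> by (auto simp: Z_def)
    ultimately obtain r where r: "r > 0" "ball p r \<subseteq> - Z"
      using open_contains_ball [of "- Z"] by (auto simp: open_Compl)
    \<comment> \<open>The punctured disc misses the image of the line \<open>Re w = x\<close>, so
      \<open>W\<close> is relatively clopen in it and contains all of it. This makes
      \<open>p\<close> an interior point of \<open>W'\<close>.\<close>
    define S where "S = ball p r - {p}"
    have "connected S"
      unfolding S_def by (rule connected_punctured_ball) simp
    have clW: "z \<in> W" if z: "z \<in> S" "z \<in> closure W" for z
    proof -
      have "z \<noteq> p" using z(1) by (simp add: S_def)
      then obtain e y where e: "0 < e" "\<And>w. y < Re w \<Longrightarrow> e \<le> dist (G w) z"
        using away by blast
      then obtain w where w: "x \<le> Re w" "z = G w"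
        using closure_strip_image [OF n x e z(2) [unfolded W_def]] by blast
      have "z \<notin> Z" using r(2) z(1) by (auto simp: S_def)
      then have "Re w \<noteq> x" using w by (auto simp: Z_def)
      then show ?thesis using w by (auto simp: W_def)
    qed
    obtain y where y: "\<And>w. y < Re w \<Longrightarrow> dist (G w) p < r"
      using Gp [OF r(1)] by blast
    define w where "w = complex_of_real (max x y + 1)"
    have wx: "x < Re w" "y < Re w" by (auto simp: w_def)
    then have "G w \<noteq> p" using G_\<Omega> [of w] p x by auto
    then have "G w \<in> W" "G w \<in> S"
      using y [OF wx(2)] wx by (auto simp: W_def S_def dist_commute)
    moreover have "W \<inter> S = {} \<or> (- closure W) \<inter> S = {}"
    proof (rule connectedD [OF \<open>connected S\<close> \<open>open W\<close>])
      show "S \<subseteq> W \<union> - closure W" using clW by blast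
      show "W \<inter> - closure W \<inter> S = {}" using closure_subset by blast
    qed (simp add: open_Compl)
    ultimately have "S \<subseteq> closure W" by blast
    then have "S \<subseteq> W" using clW by blast
    moreover have "W \<subseteq> G ` half_plane"
      unfolding W_def using x by (intro image_mono) auto
    ultimately have "W' = ball p r \<union> G ` half_plane"
      using r(1) by (auto simp: W'_def S_def)
    moreover have "open (G ` half_plane)"
      by (rule open_image_G) (auto simp: open_halfspace_Re_gt)
    ultimately show ?thesis
      by (simp add: open_Un)
  qed
  define C where "C = \<gamma> ` {t0..}"
  have "connected C"
    unfolding C_def by (rule connected_continuous_image [OF \<gamma>(1)]) (simp add: connected_Ici)
  have clC: "z \<in> W'" if z: "z \<in> C" "z \<in> closure W'" for z
  proof (cases "z = p")
    case False
    have "z \<in> closure (G ` half_plane)"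
      using z(2) False by (simp add: W'_def closure_insert)
    moreover have "R < cmod (f z)" if "z \<in> \<Omega>"
      using z(1) that large by (auto simp: C_def)
    ultimately show ?thesis
      using cl False by (simp add: W'_def)
  qed (simp add: W'_def)
  have "\<gamma> t0 \<in> W' \<inter> C" using start by (simp add: W'_def C_def)
  moreover have "W' \<inter> C = {} \<or> (- closure W') \<inter> C = {}"
  proof (rule connectedD [OF \<open>connected C\<close> \<open>open W'\<close>])
    show "C \<subseteq> W' \<union> - closure W'" using clC by blast
    show "W' \<inter> - closure W' \<inter> C = {}" using closure_subset by blast
  qed (simp add: open_Compl)
  ultimately have "C \<subseteq> closure W'" by blast
  then have CW: "C \<subseteq> W'" using clC by blast
  obtain N where N: "\<And>w. N < Re w \<Longrightarrow> dist (G w) p < 1"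
    using Gp [of 1] by auto
  have "\<forall>\<^sub>F t in at_top. cmod p + 2 \<le> cmod (\<gamma> t)"
    using \<gamma>(2) unfolding filterlim_at_infinity_conv_norm_at_top filterlim_at_top by blast
  then have "\<forall>\<^sub>F t in at_top. t0 \<le> t \<and> cmod p + 2 \<le> cmod (\<gamma> t) \<and> (\<gamma> t \<in> \<Omega> \<longrightarrow> exp N < cmod (f (\<gamma> t)))"
    using inf [of "exp N"] eventually_ge_at_top [of t0] by eventually_elim simp
  then obtain t where t: "t0 \<le> t" "cmod p + 2 \<le> cmod (\<gamma> t)" "\<gamma> t \<in> \<Omega> \<Longrightarrow> exp N < cmod (f (\<gamma> t))"
    by (auto simp: eventually_at_top_linorder)
  have "\<gamma> t \<in> W'" using CW t(1) by (auto simp: C_def)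
  moreover have "\<gamma> t \<noteq> p" using t(2) by auto
  ultimately obtain w where w: "w \<in> half_plane" "\<gamma> t = G w"
    by (auto simp: W'_def)
  then have "N < Re w"
    using t(3) f_G [OF w(1)] G_\<Omega> [OF w(1)] by simp
  then have "dist (\<gamma> t) p < 1" using N w by simp
  then show False
    using t(2) norm_triangle_ineq2 [of "\<gamma> t" p] by (simp add: dist_norm)
qed

end

context meromorphic_outside_singular_disc
begin

text \<open>The lift is started at a point of the asymptotic curve. That starting point is what
  rules out the lift trapped at a pole, and with it every lift that does not tend to
  infinity.\<close>

lemma logarithmic_tract:
  assumes "asymptotic_value f None"
  shows "\<exists>G. G holomorphic_on half_plane \<and> inj_on G half_plane \<and> (\<forall>B. \<exists>N. \<forall>z. N < Re z \<longrightarrow> B < cmod (G z)) \<and>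
    (\<forall>z\<in>half_plane. G z \<in> \<Omega> \<and> f (G z) = exp z)"
proof -
  obtain \<gamma> :: "real \<Rightarrow> complex" where \<gamma>: "continuous_on {0..} \<gamma>" "filterlim \<gamma> at_infinity at_top"
    and lim: "limitin riemann_sphere (\<lambda>t. sphere_map f (Some (\<gamma> t))) None at_top"
    using assms unfolding asymptotic_value_def by blast
  have inf: "\<forall>\<^sub>F t in at_top. \<gamma> t \<in> \<Omega> \<longrightarrow> K < cmod (f (\<gamma> t))" for K
  proof -
    define U where "U = UNIV - Some ` cball (0::complex) K"
    have "closedin riemann_sphere (Some ` cball (0::complex) K)"
      by simp
    then have "openin riemann_sphere U"
      unfolding U_def closedin_def by (simp add: UNIV_option_conv)
    moreover have "None \<in> U" by (auto simp: U_def)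
    ultimately have "\<forall>\<^sub>F t in at_top. sphere_map f (Some (\<gamma> t)) \<in> U"
      using lim unfolding limitin_def by blast
    then show ?thesis
    proof eventually_elim
      case (elim t)
      show ?case
      proof
        assume "\<gamma> t \<in> \<Omega>"
        then have "Some (f (\<gamma> t)) \<in> U"
          using elim sphere_map_\<Omega> by simp
        then show "K < cmod (f (\<gamma> t))"
          by (auto simp: U_def)
      qed
    qed
  qed
  obtain t1 where t1: "\<And>t. t1 \<le> t \<Longrightarrow> \<gamma> t \<in> \<Omega> \<Longrightarrow> R < cmod (f (\<gamma> t))"
    using inf [of R] unfolding eventually_at_top_linorder by blast
  \<comment> \<open>A curve that stays in the countable set of poles would be constant and could not
    tend to infinity.\<close>
  have "\<exists>t0\<ge>max t1 0. \<gamma> t0 \<in> \<Omega>"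
  proof (rule ccontr)
    assume "\<not> ?thesis"
    then have sub: "\<gamma> ` {max t1 0..} \<subseteq> - \<Omega>"
      by blast
    define s where "s = max t1 0"
    have "connected (\<gamma> ` {s..})"
      by (rule connected_continuous_image [OF continuous_on_subset [OF \<gamma>(1)]]) (auto simp: s_def connected_Ici)
    moreover have "countable (- \<Omega>)"
      using sparse_imp_countable [OF open_UNIV poles_sparse] by simp
    then have "countable (\<gamma> ` {s..})"
      using sub countable_subset unfolding s_def by blast
    ultimately have const: "\<gamma> t = \<gamma> s" if "s \<le> t" for t
      using connected_uncountable [of "\<gamma> ` {s..}" "\<gamma> t" "\<gamma> s"] that by force
    have "\<forall>\<^sub>F t in at_top. cmod (\<gamma> s) + 1 \<le> cmod (\<gamma> t)"
      using \<gamma>(2) unfolding filterlim_at_infinity_conv_norm_at_top filterlim_at_top by blast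
    then have "\<forall>\<^sub>F t::real in at_top. False"
      using eventually_ge_at_top [of s]
    proof eventually_elim
      case (elim t)
      have "cmod (\<gamma> t) = cmod (\<gamma> s)"
        by (rule arg_cong [OF const [OF elim(2)]])
      with elim(1) show False by linarith
    qed
    then show False by simp
  qed
  then obtain t0 where t0: "max t1 0 \<le> t0" "\<gamma> t0 \<in> \<Omega>" by blast
  have "R < cmod (f (\<gamma> t0))" using t1 t0 by auto
  then obtain G \<zeta> where G: "is_lift half_plane exp G" "\<zeta> \<in> half_plane" "G \<zeta> = \<gamma> t0"
    using half_plane_lift [OF t0(2)] by blast
  interpret exponential_lift f R G
    by unfold_locales (rule G)
  have Ginf: "\<forall>B. \<exists>N. \<forall>z. N < Re z \<longrightarrow> B < cmod (G z)"
  proof (rule ccontr)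
    assume "\<not> ?thesis"
    then obtain p n where pn: "p \<notin> \<Omega>" "has_period n" "\<forall>e>0. \<exists>N. \<forall>z. N < Re z \<longrightarrow> dist (G z) p < e"
      using trapped_at_pole by blast
    show False
    proof (rule curve_not_trapped [OF pn(2,1), of t0 \<gamma>])
      show "continuous_on {t0..} \<gamma>"
        using \<gamma>(1) by (rule continuous_on_subset) (use t0 in auto)
      show "\<gamma> t0 \<in> G ` half_plane"
        using G by (metis imageI)
      show "\<exists>N. \<forall>z. N < Re z \<longrightarrow> dist (G z) p < e" if "0 < e" for e
        using pn(3) that by blast
      show "R < cmod (f (\<gamma> t))" if "t0 \<le> t" "\<gamma> t \<in> \<Omega>" for t
        using t1 [OF _ that(2)] t0(1) that(1) by simp
    qed (rule \<gamma> inf)+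
  qed
  moreover have "inj_on G half_plane"
  proof (rule inj_onI, rule ccontr)
    fix a b assume "a \<in> half_plane" "b \<in> half_plane" "G a = G b" "a \<noteq> b"
    then obtain n where n: "has_period n"
      using has_period_if_not_injective [of a b] by blast
    show False
      by (rule not_periodic_tending_to_infinity [OF n]) (use Ginf in blast)
  qed
  ultimately show ?thesis
    using holomorphic_G G_\<Omega> f_G by (intro exI [of _ G] conjI ballI) (assumption | simp)+
qed

end

section \<open>The two Fatou components\<close>

lemma homeomorphic_map_Some:
  "homeomorphic_map (top_of_set S) (subtopology riemann_sphere (Some ` S)) Some"
proof -
  have "homeomorphic_map euclidean (subtopology riemann_sphere (range Some)) Some"
    using embedding_map_Some [of "euclidean :: complex topology"] by (simp add: embedding_map_def)
  then have "homeomorphic_map (top_of_set S) (subtopology (subtopology riemann_sphere (range Some)) (Some ` S)) Some"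
    by (rule homeomorphic_map_subtopologies) auto
  then show ?thesis
    by (simp add: subtopology_subtopology Int_absorb1 image_mono)
qed

lemma connected_components_of_top_of_set: "connected_components_of (top_of_set S) = components S"
  unfolding connected_components_of_def components_def connected_component_of_def connected_component_def connectedin_subtopology
  by (auto simp: conj_ac)

lemma card_components_riemann_sphere:
  "card (connected_components_of (subtopology riemann_sphere (Some ` S))) = card (components S)"
  unfolding homeomorphic_map_connected_components_of [OF homeomorphic_map_Some] connected_components_of_top_of_set
  by (intro card_image inj_on_subset [OF inj_on_image]) (auto intro: injI)

text \<open>The plane is open in the sphere, so the finite part of \<open>K\<close> is an open
  subspace and inherits local connectedness. The conclusion is phrased with connected neighborhoods
  that need not be open, the form used around the circle.\<close>

lemma locally_connected_finite_part:
  assumes lc: "locally_connected_space (subtopology riemann_sphere K)" and J: "J = {z. Some z \<in> K}"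
    and x: "x \<in> J" "0 < e"
  shows "\<exists>d>0. \<exists>N. connected N \<and> N \<subseteq> J \<inter> ball x e \<and> J \<inter> ball x d \<subseteq> N"
proof -
  have "openin riemann_sphere (range Some)"
    using openin_Alexandroff_compactification_image_Some [of euclidean "UNIV :: complex set"] by simp
  then have "openin (subtopology riemann_sphere K) (K \<inter> range Some)"
    by (rule openin_subtopology_Int2)
  moreover have "K \<inter> range Some = Some ` J"
    by (auto simp: J)
  ultimately have "locally_connected_space (subtopology (subtopology riemann_sphere K) (Some ` J))"
    using locally_connected_space_open_subset [OF lc] by simp
  moreover have "K \<inter> Some ` J = Some ` J"
    by (auto simp: J)
  ultimately have "locally_connected_space (subtopology riemann_sphere (Some ` J))"
    by (simp add: subtopology_subtopology)
  moreover have "top_of_set J homeomorphic_space subtopology riemann_sphere (Some ` J)"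
    using homeomorphic_map_Some homeomorphic_map_imp_homeomorphic_space by blast
  ultimately have lcJ: "locally_connected_space (top_of_set J)"
    using homeomorphic_locally_connected_space by blast
  have "openin (top_of_set J) (J \<inter> ball x e)" "x \<in> J \<inter> ball x e"
    using x by auto
  then obtain U V where UV: "openin (top_of_set J) U" "connectedin (top_of_set J) V" "x \<in> U" "U \<subseteq> V" "V \<subseteq> J \<inter> ball x e"
    using lcJ unfolding locally_connected_space_def neighbourhood_base_of by metis
  obtain d where "d > 0" "ball x d \<inter> J \<subseteq> U"
    using UV(1,3) unfolding openin_contains_ball by blast
  moreover have "connected V"
    using UV(2) by (simp add: connectedin_subtopology)
  ultimately show ?thesis
    using UV(4,5) by (intro exI [of _ d] conjI exI [of _ V]) auto
qed

lemma path_log_lift: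
  fixes g :: "real \<Rightarrow> complex"
  assumes "path g" "0 \<notin> path_image g" "exp a = pathstart g"
  obtains h where "path h" "pathstart h = a" "\<And>t. t \<in> {0..1} \<Longrightarrow> exp (h t) = g t"
proof -
  obtain q where q: "path q" "\<And>t. t \<in> {0..1} \<Longrightarrow> g t = 0 + exp (q t)"
    using winding_number_as_continuous_log [OF assms(1,2)] by metis
  define h where "h t = q t - pathstart q + a" for t
  show ?thesis
  proof (rule that [of h])
    show "path h"
      using q(1) unfolding h_def path_def by (intro continuous_intros)
    show "pathstart h = a"
      by (simp add: h_def pathstart_def)
    have "exp (pathstart q) = exp a"
      using q(2) [of 0] assms(3) by (simp add: pathstart_def)
    then show "exp (h t) = g t" if "t \<in> {0..1}" for t
      using q(2) [OF that] by (simp add: h_def exp_add exp_diff)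
  qed
qed

text \<open>The radius \<open>R * exp (real n)\<close> is chosen so that exceeding it means
  \<open>Re z > ln R + real n\<close>; since \<open>ln R\<close> is nonnegative, this gives both
  lower bounds on the real part. Each lift starts where the previous one ended, so the choice of the
  points is dependent.\<close>

lemma log_lift_access:
  fixes A :: "complex set"
  assumes A: "open A" and R: "1 \<le> R"
    and p: "\<And>n. connected_component (A \<inter> {w. R * exp (real n) < cmod w}) (p n) (p (Suc n))"
  shows "\<exists>a. \<forall>n. connected_component {z. Re z > ln R \<and> Re z > real n \<and> exp z \<in> A} (a n) (a (Suc n))"
proof -
  define B where "B n = A \<inter> {w. R * exp (real n) < cmod w}" for n
  define E where "E n = {z. Re z > ln R \<and> Re z > real n \<and> exp z \<in> A}" for n
  have "open {w. x < cmod w}" for x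
    by (intro open_Collect_less continuous_intros)
  then have opB: "open (B n)" for n
    unfolding B_def by (intro open_Int A)
  have B0: "0 \<notin> B n" for n
  proof
    assume "0 \<in> B n"
    then have "R * exp (real n) < 0" by (simp add: B_def)
    moreover have "0 < R * exp (real n)" using R by simp
    ultimately show False by linarith
  qed
  have BE: "z \<in> E n" if "exp z \<in> B n" for z n
  proof -
    have "R * exp (real n) < exp (Re z)" "exp z \<in> A" using that by (auto simp: B_def)
    moreover have "R * exp (real n) = exp (ln R + real n)"
      using R by (simp add: exp_add)
    ultimately have "ln R + real n < Re z" by simp
    moreover have "0 \<le> ln R" using R by simp
    ultimately show ?thesis using \<open>exp z \<in> A\<close> by (simp add: E_def)
  qed
  have pB: "connected_component (B n) (p n) (p (Suc n))" for n
    using p by (simp add: B_def)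
  have "\<exists>a. \<forall>n. exp (a n) = p n \<and> connected_component (E n) (a n) (a (Suc n))"
  proof (rule dependent_nat_choice)
    have "p 0 \<noteq> 0" using connected_component_in [OF pB [of 0]] B0 by metis
    then show "\<exists>x. exp x = p 0" by (intro exI [of _ "Ln (p 0)"]) simp
  next
    fix a n assume a: "exp a = p n"
    have "path_component (B n) (p n) (p (Suc n))"
      using pB opB open_path_connected_component by metis
    then obtain g where g: "path g" "path_image g \<subseteq> B n" "pathstart g = p n" "pathfinish g = p (Suc n)"
      unfolding path_component_def by auto
    obtain h where h: "path h" "pathstart h = a" "\<And>t. t \<in> {0..1} \<Longrightarrow> exp (h t) = g t"
      by (rule path_log_lift [OF g(1), of a]) (use g B0 a in auto)
    have "path_image h \<subseteq> E n"
    proof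
      fix z assume "z \<in> path_image h"
      then obtain t where t: "t \<in> {0..1}" "z = h t" by (auto simp: path_image_def)
      then have "exp z \<in> B n"
        using h(3) [OF t(1)] g(2) by (auto simp: path_image_def)
      then show "z \<in> E n" by (rule BE)
    qed
    then have "connected_component (E n) a (pathfinish h)"
      unfolding connected_component_def using h(1,2)
      by (intro exI [of _ "path_image h"]) (auto simp: connected_path_image)
    moreover have "exp (pathfinish h) = p (Suc n)"
      using h(3) [of 1] g(4) by (simp add: pathfinish_def)
    ultimately show "\<exists>y. exp y = p (Suc n) \<and> connected_component (E n) a y" by blast
  qed
  then obtain a where "\<forall>n. exp (a n) = p n \<and> connected_component (E n) (a n) (a (Suc n))" ..
  then have "\<forall>n. connected_component (E n) (a n) (a (Suc n))" by simp
  then show ?thesis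
    unfolding E_def by (rule exI [of _ a])
qed

section \<open>Permutation of the Fatou components\<close>

context transcendental_meromorphic
begin

definition finite_fatou :: "complex set" where
  "finite_fatou = {z. Some z \<in> fatou_set f}"

lemma fatou_set_eq: "fatou_set f = Some ` finite_fatou"
proof -
  have "x \<in> Some ` finite_fatou" if "x \<in> fatou_set f" for x
    using that fatou_finite by (cases x) (auto simp: finite_fatou_def)
  then show ?thesis by (auto simp: finite_fatou_def)
qed

lemma finite_fatou_iff: "z \<in> finite_fatou \<longleftrightarrow> z \<in> \<Omega> \<and> f z \<in> finite_fatou"
  using fatou_backward fatou_forward by (auto simp: finite_fatou_def)

lemma open_finite_fatou: "open finite_fatou"
proof (subst open_subopen, intro ballI)
  fix z assume "z \<in> finite_fatou"
  then obtain V where V: "z \<in> V" "fatou_on V"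
    using Some_fatou_iff by (auto simp: finite_fatou_def)
  then have "V \<subseteq> finite_fatou"
    using Some_fatou_iff by (auto simp: finite_fatou_def)
  then show "\<exists>V. open V \<and> z \<in> V \<and> V \<subseteq> finite_fatou"
    using V by (auto simp: fatou_on_def)
qed

text \<open>Every component has a preimage, so \<open>f\<close> permutes the components if there are finitely many.\<close>

lemma components_permuted:
  assumes fin: "finite (components finite_fatou)"
  obtains \<sigma> where "bij_betw \<sigma> (components finite_fatou) (components finite_fatou)"
    "\<And>C z. \<lbrakk>C \<in> components finite_fatou; z \<in> \<Omega>; f z \<in> \<sigma> C\<rbrakk> \<Longrightarrow> z \<in> C"
proof -
  define \<C> where "\<C> = components finite_fatou"
  have sub: "C \<subseteq> finite_fatou" and conn: "connected C" and ne: "C \<noteq> {}" and op: "open C" if "C \<in> \<C>" for C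
    using in_components_subset [of C finite_fatou] in_components_connected [of C finite_fatou]
      in_components_nonempty [of C finite_fatou] open_components [OF open_finite_fatou, of C] that
    by (simp_all add: \<C>_def)
  have "\<exists>A. A \<in> \<C> \<and> f ` C \<subseteq> A" if C: "C \<in> \<C>" for C
    unfolding \<C>_def
  proof (rule exists_component_superset)
    have *: "z \<in> \<Omega> \<and> f z \<in> finite_fatou" if "z \<in> C" for z
      using sub [OF C] finite_fatou_iff [of z] that by blast
    then show "f ` C \<subseteq> finite_fatou" by blast
    show "finite_fatou \<noteq> {}" using sub [OF C] ne [OF C] by blast
    have "C \<subseteq> \<Omega>" using * by blast
    then show "connected (f ` C)"
      by (intro connected_continuous_image conn [OF C] continuous_on_subset [OF f_continuous])
  qed
  then obtain \<sigma> where \<sigma>: "\<And>C. C \<in> \<C> \<Longrightarrow> \<sigma> C \<in> \<C>" "\<And>C. C \<in> \<C> \<Longrightarrow> f ` C \<subseteq> \<sigma> C"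
    by metis
  have cover: "\<exists>C\<in>\<C>. z \<in> C" if "z \<in> finite_fatou" for z
    using that Union_components [of finite_fatou] unfolding \<C>_def by blast
  have same: "\<sigma> C = A" if "C \<in> \<C>" "A \<in> \<C>" "z \<in> C" "f z \<in> A" for C A z
  proof -
    have "f z \<in> \<sigma> C \<inter> A" using \<sigma>(2) [OF that(1)] that by blast
    then show ?thesis
      using components_nonoverlap [of "\<sigma> C" finite_fatou A] \<sigma>(1) [OF that(1)] that(2) by (auto simp: \<C>_def)
  qed
  have surj: "\<C> \<subseteq> \<sigma> ` \<C>"
  proof
    fix A assume A: "A \<in> \<C>"
    obtain z where z: "z \<in> \<Omega>" "f z \<in> A"
      using dense_values_near_infinity [OF op [OF A] ne [OF A]] by blast
    then have "z \<in> finite_fatou" using sub [OF A] finite_fatou_iff [of z] by blast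
    then obtain C where "C \<in> \<C>" "z \<in> C" using cover by blast
    then show "A \<in> \<sigma> ` \<C>" using same [of C A z] A z(2) by blast
  qed
  have inj: "inj_on \<sigma> \<C>"
    using fin surj unfolding \<C>_def by (rule finite_surj_inj)
  have "\<sigma> ` \<C> = \<C>" using surj \<sigma>(1) by blast
  with inj have "bij_betw \<sigma> \<C> \<C>" by (simp add: bij_betw_def)
  \<comment> \<open>Injectivity of \<open>\<sigma>\<close> is what confines the whole preimage of a
    component to a single component.\<close>
  moreover have "z \<in> C" if "C \<in> \<C>" "z \<in> \<Omega>" "f z \<in> \<sigma> C" for C z
  proof -
    have "z \<in> finite_fatou" using sub [OF \<sigma>(1) [OF that(1)]] that finite_fatou_iff [of z] by blast
    then obtain C' where C': "C' \<in> \<C>" "z \<in> C'" using cover by blast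
    then have "\<sigma> C' = \<sigma> C" using same [of C' "\<sigma> C" z] \<sigma>(1) that by blast
    then have "C' = C" using inj C'(1) that(1) by (auto dest: inj_onD)
    with C' show ?thesis by simp
  qed
  ultimately show ?thesis using that unfolding \<C>_def by blast
qed

end

theorem theorem2p7:
  fixes f :: "complex \<Rightarrow> complex"
  assumes "f nicely_meromorphic_on UNIV"
    and "\<not> rational_function f \<or> (\<exists>d\<ge>2. rational_of_degree f d)"
    and "class_B f"
    and "connectedin riemann_sphere (julia_set f)"
    and "locally_connected_space (subtopology riemann_sphere (julia_set f))"
    and "card (connected_components_of (subtopology riemann_sphere (fatou_set f))) = 2"
  shows "\<not> asymptotic_value f None"
proof
  assume asym: "asymptotic_value f None"
  then have "\<not> rational_function f"
    by (simp add: asymptotic_value_def)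
  then interpret transcendental_meromorphic f
    by unfold_locales (use assms(1) in auto)
  obtain R0 where R0: "\<And>w. w \<in> sing_inverse f \<Longrightarrow> cmod w \<le> R0"
    using assms(3) unfolding class_B_def bounded_iff by blast
  define R where "R = max 1 R0"
  have sing: "cmod w \<le> R" if "w \<in> finite_critical_values f \<union> {a. asymptotic_value f (Some a)}" for w
  proof -
    have "w \<in> sing_inverse f"
      unfolding sing_inverse_def using that by (rule subsetD [OF closure_subset])
    then show ?thesis using R0 [of w] by (simp add: R_def)
  qed
  interpret meromorphic_outside_singular_disc f R
  proof
    show "1 \<le> R" by (simp add: R_def)
    show "deriv f z \<noteq> 0" if "z \<in> \<Omega>" "R < cmod (f z)" for z
    proof
      assume "deriv f z = 0"
      then have "f z \<in> finite_critical_values f"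
        using that(1) by (auto simp: finite_critical_values_def \<Omega>_def)
      then show False using sing [of "f z"] that(2) by auto
    qed
    show "\<not> asymptotic_value f (Some w)" if "R < cmod w" for w
      using sing [of w] that by auto
  qed
  obtain G where G: "G holomorphic_on half_plane" "inj_on G half_plane"
      "\<And>B. \<exists>N. \<forall>z. N < Re z \<longrightarrow> B < cmod (G z)"
      "\<And>z. z \<in> half_plane \<Longrightarrow> G z \<in> \<Omega>" "\<And>z. z \<in> half_plane \<Longrightarrow> f (G z) = exp z"
    using logarithmic_tract [OF asym] by blast
  define \<C> where "\<C> = components finite_fatou"
  have card: "card \<C> = 2"
    using assms(6) unfolding fatou_set_eq card_components_riemann_sphere \<C>_def .
  then have "finite \<C>" by (simp add: card_ge_0_finite)
  then obtain \<sigma> where \<sigma>: "bij_betw \<sigma> \<C> \<C>"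
    and pre: "\<And>C z. \<lbrakk>C \<in> \<C>; z \<in> \<Omega>; f z \<in> \<sigma> C\<rbrakk> \<Longrightarrow> z \<in> C"
    using components_permuted unfolding \<C>_def by metis
  have open\<C>: "open C" and ne\<C>: "C \<noteq> {}" and conn\<C>: "connected C" if "C \<in> \<C>" for C
    using in_components_connected [of C finite_fatou] in_components_nonempty [of C finite_fatou]
      open_components [OF open_finite_fatou, of C] that
    by (simp_all add: \<C>_def)
  have \<sigma>\<C>: "\<sigma> C \<in> \<C>" if "C \<in> \<C>" for C
    using \<sigma> that by (auto simp: bij_betw_def)
  \<comment> \<open>\<open>f\<close> takes values in the open set \<open>\<sigma> C\<close>
    arbitrarily near infinity, and the points where it does so belong to \<open>C\<close>.\<close>
  have unb: "\<exists>z\<in>C. r < cmod z" if C: "C \<in> \<C>" for C r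
    using dense_values_near_infinity [OF open\<C> ne\<C>, OF \<sigma>\<C> \<sigma>\<C>, OF C C, of r] pre [OF C] by blast
  obtain U U' where UU': "\<C> = {U, U'}" "U \<noteq> U'"
    using card by (auto simp: card_2_iff)
  then have U: "U \<in> \<C>" "U' \<in> \<C>" by auto
  have disj: "U \<inter> U' = {}"
    using components_nonoverlap [of U finite_fatou U'] U UU'(2) by (simp add: \<C>_def)
  \<comment> \<open>The roles are assigned through \<open>\<sigma>\<close>, so that \<open>G\<close>
    carries the logarithms of points of \<open>A\<close> into \<open>U\<close> and those of
    \<open>A'\<close> into \<open>U'\<close>.\<close>
  define A A' where "A = \<sigma> U" and "A' = \<sigma> U'"
  have A: "A \<in> \<C>" "A' \<in> \<C>" using \<sigma>\<C> U by (auto simp: A_def A'_def)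
  define J where "J = - finite_fatou"
  have J: "J = {z. Some z \<in> julia_set f}"
    by (auto simp: J_def julia_set_def finite_fatou_def)
  have "\<exists>p. \<forall>n. connected_component (A \<inter> {w. R * exp (real n) < cmod w}) (p n) (p (Suc n))"
  proof (rule unbounded_component_accessible)
    show "closed J" using open_finite_fatou by (simp add: J_def closed_Compl)
    show "A \<in> components (- J)" using A by (simp add: J_def \<C>_def)
    show "\<not> bounded A"
    proof
      assume "bounded A"
      then obtain r where "\<And>z. z \<in> A \<Longrightarrow> cmod z \<le> r" by (auto simp: bounded_iff)
      with unb [OF A(1), of r] show False by force
    qed
    show "\<exists>d>0. \<exists>N. connected N \<and> N \<subseteq> J \<inter> ball x e \<and> J \<inter> ball x d \<subseteq> N" if "x \<in> J" "0 < e" for x e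
      by (rule locally_connected_finite_part [OF assms(5) J that])
    show "mono (\<lambda>n. R * exp (real n))"
      using R by (intro monoI mult_left_mono) auto
  qed
  then obtain p where "\<And>n. connected_component (A \<inter> {w. R * exp (real n) < cmod w}) (p n) (p (Suc n))"
    by blast
  then obtain a where a: "\<And>n. connected_component {z. Re z > ln R \<and> Re z > real n \<and> exp z \<in> A} (a n) (a (Suc n))"
    using log_lift_access [OF open\<C> [OF A(1)] R] by blast
  show False
  proof (rule no_disjoint_unbounded_domains_in_tract [OF G(1-3) open\<C> conn\<C> open\<C> conn\<C> disj open\<C>, OF U(1) U(1) U(2) U(2) A(1)])
    show "G z \<in> U" if "ln R < Re z" "exp z \<in> A" for z
      using pre [OF U(1) G(4)] G(5) [of z] that by (simp add: A_def)
    show "G z \<in> U'" if "ln R < Re z" "exp z \<in> A'" for z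
      using pre [OF U(2) G(4)] G(5) [of z] that by (simp add: A'_def)
    show "\<exists>w\<in>A'. r < cmod w" for r
      by (rule unb [OF A(2)])
  qed (rule a)
qed

end
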